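(* Let $K$ be a compact subset of the open unit disk in $\mathbb{C}$ such that $R(K)$ is non-trivial (i.e. $R(K)\ne C(K)$) and $R(K)$ does not admit any non-trivial Jensen measures. Set $A:=R(K)$, $X_K:=\{(z,w)\in\mathbb{C}^2: z\in K,\ |z|^2+|w|^2=1\}$ and $B:=R(X_K)$. Then: (a) the algebra $B$ is natural on $X_K$; (b) the circle group $\mathbb{T}$ acts continuously on $X_K$ via the formula $s\cdot(z,w)=(z,sw)$ $(s\in\mathbb{T},\ (z,w)\in X_K)$; (c) the algebra $B$ is a generalised Cole extension of $A$ implemented by $\mathbb{T}$ (with the action in (b)).
   Context: A compact space is a non-empty compact Hausdorff space. $C(X)$ is the algebra of continuous complex-valued functions on $X$ with the uniform norm. A uniform algebra on $X$ is a closed subalgebra of $C(X)$ that contains the constants and separates the points of $X$. It is natural on $X$ if every character on it is a point evaluation at a point of $X$. For a compact $X\subseteq\mathbb{C}^n$, $R(X)$ is the uniform closure in $C(X)$ of the algebra of restrictions to $X$ of rational functions with no poles on $X$. A Jensen measure for a character $\varphi$ on a uniform algebra $A$ on $X$ is a regular Borel probability measure $\mu$ on $X$ with $\log|\varphi(f)|\le\int_X\log|f|\,d\mu$ for all $f\in A$. It is trivial if it is the point mass at some $x\in X$. $A$ admits no non-trivial Jensen measures if every Jensen measure for every character on $A$ is trivial. For a continuous surjection $\Pi:Y\to X$ of compact spaces, $\Pi^*(f)=f\circ\Pi$ $(f\in C(X))$. A uniform algebra $B$ on $Y$ is a generalised Cole extension of a uniform algebra $A$ on $X$ if there exist a continuous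 surjection $\Pi:Y\to X$ and a unital linear map $T:C(Y)\to C(X)$ with $\|T\|=1$ such that $T\circ\Pi^*=\mathrm{id}_{C(X)}$ and $T(B)=A$. It is implemented by a compact group $G$ (with normalised Haar measure $\mu$) acting continuously (i.e. jointly continuously) on $Y$ if, moreover, $G\cdot y=\Pi^{-1}(\{\Pi(y)\})$ for all $y\in Y$, and $T(f)(\Pi(y))=\int_G f(s\cdot y)\,d\mu(s)$ for all $f\in B$, $y\in Y$. *)

theory Defs
  imports "HOL-Probability.Probability" "HOL-Algebra.Group_Action"
begin

text \<open>
  A compact space is a non-empty compact subset \<open>X\<close> of a Hausdorff type.  The elements of
  \<open>C(X)\<close> are represented by extensional functions (fixed junk value off \<open>X\<close>), so that two
  elements are equal iff they agree on \<open>X\<close>; hence the use of \<open>restrict\<close> in the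
  algebra operations below.
\<close>

abbreviation cfun_metric :: "'a::t2_space set \<Rightarrow> ('a \<Rightarrow> complex) metric" where
  "cfun_metric X \<equiv> cfunspace (top_of_set X) euclidean_metric"

abbreviation cfun :: "'a::t2_space set \<Rightarrow> ('a \<Rightarrow> complex) set" where
  "cfun X \<equiv> mspace (cfun_metric X)"

lemma cfun_eq:
  assumes "compact X"
  shows "cfun X = {f \<in> extensional X. continuous_on X f}"
proof -
  have "compactin (top_of_set X) (topspace (top_of_set X))"
    using assms by (simp add: compactin_subtopology)
  then show ?thesis
    using assms
    by (auto simp: compactin_mspace_cfunspace PiE_def intro: compact_imp_bounded compact_continuous_image)
qed

definition sup_norm :: "'a set \<Rightarrow> ('a \<Rightarrow> complex) \<Rightarrow> real" where
  "sup_norm X f = (SUP x\<in>X. cmod (f x))"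

text \<open>Closure under scalar multiples follows from containing constants and closure under products.\<close>

definition uniform_algebra :: "'a::t2_space set \<Rightarrow> ('a \<Rightarrow> complex) set \<Rightarrow> bool" where
  "uniform_algebra X A \<longleftrightarrow>
     compact X \<and> X \<noteq> {} \<and> A \<subseteq> cfun X \<and>
     (\<forall>c. (\<lambda>x\<in>X. c) \<in> A) \<and>
     (\<forall>f\<in>A. \<forall>g\<in>A. (\<lambda>x\<in>X. f x + g x) \<in> A) \<and>
     (\<forall>f\<in>A. \<forall>g\<in>A. (\<lambda>x\<in>X. f x * g x) \<in> A) \<and>
     (\<forall>x\<in>X. \<forall>y\<in>X. x \<noteq> y \<longrightarrow> (\<exists>f\<in>A. f x \<noteq> f y)) \<and>
     closedin (mtopology_of (cfun_metric X)) A"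

definition linear_on_algebra ::
    "'a set \<Rightarrow> ('a \<Rightarrow> complex) set \<Rightarrow> (('a \<Rightarrow> complex) \<Rightarrow> complex) \<Rightarrow> bool" where
  "linear_on_algebra X A \<phi> \<longleftrightarrow>
     (\<forall>f\<in>A. \<forall>g\<in>A. \<phi> (\<lambda>x\<in>X. f x + g x) = \<phi> f + \<phi> g) \<and>
     (\<forall>c. \<forall>f\<in>A. \<phi> (\<lambda>x\<in>X. c * f x) = c * \<phi> f)"

definition algebra_character ::
    "'a set \<Rightarrow> ('a \<Rightarrow> complex) set \<Rightarrow> (('a \<Rightarrow> complex) \<Rightarrow> complex) \<Rightarrow> bool" where
  "algebra_character X A \<phi> \<longleftrightarrow>
     linear_on_algebra X A \<phi> \<and>
     (\<forall>f\<in>A. \<forall>g\<in>A. \<phi> (\<lambda>x\<in>X. f x * g x) = \<phi> f * \<phi> g) \<and>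
     (\<exists>f\<in>A. \<phi> f \<noteq> 0)"

definition natural_on :: "'a set \<Rightarrow> ('a \<Rightarrow> complex) set \<Rightarrow> bool" where
  "natural_on X A \<longleftrightarrow> (\<forall>\<phi>. algebra_character X A \<phi> \<longrightarrow> (\<exists>x\<in>X. \<forall>f\<in>A. \<phi> f = f x))"

text \<open>
  Polynomials in several complex variables, as functions on a space on which \<open>Z\<close> is the set
  of coordinate functions: \<open>{\<lambda>z. z}\<close> for the complex plane, \<open>{fst, snd}\<close> for its square.
\<close>

inductive_set polynomial_funs :: "('a \<Rightarrow> complex) set \<Rightarrow> ('a \<Rightarrow> complex) set"
  for Z :: "('a \<Rightarrow> complex) set" where
  const: "(\<lambda>_. c) \<in> polynomial_funs Z"
| coord: "z \<in> Z \<Longrightarrow> z \<in> polynomial_funs Z"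
| add: "p \<in> polynomial_funs Z \<Longrightarrow> q \<in> polynomial_funs Z \<Longrightarrow> (\<lambda>x. p x + q x) \<in> polynomial_funs Z"
| mult: "p \<in> polynomial_funs Z \<Longrightarrow> q \<in> polynomial_funs Z \<Longrightarrow> (\<lambda>x. p x * q x) \<in> polynomial_funs Z"

definition rational_funs :: "('a \<Rightarrow> complex) set \<Rightarrow> 'a set \<Rightarrow> ('a \<Rightarrow> complex) set" where
  "rational_funs Z X =
     {\<lambda>x\<in>X. p x / q x | p q. p \<in> polynomial_funs Z \<and> q \<in> polynomial_funs Z \<and> (\<forall>x\<in>X. q x \<noteq> 0)}"

definition R_alg :: "('a::t2_space \<Rightarrow> complex) set \<Rightarrow> 'a set \<Rightarrow> ('a \<Rightarrow> complex) set" where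
  "R_alg Z X = mtopology_of (cfun_metric X) closure_of rational_funs Z X"

abbreviation R_1 :: "complex set \<Rightarrow> (complex \<Rightarrow> complex) set" where
  "R_1 \<equiv> R_alg {\<lambda>z. z}"

abbreviation R_2 :: "(complex \<times> complex) set \<Rightarrow> (complex \<times> complex \<Rightarrow> complex) set" where
  "R_2 \<equiv> R_alg {fst, snd}"

definition regular_borel_prob :: "'a::t2_space set \<Rightarrow> 'a measure \<Rightarrow> bool" where
  "regular_borel_prob X \<mu> \<longleftrightarrow>
     sets \<mu> = sets (restrict_space borel X) \<and> prob_space \<mu> \<and>
     (\<forall>E\<in>sets \<mu>.
        emeasure \<mu> E = (SUP C\<in>{C. compact C \<and> C \<subseteq> E}. emeasure \<mu> C) \<and>
        emeasure \<mu> E = (INF U\<in>{U. openin (top_of_set X) U \<and> E \<subseteq> U}. emeasure \<mu> U))"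

text \<open>
  The logarithm with value \<open>-\<infinity>\<close> at \<open>0\<close> (the library has \<open>ln 0 = 0\<close>), and the integral,
  possibly \<open>-\<infinity>\<close>, of a function that is bounded above: the first term is then finite, and
  \<open>e2ennreal\<close> maps negative values to \<open>0\<close>.
\<close>

definition elog :: "real \<Rightarrow> ereal" where
  "elog r = (if r = 0 then -\<infinity> else ereal (ln r))"

definition eintegral :: "'a measure \<Rightarrow> ('a \<Rightarrow> ereal) \<Rightarrow> ereal" where
  "eintegral \<mu> g =
     enn2ereal (\<integral>\<^sup>+x. e2ennreal (g x) \<partial>\<mu>) - enn2ereal (\<integral>\<^sup>+x. e2ennreal (- g x) \<partial>\<mu>)"

definition jensen_measure ::
    "'a::t2_space set \<Rightarrow> ('a \<Rightarrow> complex) set \<Rightarrow> (('a \<Rightarrow> complex) \<Rightarrow> complex) \<Rightarrow> 'a measure \<Rightarrow> bool" where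
  "jensen_measure X A \<phi> \<mu> \<longleftrightarrow>
     regular_borel_prob X \<mu> \<and>
     (\<forall>f\<in>A. elog (cmod (\<phi> f)) \<le> eintegral \<mu> (\<lambda>x. elog (cmod (f x))))"

definition no_nontrivial_jensen_measures :: "'a::t2_space set \<Rightarrow> ('a \<Rightarrow> complex) set \<Rightarrow> bool" where
  "no_nontrivial_jensen_measures X A \<longleftrightarrow>
     (\<forall>\<phi> \<mu>. algebra_character X A \<phi> \<and> jensen_measure X A \<phi> \<mu> \<longrightarrow>
        (\<exists>x\<in>X. \<mu> = return (restrict_space borel X) x))"

definition unital_linear_map ::
    "'b::t2_space set \<Rightarrow> 'a::t2_space set \<Rightarrow> (('b \<Rightarrow> complex) \<Rightarrow> ('a \<Rightarrow> complex)) \<Rightarrow> bool" where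
  "unital_linear_map Y X T \<longleftrightarrow>
     T \<in> cfun Y \<rightarrow> cfun X \<and>
     (\<forall>f\<in>cfun Y. \<forall>g\<in>cfun Y. T (\<lambda>y\<in>Y. f y + g y) = (\<lambda>x\<in>X. T f x + T g x)) \<and>
     (\<forall>c. \<forall>f\<in>cfun Y. T (\<lambda>y\<in>Y. c * f y) = (\<lambda>x\<in>X. c * T f x)) \<and>
     T (\<lambda>y\<in>Y. 1) = (\<lambda>x\<in>X. 1)"

text \<open>Boundedness is stated separately since \<open>Sup\<close> of an unbounded set of reals is unspecified.\<close>

definition has_op_norm ::
    "'b::t2_space set \<Rightarrow> 'a::t2_space set \<Rightarrow> (('b \<Rightarrow> complex) \<Rightarrow> ('a \<Rightarrow> complex)) \<Rightarrow> real \<Rightarrow> bool" where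
  "has_op_norm Y X T r \<longleftrightarrow>
     (let S = {sup_norm X (T f) | f. f \<in> cfun Y \<and> sup_norm Y f \<le> 1}
      in bdd_above S \<and> Sup S = r)"

definition cole_extension_via ::
    "'b::t2_space set \<Rightarrow> ('b \<Rightarrow> complex) set \<Rightarrow> 'a::t2_space set \<Rightarrow> ('a \<Rightarrow> complex) set \<Rightarrow>
     ('b \<Rightarrow> 'a) \<Rightarrow> (('b \<Rightarrow> complex) \<Rightarrow> ('a \<Rightarrow> complex)) \<Rightarrow> bool" where
  "cole_extension_via Y B X A \<pi> T \<longleftrightarrow>
     uniform_algebra Y B \<and> uniform_algebra X A \<and>
     continuous_on Y \<pi> \<and> \<pi> ` Y = X \<and>
     unital_linear_map Y X T \<and> has_op_norm Y X T 1 \<and>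
     (\<forall>f\<in>cfun X. T (\<lambda>y\<in>Y. f (\<pi> y)) = f) \<and>
     T ` B = A"

definition generalised_cole_extension ::
    "'b::t2_space set \<Rightarrow> ('b \<Rightarrow> complex) set \<Rightarrow> 'a::t2_space set \<Rightarrow> ('a \<Rightarrow> complex) set \<Rightarrow> bool" where
  "generalised_cole_extension Y B X A \<longleftrightarrow> (\<exists>\<pi> T. cole_extension_via Y B X A \<pi> T)"

definition compact_group :: "('g::t2_space, 'm) monoid_scheme \<Rightarrow> bool" where
  "compact_group G \<longleftrightarrow>
     group G \<and> compact (carrier G) \<and>
     continuous_on (carrier G \<times> carrier G) (\<lambda>(s, t). s \<otimes>\<^bsub>G\<^esub> t) \<and>
     continuous_on (carrier G) (\<lambda>s. inv\<^bsub>G\<^esub> s)"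

definition normalised_haar_measure :: "('g::t2_space, 'm) monoid_scheme \<Rightarrow> 'g measure \<Rightarrow> bool" where
  "normalised_haar_measure G \<mu> \<longleftrightarrow>
     regular_borel_prob (carrier G) \<mu> \<and>
     (\<forall>s\<in>carrier G. \<forall>E\<in>sets \<mu>. emeasure \<mu> (s <#\<^bsub>G\<^esub> E) = emeasure \<mu> E)"

definition continuous_action ::
    "('g::t2_space, 'm) monoid_scheme \<Rightarrow> 'b::t2_space set \<Rightarrow> ('g \<Rightarrow> 'b \<Rightarrow> 'b) \<Rightarrow> bool" where
  "continuous_action G Y \<alpha> \<longleftrightarrow>
     group_action G Y \<alpha> \<and> continuous_on (carrier G \<times> Y) (\<lambda>(s, y). \<alpha> s y)"

text \<open>The normalised Haar measure exists and is unique, so the quantifier over \<open>\<mu>\<close> merely names it.\<close>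

definition cole_extension_implemented_by ::
    "'b::t2_space set \<Rightarrow> ('b \<Rightarrow> complex) set \<Rightarrow> 'a::t2_space set \<Rightarrow> ('a \<Rightarrow> complex) set \<Rightarrow>
     ('g::t2_space, 'm) monoid_scheme \<Rightarrow> ('g \<Rightarrow> 'b \<Rightarrow> 'b) \<Rightarrow> bool" where
  "cole_extension_implemented_by Y B X A G \<alpha> \<longleftrightarrow>
     compact_group G \<and> continuous_action G Y \<alpha> \<and>
     (\<exists>\<pi> T \<mu>. cole_extension_via Y B X A \<pi> T \<and> normalised_haar_measure G \<mu> \<and>
        (\<forall>y\<in>Y. orbit G \<alpha> y = {y' \<in> Y. \<pi> y' = \<pi> y}) \<and>
        (\<forall>f\<in>B. \<forall>y\<in>Y. T f (\<pi> y) = (\<integral>s. f (\<alpha> s y) \<partial>\<mu>)))"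

definition circle_group :: "complex monoid" where
  "circle_group = \<lparr>carrier = sphere 0 1, mult = (*), one = 1\<rparr>"

definition X_over :: "complex set \<Rightarrow> (complex \<times> complex) set" where
  "X_over K = {(z, w). z \<in> K \<and> (cmod z)\<^sup>2 + (cmod w)\<^sup>2 = 1}"

definition circle_act :: "complex set \<Rightarrow> complex \<Rightarrow> complex \<times> complex \<Rightarrow> complex \<times> complex" where
  "circle_act K s = (\<lambda>(z, w)\<in>X_over K. (z, s * w))"

end

theory Submission
  imports Defs "HOL-Complex_Analysis.Complex_Analysis"
begin

text \<open>
  The space \<open>X_over K\<close> is a circle bundle over \<open>K\<close>: the fibre over \<open>z\<close> is the circle of radius
  \<open>r z = sqrt (1 - (cmod z)\<^sup>2)\<close>, which is positive because \<open>K\<close> lies in the open disc.  The circle group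
  acts simply transitively on each fibre, so the only substantial claims are naturality and the
  identity \<open>T(B) = A\<close> for the operator \<open>T\<close> that averages a function over the fibres.

  \<^bold>\<open>Naturality.\<close>  Let \<open>\<phi>\<close> be a character of \<open>B\<close>, with values \<open>a\<close> and \<open>b\<close> on the two coordinates.  As \<open>B\<close>
  is inverse-closed, \<open>\<phi> f\<close> is always a value of \<open>f\<close>; hence \<open>a \<in> K\<close>, \<open>b \<noteq> 0\<close>, and \<open>\<phi>\<close> is evaluation at
  \<open>(a, b)\<close> as soon as this point lies in \<open>X_over K\<close> (\<open>character_eq_evaluation\<close>), that is, once
  \<open>cmod b = r a\<close>.  Applied to \<open>f(z) w\<^sup>k\<close>, where \<open>f \<in> A\<close>, the same fact shows that
  \<open>k ln (cmod b) + ln (cmod (f a)) \<le> sup (k ln r + ln (cmod f))\<close> over \<open>K\<close>, for all \<open>k\<close>.  A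
  Hahn-Banach argument turns these inequalities into a Jensen measure \<open>\<mu>\<close> for \<open>a\<close> with
  \<open>ln (cmod b) \<le> \<integral> ln r d\<mu>\<close> (\<open>Jensen_measure_exists\<close>).  By hypothesis \<open>\<mu>\<close> is the point mass at \<open>a\<close>, so
  \<open>cmod b \<le> r a\<close>.  The function \<open>1/w\<close> also belongs to \<open>B\<close> and gives the reverse inequality.

  \<^bold>\<open>Representing measures.\<close>  The functional is obtained from a maximal additive cone of bounded
  functions (\<open>positive_functional_extension\<close>), and is defined on all bounded functions on \<open>K\<close>, so it
  can be discretised along partitions of \<open>K\<close> into arbitrarily small sets.  The resulting
  finitely supported measures are lifted to the unit interval along a continuous surjection onto a square
  containing \<open>K\<close>; Helly's selection theorem on the line gives a limit, whose image represents the functional on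
  continuous functions (\<open>Riesz_representation_compact_plane\<close>).

  \<^bold>\<open>Averaging.\<close>  Pulling back along \<open>(z, w) \<mapsto> z\<close> embeds \<open>A\<close> in \<open>B\<close>, and \<open>T\<close> inverts this embedding, so
  \<open>A \<subseteq> T(B)\<close>.  For the converse it suffices to average a rational function \<open>p/q\<close>.  Near a point of \<open>K\<close>,
  Cauchy's theorem in the variable \<open>w\<close> lets one replace the circle of radius \<open>r z\<close> by a circle of fixed radius,
  after which the average is visibly holomorphic in \<open>z\<close>.  So the average extends holomorphically to a
  neighbourhood of \<open>K\<close> and lies in \<open>R(K)\<close> by Runge's theorem (\<open>Runge_R_1\<close>), proved here by
  the Cauchy integral formula on a grid of squares.
\<close>

section \<open>Uniform closures of rational functions\<close>

lemma polynomial_funs_continuous_on: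
  assumes "\<And>z. z \<in> Z \<Longrightarrow> continuous_on X z" and "p \<in> polynomial_funs Z"
  shows "continuous_on X p"
  using assms(2)
proof induction
  case (coord z)
  then show ?case by (rule assms(1))
qed (intro continuous_intros; assumption)+

locale continuous_coordinates =
  fixes Z :: "('a::t2_space \<Rightarrow> complex) set" and X :: "'a set"
  assumes compact_space: "compact X"
    and continuous_coord: "z \<in> Z \<Longrightarrow> continuous_on X z"
begin

abbreviation "A \<equiv> R_alg Z X"

lemma cfun_iff: "f \<in> cfun X \<longleftrightarrow> f \<in> extensional X \<and> continuous_on X f"
  unfolding cfun_eq[OF compact_space] by blast

lemma rational_funs_subset_cfun: "rational_funs Z X \<subseteq> cfun X"
proof -
  have "continuous_on X (\<lambda>x\<in>X. p x / q x)"
    if "p \<in> polynomial_funs Z" "q \<in> polynomial_funs Z" "\<forall>x\<in>X. q x \<noteq> 0" for p q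
  proof -
    have "continuous_on X (\<lambda>x. p x / q x)"
      using that by (intro continuous_intros polynomial_funs_continuous_on[OF continuous_coord]) auto
    then show ?thesis
      by (simp cong: continuous_on_cong)
  qed
  then show ?thesis
    unfolding rational_funs_def cfun_iff subset_iff by auto
qed

lemma mem_iff_approx:
  "f \<in> A \<longleftrightarrow> f \<in> cfun X \<and> (\<forall>e>0. \<exists>r\<in>rational_funs Z X. \<forall>x\<in>X. cmod (f x - r x) \<le> e)"
proof -
  interpret Metric_space "cfun X" "mdist (cfun_metric X)"
    by (rule Metric_space_mspace_mdist)
  have lt: "mdist (cfun_metric X) f r < e" if "0 < e" "\<forall>x\<in>X. cmod (f x - r x) \<le> e / 2" for f r e
  proof -
    have "mdist (cfun_metric X) f r \<le> e / 2"
      using that by (intro mdist_cfunspace_le) (auto simp: dist_norm)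
    then show ?thesis using that(1) by simp
  qed
  have le: "\<forall>x\<in>X. cmod (f x - r x) \<le> e"
    if "f \<in> cfun X" "r \<in> cfun X" "mdist (cfun_metric X) f r < e" for f r e
    using mdist_cfunspace_imp_mdist_le[OF that(1,2) less_imp_le[OF that(3)]] by (auto simp: dist_norm)
  have "A = mtopology closure_of rational_funs Z X"
    by (simp add: R_alg_def mtopology_of_def)
  then have "f \<in> A \<longleftrightarrow> f \<in> cfun X \<and>
      (\<forall>e>0. \<exists>r\<in>rational_funs Z X. mdist (cfun_metric X) f r < e)"
    using rational_funs_subset_cfun unfolding metric_closure_of by (fastforce simp del: mspace_cfunspace)
  moreover have "(\<forall>e>0. \<exists>r\<in>rational_funs Z X. mdist (cfun_metric X) f r < e) \<longleftrightarrow>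
      (\<forall>e>0. \<exists>r\<in>rational_funs Z X. \<forall>x\<in>X. cmod (f x - r x) \<le> e)" if "f \<in> cfun X"
    using lt le[OF that] rational_funs_subset_cfun by (meson half_gt_zero subsetD)
  ultimately show ?thesis by blast
qed

lemma rational_mem: "r \<in> rational_funs Z X \<Longrightarrow> r \<in> A"
  using rational_funs_subset_cfun unfolding mem_iff_approx
  by (auto simp del: mspace_cfunspace intro!: bexI[of _ r])

lemma mem_iff_uniform_limit:
  "f \<in> A \<longleftrightarrow> f \<in> cfun X \<and> (\<exists>r. range r \<subseteq> rational_funs Z X \<and> uniform_limit X r f sequentially)"
  (is "_ \<longleftrightarrow> _ \<and> ?R")
proof -
  have "(\<forall>e>0. \<exists>r\<in>rational_funs Z X. \<forall>x\<in>X. cmod (f x - r x) \<le> e) \<longleftrightarrow> ?R"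
  proof
    assume *: "\<forall>e>0. \<exists>r\<in>rational_funs Z X. \<forall>x\<in>X. cmod (f x - r x) \<le> e"
    have "\<forall>n. \<exists>r\<in>rational_funs Z X. \<forall>x\<in>X. cmod (f x - r x) \<le> inverse (Suc n)"
      using * by (auto simp del: of_nat_Suc)
    then obtain r where r: "\<And>n. r n \<in> rational_funs Z X"
      and le: "\<And>n x. x \<in> X \<Longrightarrow> cmod (f x - r n x) \<le> inverse (Suc n)"
      by metis
    have "uniform_limit X r f sequentially"
    proof (rule uniform_limitI)
      fix e :: real assume "0 < e"
      then have "\<forall>\<^sub>F n in sequentially. inverse (real (Suc n)) < e"
        by (rule order_tendstoD(2)[OF LIMSEQ_inverse_real_of_nat])
      then show "\<forall>\<^sub>F n in sequentially. \<forall>x\<in>X. dist (r n x) (f x) < e"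
      proof eventually_elim
        case (elim n)
        then show ?case using le[of _ n] by (auto simp: dist_norm norm_minus_commute intro: le_less_trans)
      qed
    qed
    with r show ?R by blast
  next
    assume ?R
    then obtain r where r: "\<And>n. r n \<in> rational_funs Z X" and lim: "uniform_limit X r f sequentially"
      by blast
    show "\<forall>e>0. \<exists>r\<in>rational_funs Z X. \<forall>x\<in>X. cmod (f x - r x) \<le> e"
    proof (intro allI impI)
      fix e :: real assume "0 < e"
      then obtain n where "\<forall>x\<in>X. dist (r n x) (f x) < e"
        using uniform_limitD[OF lim] eventually_happens' sequentially_bot by blast
      then show "\<exists>r\<in>rational_funs Z X. \<forall>x\<in>X. cmod (f x - r x) \<le> e"
        using r by (intro bexI[of _ "r n"]) (auto simp: dist_norm norm_minus_commute less_imp_le)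
    qed
  qed
  then show ?thesis unfolding mem_iff_approx by blast
qed

lemma rational_funsI:
  assumes "p \<in> polynomial_funs Z" "q \<in> polynomial_funs Z" "\<forall>x\<in>X. q x \<noteq> 0" "\<And>x. x \<in> X \<Longrightarrow> f x = p x / q x"
  shows "restrict f X \<in> rational_funs Z X"
proof -
  have "restrict f X = (\<lambda>x\<in>X. p x / q x)"
    using assms(4) by auto
  then show ?thesis
    using assms unfolding rational_funs_def by blast
qed

lemma rational_funsE:
  assumes "r \<in> rational_funs Z X"
  obtains p q where "p \<in> polynomial_funs Z" "q \<in> polynomial_funs Z" "\<forall>x\<in>X. q x \<noteq> 0" 
    "r \<in> extensional X" "\<And>x. x \<in> X \<Longrightarrow> r x = p x / q x"
  using assms unfolding rational_funs_def by auto

lemma rational_add: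
  assumes "r \<in> rational_funs Z X" "s \<in> rational_funs Z X"
  shows "(\<lambda>x\<in>X. r x + s x) \<in> rational_funs Z X"
proof -
  obtain p q p' q' where *: "p \<in> polynomial_funs Z" "q \<in> polynomial_funs Z" "\<forall>x\<in>X. q x \<noteq> 0" 
    "\<And>x. x \<in> X \<Longrightarrow> r x = p x / q x" "p' \<in> polynomial_funs Z" "q' \<in> polynomial_funs Z" "\<forall>x\<in>X. q' x \<noteq> 0" 
    "\<And>x. x \<in> X \<Longrightarrow> s x = p' x / q' x"
    using assms rational_funsE by metis
  show ?thesis
    by (rule rational_funsI[of "\<lambda>x. p x * q' x + p' x * q x" "\<lambda>x. q x * q' x"])
      (use * in \<open>auto intro!: polynomial_funs.add polynomial_funs.mult simp: add_frac_eq\<close>)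
qed

lemma rational_mult:
  assumes "r \<in> rational_funs Z X" "s \<in> rational_funs Z X"
  shows "(\<lambda>x\<in>X. r x * s x) \<in> rational_funs Z X"
proof -
  obtain p q p' q' where *: "p \<in> polynomial_funs Z" "q \<in> polynomial_funs Z" "\<forall>x\<in>X. q x \<noteq> 0" 
    "\<And>x. x \<in> X \<Longrightarrow> r x = p x / q x" "p' \<in> polynomial_funs Z" "q' \<in> polynomial_funs Z" "\<forall>x\<in>X. q' x \<noteq> 0" 
    "\<And>x. x \<in> X \<Longrightarrow> s x = p' x / q' x"
    using assms rational_funsE by metis
  show ?thesis
    by (rule rational_funsI[of "\<lambda>x. p x * p' x" "\<lambda>x. q x * q' x"])
      (use * in \<open>auto intro!: polynomial_funs.mult\<close>)
qed

lemma rational_inverse: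
  assumes "r \<in> rational_funs Z X" "\<forall>x\<in>X. r x \<noteq> 0"
  shows "(\<lambda>x\<in>X. inverse (r x)) \<in> rational_funs Z X"
proof -
  obtain p q where *: "p \<in> polynomial_funs Z" "q \<in> polynomial_funs Z" "\<forall>x\<in>X. q x \<noteq> 0" 
    "\<And>x. x \<in> X \<Longrightarrow> r x = p x / q x"
    using assms rational_funsE by metis
  show ?thesis
    by (rule rational_funsI[of q p]) (use * assms(2) in auto)
qed

lemma polynomial_mem:
  assumes "p \<in> polynomial_funs Z" shows "restrict p X \<in> A"
proof -
  have "restrict p X \<in> rational_funs Z X"
    by (rule rational_funsI[of p "\<lambda>_. 1"]) (use assms in \<open>auto intro: polynomial_funs.const\<close>)
  then show ?thesis by (rule rational_mem)
qed

lemma const_mem: "(\<lambda>x\<in>X. c) \<in> A"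
  by (rule polynomial_mem) (rule polynomial_funs.const)

lemma coord_mem: "z \<in> Z \<Longrightarrow> restrict z X \<in> A"
  by (rule polynomial_mem) (rule polynomial_funs.coord)

lemma mem_cfun: "f \<in> A \<Longrightarrow> f \<in> cfun X"
  unfolding mem_iff_approx by blast

lemma mem_continuous: "f \<in> A \<Longrightarrow> continuous_on X f"
  using mem_cfun cfun_iff by blast

lemma mem_bounded: "f \<in> A \<Longrightarrow> bounded (f ` X)"
  by (simp add: mem_continuous compact_continuous_image compact_imp_bounded compact_space)

lemma uniform_limit_mem:
  assumes "continuous_on X f" "\<And>n::nat. r n \<in> rational_funs Z X" "uniform_limit X r f sequentially"
  shows "restrict f X \<in> A"
proof -
  have "uniform_limit X r (restrict f X) sequentially"
    using assms(3) by (rule uniform_limit_cong'[THEN iffD1, rotated -1]) auto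
  moreover have "continuous_on X (restrict f X)"
    using assms(1) by (simp cong: continuous_on_cong)
  ultimately show ?thesis
    using assms(2) unfolding mem_iff_uniform_limit cfun_iff by blast
qed

lemma add_mem:
  assumes "f \<in> A" "g \<in> A" shows "(\<lambda>x\<in>X. f x + g x) \<in> A"
proof -
  obtain r s where *: "\<And>n::nat. r n \<in> rational_funs Z X" "uniform_limit X r f sequentially"
     "\<And>n::nat. s n \<in> rational_funs Z X" "uniform_limit X s g sequentially"
    using assms unfolding mem_iff_uniform_limit by blast
  have "uniform_limit X (\<lambda>n. \<lambda>x\<in>X. r n x + s n x) (\<lambda>x. f x + g x) sequentially"
    using uniform_limit_add[OF *(2,4)] by (rule uniform_limit_cong'[THEN iffD1, rotated -1]) auto
  then show ?thesis
    by (rule uniform_limit_mem[rotated -1]) (use * assms in \<open>auto intro!: rational_add continuous_intros mem_continuous[OF assms(1)] mem_continuous[OF assms(2)]\<close>)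
qed

lemma mult_mem:
  assumes "f \<in> A" "g \<in> A" shows "(\<lambda>x\<in>X. f x * g x) \<in> A"
proof -
  obtain r s where *: "\<And>n::nat. r n \<in> rational_funs Z X" "uniform_limit X r f sequentially"
     "\<And>n::nat. s n \<in> rational_funs Z X" "uniform_limit X s g sequentially"
    using assms unfolding mem_iff_uniform_limit by blast
  have "uniform_limit X (\<lambda>n. \<lambda>x\<in>X. r n x * s n x) (\<lambda>x. f x * g x) sequentially"
    using uniform_lim_mult[OF *(2,4) mem_bounded[OF assms(1)] mem_bounded[OF assms(2)]]
    by (rule uniform_limit_cong'[THEN iffD1, rotated -1]) auto
  then show ?thesis
    by (rule uniform_limit_mem[rotated -1]) (use * assms in \<open>auto intro!: rational_mult continuous_intros mem_continuous[OF assms(1)] mem_continuous[OF assms(2)]\<close>)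
qed

text \<open>
  \<open>R(X)\<close> is inverse-closed: if rational functions converge uniformly to a function bounded away
  from \<open>0\<close>, they are eventually zero-free on \<open>X\<close>, so that their reciprocals are again rational
  functions without poles on \<open>X\<close>.  This is what bounds the
  characters of \<open>R(X)\<close>.
\<close>

lemma inverse_mem:
  assumes f: "f \<in> A" and nz: "\<forall>x\<in>X. f x \<noteq> 0" shows "(\<lambda>x\<in>X. inverse (f x)) \<in> A"
proof -
  obtain r where r: "\<And>n::nat. r n \<in> rational_funs Z X" "uniform_limit X r f sequentially"
    using f unfolding mem_iff_uniform_limit by blast
  obtain b where b: "0 < b" "\<And>x. x \<in> X \<Longrightarrow> b \<le> cmod (f x)"
  proof (cases "X = {}")
    case False
    have "continuous_on X (\<lambda>x. cmod (f x))"
      using f by (intro continuous_intros mem_continuous)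
    then obtain y where "y \<in> X" "\<forall>x\<in>X. cmod (f y) \<le> cmod (f x)"
      using continuous_attains_inf[OF compact_space False] by blast
    then show ?thesis using that[of "cmod (f y)"] nz by auto
  qed (use that[of 1] in auto)
  obtain N where N: "\<And>n x. N \<le> n \<Longrightarrow> x \<in> X \<Longrightarrow> dist (r n x) (f x) < b"
    using uniform_limitD[OF r(2) b(1)] unfolding eventually_sequentially by blast
  define s where "s n = r (n + N)" for n
  have "uniform_limit X s f sequentially"
    unfolding s_def using r(2) by (rule filterlim_compose) (rule filterlim_add_const_nat_at_top)
  from uniform_lim_inverse[OF this b(2,1)]
  have "uniform_limit X (\<lambda>n. \<lambda>x\<in>X. inverse (s n x)) (\<lambda>x. inverse (f x)) sequentially"
    by (rule uniform_limit_cong'[THEN iffD1, rotated -1]) auto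
  moreover have "s n x \<noteq> 0" if "x \<in> X" for n x
    using N[of "n + N" x] b(2)[OF that] that by (auto simp: s_def dist_norm)
  ultimately show ?thesis
    by (intro uniform_limit_mem[of _ "\<lambda>n. \<lambda>x\<in>X. inverse (s n x)"])
      (use r(1) f nz in \<open>auto simp: s_def intro!: rational_inverse continuous_intros mem_continuous[OF f]\<close>)
qed

lemma scale_mem: "f \<in> A \<Longrightarrow> (\<lambda>x\<in>X. c * f x) \<in> A"
  using mult_mem[OF const_mem[of c]] by (simp cong: restrict_cong add: restrict_apply' del: restrict_apply)

lemma power_mem: "f \<in> A \<Longrightarrow> (\<lambda>x\<in>X. f x ^ k) \<in> A"
proof (induction k)
  case 0
  then show ?case using const_mem[of 1] by (simp del: restrict_apply)
next
  case (Suc k)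
  then show ?case using mult_mem[of f "\<lambda>x\<in>X. f x ^ k"] by (simp cong: restrict_cong add: restrict_apply' del: restrict_apply)
qed

lemma closed_mem:
  assumes "f \<in> cfun X" "\<And>e. 0 < e \<Longrightarrow> \<exists>g\<in>A. \<forall>x\<in>X. cmod (f x - g x) \<le> e"
  shows "f \<in> A"
  unfolding mem_iff_approx
proof (intro conjI allI impI assms(1))
  fix e :: real assume "0 < e"
  then obtain g where g: "g \<in> A" "\<forall>x\<in>X. cmod (f x - g x) \<le> e/2"
    using assms(2)[of "e/2"] by auto
  then obtain r where r: "r \<in> rational_funs Z X" "\<forall>x\<in>X. cmod (g x - r x) \<le> e/2"
    using \<open>0 < e\<close> unfolding mem_iff_approx by (meson half_gt_zero)
  have "cmod (f x - r x) \<le> e" if "x \<in> X" for x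
    using norm_triangle_ineq[of "f x - g x" "g x - r x"] g(2) r(2) that by fastforce
  with r(1) show "\<exists>r\<in>rational_funs Z X. \<forall>x\<in>X. cmod (f x - r x) \<le> e" by blast
qed

lemma uniform_algebra_A:
  assumes "X \<noteq> {}" "\<And>x y. x \<in> X \<Longrightarrow> y \<in> X \<Longrightarrow> x \<noteq> y \<Longrightarrow> \<exists>z\<in>Z. z x \<noteq> z y"
  shows "uniform_algebra X A"
  unfolding uniform_algebra_def
proof (intro conjI ballI impI allI)
  show "closedin (mtopology_of (cfun_metric X)) A"
    unfolding R_alg_def by simp
  fix x y assume "x \<in> X" "y \<in> X" "x \<noteq> y"
  then obtain z where "z \<in> Z" "restrict z X x \<noteq> restrict z X y"
    using assms(2) by auto
  then show "\<exists>f\<in>A. f x \<noteq> f y"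
    using coord_mem by blast
qed (use assms(1) compact_space in \<open>auto intro: mem_cfun const_mem add_mem mult_mem simp del: mspace_cfunspace\<close>)

lemma mem_extensional: "f \<in> A \<Longrightarrow> restrict f X = f"
  using mem_cfun cfun_iff extensional_restrict by blast

lemma character_one:
  assumes "algebra_character X A \<phi>" shows "\<phi> (\<lambda>x\<in>X. 1) = 1"
proof -
  obtain f where f: "f \<in> A" "\<phi> f \<noteq> 0"
    using assms unfolding algebra_character_def by blast
  have "\<phi> (\<lambda>x\<in>X. f x * (\<lambda>x\<in>X. 1) x) = \<phi> f * \<phi> (\<lambda>x\<in>X. 1)"
    using assms f const_mem unfolding algebra_character_def by blast
  then show ?thesis
    using f mem_extensional[OF f(1)] by (simp cong: restrict_cong add: restrict_apply' del: restrict_apply)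
qed

lemma character_const:
  assumes "algebra_character X A \<phi>" shows "\<phi> (\<lambda>x\<in>X. c) = c"
proof -
  have "\<phi> (\<lambda>x\<in>X. c * (\<lambda>x\<in>X. 1) x) = c * \<phi> (\<lambda>x\<in>X. 1)"
    using assms const_mem unfolding algebra_character_def linear_on_algebra_def by blast
  then show ?thesis
    using character_one[OF assms] by (simp cong: restrict_cong add: restrict_apply' del: restrict_apply)
qed

lemma character_add:
  assumes "algebra_character X A \<phi>" "f \<in> A" "g \<in> A" shows "\<phi> (\<lambda>x\<in>X. f x + g x) = \<phi> f + \<phi> g"
  using assms unfolding algebra_character_def linear_on_algebra_def by blast

lemma character_mult:
  assumes "algebra_character X A \<phi>" "f \<in> A" "g \<in> A" shows "\<phi> (\<lambda>x\<in>X. f x * g x) = \<phi> f * \<phi> g"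
  using assms unfolding algebra_character_def linear_on_algebra_def by blast

lemma character_power:
  assumes "algebra_character X A \<phi>" "f \<in> A" shows "\<phi> (\<lambda>x\<in>X. f x ^ k) = \<phi> f ^ k"
proof (induction k)
  case 0
  then show ?case using character_one[OF assms(1)] by (simp del: restrict_apply)
next
  case (Suc k)
  then show ?case
    using character_mult[OF assms power_mem[OF assms(2)], of k] by (simp cong: restrict_cong add: restrict_apply' del: restrict_apply)
qed

text \<open>
  Otherwise \<open>f - \<phi> f\<close> would be invertible in the algebra and lie in the kernel of \<open>\<phi>\<close>.
  In particular characters are contractive.
\<close>

lemma character_mem_range:
  assumes \<phi>: "algebra_character X A \<phi>" and f: "f \<in> A" shows "\<exists>x\<in>X. \<phi> f = f x"
proof (rule ccontr)
  assume "\<not> ?thesis"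
  then have nz: "\<forall>x\<in>X. f x \<noteq> \<phi> f" by auto
  define g where "g = (\<lambda>x\<in>X. f x + (\<lambda>x\<in>X. - \<phi> f) x)"
  have g: "g \<in> A" "\<phi> g = 0"
    using add_mem[OF f const_mem] character_add[OF \<phi> f const_mem] character_const[OF \<phi>]
    unfolding g_def by auto
  have nz': "\<forall>x\<in>X. g x \<noteq> 0" using nz by (auto simp: g_def)
  have "\<phi> (\<lambda>x\<in>X. g x * (\<lambda>x\<in>X. inverse (g x)) x) = \<phi> g * \<phi> (\<lambda>x\<in>X. inverse (g x))"
    by (rule character_mult[OF \<phi> g(1) inverse_mem[OF g(1) nz']])
  also have "(\<lambda>x\<in>X. g x * (\<lambda>x\<in>X. inverse (g x)) x) = (\<lambda>x\<in>X. 1)"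
    using nz' by (intro restrict_ext) auto
  finally show False
    using g(2) character_one[OF \<phi>] by (simp del: restrict_apply)
qed

lemma character_bound:
  assumes "algebra_character X A \<phi>" "f \<in> A" "\<And>x. x \<in> X \<Longrightarrow> cmod (f x) \<le> b" shows "cmod (\<phi> f) \<le> b"
  using character_mem_range[OF assms(1,2)] assms(3) by auto

lemma character_polynomial:
  assumes \<phi>: "algebra_character X A \<phi>" and y: "\<And>z. z \<in> Z \<Longrightarrow> \<phi> (restrict z X) = z y"
    and p: "p \<in> polynomial_funs Z"
  shows "\<phi> (restrict p X) = p y"
  using p
proof induction
  case (const c)
  then show ?case by (rule character_const[OF \<phi>])
next
  case (coord z)
  then show ?case by (rule y)
next
  case (add p q)
  then show ?case
    using character_add[OF \<phi> polynomial_mem polynomial_mem, of p q] by (simp cong: restrict_cong add: restrict_apply' del: restrict_apply)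
next
  case (mult p q)
  then show ?case
    using character_mult[OF \<phi> polynomial_mem polynomial_mem, of p q] by (simp cong: restrict_cong add: restrict_apply' del: restrict_apply)
qed

lemma character_rational:
  assumes \<phi>: "algebra_character X A \<phi>" and y: "\<And>z. z \<in> Z \<Longrightarrow> \<phi> (restrict z X) = z y" "y \<in> X"
    and r: "r \<in> rational_funs Z X"
  shows "\<phi> r = r y"
proof -
  obtain p q where *: "p \<in> polynomial_funs Z" "q \<in> polynomial_funs Z" "\<forall>x\<in>X. q x \<noteq> 0" 
    "r \<in> extensional X" "\<And>x. x \<in> X \<Longrightarrow> r x = p x / q x"
    using r rational_funsE by metis
  have rA: "r \<in> A"
    using r by (auto intro: rational_mem)
  have "\<phi> (\<lambda>x\<in>X. r x * restrict q X x) = \<phi> r * \<phi> (restrict q X)"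
    using * by (intro character_mult[OF \<phi> rA polynomial_mem])
  also have "(\<lambda>x\<in>X. r x * restrict q X x) = restrict p X"
    using * by (intro restrict_ext) auto
  finally have "p y = \<phi> r * q y"
    using character_polynomial[OF \<phi> y(1)] * by simp
  then show ?thesis
    using *(3) *(5)[OF y(2)] y(2) by simp
qed

text \<open>
  A character is determined by its values on the coordinate functions: algebra gives this for rational
  functions, and contractivity extends it to their uniform limits.
\<close>

lemma character_eq_evaluation:
  assumes \<phi>: "algebra_character X A \<phi>" and y: "\<And>z. z \<in> Z \<Longrightarrow> \<phi> (restrict z X) = z y" "y \<in> X"
    and f: "f \<in> A"
  shows "\<phi> f = f y"
proof (rule ccontr)
  assume "\<phi> f \<noteq> f y"
  define e where "e = cmod (\<phi> f - f y) / 3"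
  have "e > 0" using \<open>\<phi> f \<noteq> f y\<close> by (simp add: e_def)
  then obtain r where r: "r \<in> rational_funs Z X" "\<forall>x\<in>X. cmod (f x - r x) \<le> e"
    using f unfolding mem_iff_approx by blast
  have rA: "r \<in> A"
    using r by (auto intro: rational_mem)
  define g where "g = (\<lambda>x\<in>X. f x + (\<lambda>x\<in>X. (-1) * r x) x)"
  have gA: "g \<in> A"
    unfolding g_def by (intro add_mem scale_mem f rA)
  have "f = (\<lambda>x\<in>X. g x + r x)"
    using f cfun_iff mem_cfun by (auto simp: g_def intro: extensionalityI[OF _ restrict_extensional])
  then have "\<phi> f = \<phi> g + \<phi> r"
    using character_add[OF \<phi> gA rA] by simp
  moreover have "\<phi> r = r y"
    by (rule character_rational[OF \<phi> y r(1)])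
  moreover have "cmod (\<phi> g) \<le> e"
    using r(2) by (intro character_bound[OF \<phi> gA]) (auto simp: g_def)
  moreover have "cmod (f y - r y) \<le> e"
    using r(2) y(2) by blast
  ultimately have "cmod (\<phi> f - f y) \<le> e + e"
    using norm_triangle_ineq4[of "\<phi> g" "f y - r y"] by (simp add: algebra_simps)
  then show False using \<open>e > 0\<close> unfolding e_def by simp
qed

end

section \<open>Cauchy integrals and Runge's theorem\<close>

context continuous_coordinates begin

lemma sum_mem: "finite I \<Longrightarrow> (\<And>i. i \<in> I \<Longrightarrow> (\<lambda>x\<in>X. f i x) \<in> A) \<Longrightarrow> (\<lambda>x\<in>X. \<Sum>i\<in>I. f i x) \<in> A"
proof (induction rule: finite_induct)
  case empty
  then show ?case using const_mem[of 0] by (simp del: restrict_apply)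
next
  case (insert i I)
  then show ?case
    using add_mem[of "\<lambda>x\<in>X. f i x" "\<lambda>x\<in>X. \<Sum>i\<in>I. f i x"]
    by (simp cong: restrict_cong add: restrict_apply' del: restrict_apply)
qed

text \<open>
  A closed subspace contains the integral of a curve of its elements, because that integral is a
  uniform limit of Riemann sums; the equicontinuity \<open>ucont\<close> makes the convergence uniform on \<open>X\<close>.
\<close>

lemma integral_mem:
  fixes g :: "real \<Rightarrow> 'a \<Rightarrow> complex"
  assumes cont: "continuous_on ({0..1} \<times> X) (\<lambda>(t, x). g t x)"
    and mem: "\<And>t. t \<in> {0..1} \<Longrightarrow> (\<lambda>x\<in>X. g t x) \<in> A"
    and ucont: "\<And>e. 0 < e \<Longrightarrow> \<exists>\<delta>>0. \<forall>s\<in>{0..1}. \<forall>t\<in>{0..1}. \<forall>x\<in>X. \<bar>s - t\<bar> < \<delta> \<longrightarrow> cmod (g s x - g t x) < e"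
  shows "(\<lambda>x\<in>X. integral {0..1} (\<lambda>t. g t x)) \<in> A"
proof (rule closed_mem)
  have approx: "\<exists>h\<in>A. \<forall>x\<in>X. cmod (integral {0..1} (\<lambda>t. g t x) - h x) \<le> e" if e: "0 < e" for e
  proof -
    obtain \<delta> where \<delta>: "0 < \<delta>"
      "\<And>s t x. s \<in> {0..1} \<Longrightarrow> t \<in> {0..1} \<Longrightarrow> x \<in> X \<Longrightarrow> \<bar>s - t\<bar> < \<delta> \<Longrightarrow> cmod (g s x - g t x) < e"
      using ucont[OF e] by blast
    obtain m where m: "inverse (real (Suc m)) < \<delta>"
      using reals_Archimedean[OF \<delta>(1)] by blast
    define n where "n = real (Suc m)"
    have n: "n > 0" "inverse n < \<delta>" using m by (auto simp: n_def)
    define S where "S k x = (\<Sum>j<k. g (real j / n) x / n)" for k x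
    have "cmod (integral {0..real k / n} (\<lambda>t. g t x) - S k x) \<le> e * (real k / n)" if "x \<in> X" "k \<le> Suc m" for k x
      using that(2)
    proof (induction k)
      case 0
      then show ?case by (simp add: S_def)
    next
      case (Suc k)
      have k1: "real (Suc k) / n \<le> 1" "real k / n \<le> real (Suc k) / n" "0 \<le> real k / n"
        using Suc.prems n by (auto simp: n_def divide_simps)
      have gc: "continuous_on {0..1} (\<lambda>t. g t x)"
        by (rule continuous_on_compose2[OF cont, where f = "\<lambda>t. (t, x)", simplified]) (use that(1) in \<open>auto intro!: continuous_intros\<close>)
      have int: "(\<lambda>t. g t x) integrable_on {a..b}" if "0 \<le> a" "b \<le> 1" for a b
        by (rule integrable_continuous_interval, rule continuous_on_subset[OF gc]) (use that in auto)
      have split: "integral {0..real (Suc k) / n} (\<lambda>t. g t x) = integral {0..real k / n} (\<lambda>t. g t x) + integral {real k / n..real (Suc k) / n} (\<lambda>t. g t x)"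
        by (rule Henstock_Kurzweil_Integration.integral_combine[symmetric]) (use k1 int in auto)
      have len: "real (Suc k) / n - real k / n = 1 / n" by (simp add: divide_simps)
      have "integral {real k / n..real (Suc k) / n} (\<lambda>t. g t x) - g (real k / n) x / n = integral {real k / n..real (Suc k) / n} (\<lambda>t. g t x - g (real k / n) x)"
        using k1 len int[of "real k / n" "real (Suc k) / n"]
        by (subst integral_diff) (auto simp: content_real scaleR_conv_of_real simp del: of_nat_Suc)
      also have "cmod \<dots> \<le> e * (real (Suc k) / n - real k / n)"
      proof (rule integral_bound)
        show "continuous_on {real k / n..real (Suc k) / n} (\<lambda>t. g t x - g (real k / n) x)"
          by (intro continuous_intros continuous_on_subset[OF gc]) (use k1 in auto)
        fix t assume t: "t \<in> {real k / n..real (Suc k) / n}"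
        then have "\<bar>t - real k / n\<bar> < \<delta>"
          using len n(2) by (auto simp: inverse_eq_divide)
        then show "cmod (g t x - g (real k / n) x) \<le> e"
          by (intro less_imp_le[OF \<delta>(2)]) (use t k1 that(1) in auto)
      qed (use k1 in auto)
      finally have step: "cmod (integral {real k / n..real (Suc k) / n} (\<lambda>t. g t x) - g (real k / n) x / n) \<le> e * (1 / n)"
        unfolding len .
      have "cmod (integral {0..real (Suc k) / n} (\<lambda>t. g t x) - S (Suc k) x)
        = cmod ((integral {0..real k / n} (\<lambda>t. g t x) - S k x) + (integral {real k / n..real (Suc k) / n} (\<lambda>t. g t x) - g (real k / n) x / n))"
        unfolding split S_def by (simp add: algebra_simps)
      also have "\<dots> \<le> e * (real k / n) + e * (1 / n)"
        using Suc step by (intro norm_triangle_le add_mono) auto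
      also have "\<dots> = e * (real (Suc k) / n)"
        by (simp add: add_divide_distrib ring_distribs)
      finally show ?case .
    qed
    from this[of _ "Suc m"] have "\<forall>x\<in>X. cmod (integral {0..1} (\<lambda>t. g t x) - (\<lambda>x\<in>X. S (Suc m) x) x) \<le> e"
      using n by (simp add: n_def)
    moreover have "(\<lambda>x\<in>X. S (Suc m) x) \<in> A"
      unfolding S_def
    proof (rule sum_mem)
      fix j assume "j \<in> {..<Suc m}"
      then have "real j / n \<in> {0..1}" by (auto simp: n_def divide_simps)
      from scale_mem[OF mem[OF this], of "1 / n"] show "(\<lambda>x\<in>X. g (real j / n) x / n) \<in> A"
        by (simp cong: restrict_cong add: restrict_apply' del: restrict_apply)
    qed simp
    ultimately show ?thesis by blast
  qed
  show "\<exists>h\<in>A. \<forall>x\<in>X. cmod ((\<lambda>x\<in>X. integral {0..1} (\<lambda>t. g t x)) x - h x) \<le> e" if "0 < e" for e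
    using approx[OF that] by simp
  have "continuous_on X (\<lambda>x. integral (cbox 0 1) (\<lambda>t. g t x))"
  proof (rule integral_continuous_on_param)
    have "continuous_on (X \<times> cbox 0 1) (\<lambda>p. (\<lambda>(t, x). g t x) (snd p, fst p))"
      by (rule continuous_on_compose2[OF cont]) (auto intro!: continuous_intros)
    then show "continuous_on (X \<times> cbox 0 1) (\<lambda>(x, t). g t x)"
      by (simp add: case_prod_unfold)
  qed
  then show "(\<lambda>x\<in>X. integral {0..1} (\<lambda>t. g t x)) \<in> cfun X"
    unfolding cfun_iff by (simp cong: continuous_on_cong)
qed

lemma restrict_mem_R_alg:
  assumes "f \<in> A" "Y \<subseteq> X" "compact Y" shows "restrict f Y \<in> R_alg Z Y"
proof -
  interpret Y: continuous_coordinates Z Y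
    by unfold_locales (use assms continuous_coord continuous_on_subset in blast)+
  obtain r where r: "\<And>n::nat. r n \<in> rational_funs Z X" "uniform_limit X r f sequentially"
    using assms(1) unfolding mem_iff_uniform_limit by blast
  have rY: "restrict (r n) Y \<in> rational_funs Z Y" for n
  proof -
    obtain p q where "p \<in> polynomial_funs Z" "q \<in> polynomial_funs Z" "\<forall>x\<in>X. q x \<noteq> 0" 
      "\<And>x. x \<in> X \<Longrightarrow> r n x = p x / q x"
      using rational_funsE[OF r(1)[of n]] by metis
    then show ?thesis using assms(2) by (intro Y.rational_funsI[of p q]) auto
  qed
  have "uniform_limit Y (\<lambda>n. restrict (r n) Y) f sequentially"
    using uniform_limit_on_subset[OF r(2) assms(2)]
    by (rule uniform_limit_cong'[THEN iffD1, rotated -1]) auto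
  then show ?thesis
    using continuous_on_subset[OF mem_continuous[OF assms(1)] assms(2)] rY
    by (intro Y.uniform_limit_mem[of f "\<lambda>n. restrict (r n) Y"])
qed

end

text \<open>
  The integrand \<open>F \<zeta> / (\<zeta> - z)\<close> is, for each fixed \<open>\<zeta>\<close> on the segment, a rational function of \<open>z\<close> whose
  only pole is off \<open>K\<close>.
\<close>

lemma Cauchy_kernel_segment_mem_R_1:
  assumes K: "compact K" and disj: "closed_segment a b \<inter> K = {}" and F: "continuous_on (closed_segment a b) F"
  shows "(\<lambda>z\<in>K. contour_integral (linepath a b) (\<lambda>\<zeta>. F \<zeta> / (\<zeta> - z))) \<in> R_1 K"
proof -
  interpret continuous_coordinates "{\<lambda>z. z}" K
    using K by unfold_locales auto
  define g where "g t z = F (linepath a b t) / (linepath a b t - z) * (b - a)" for t z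
  have seg: "linepath a b t \<in> closed_segment a b" if "t \<in> {0..1}" for t
    using that by (simp add: linepath_in_path)
  have ne: "linepath a b t \<noteq> z" if "t \<in> {0..1}" "z \<in> K" for t z
    using seg[OF that(1)] that(2) disj by auto
  have Fl: "continuous_on ({0..1} \<times> K) (\<lambda>p. F (linepath a b (fst p)))"
    by (rule continuous_on_compose2[OF F])
      (use seg in \<open>auto intro!: continuous_on_compose2[OF continuous_on_linepath] continuous_intros\<close>)
  have cont: "continuous_on ({0..1} \<times> K) (\<lambda>(t, z). g t z)"
    unfolding g_def split_beta
    by (intro continuous_intros Fl) (use ne in \<open>auto simp: linepath_def intro!: continuous_intros\<close>)
  have "(\<lambda>z\<in>K. integral {0..1} (\<lambda>t. g t z)) \<in> R_1 K"
  proof (rule integral_mem[OF cont])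
    fix t :: real assume t: "t \<in> {0..1}"
    have "(\<lambda>z\<in>K. g t z) \<in> rational_funs {\<lambda>z. z} K"
    proof (rule rational_funsI)
      show "(\<lambda>z. F (linepath a b t) * (b - a)) \<in> polynomial_funs {\<lambda>z. z}"
        by (rule polynomial_funs.const)
      show "(\<lambda>z. linepath a b t + (- 1) * z) \<in> polynomial_funs {\<lambda>z. z}"
        by (intro polynomial_funs.add polynomial_funs.mult polynomial_funs.const polynomial_funs.coord) simp
    qed (use ne[OF t] in \<open>auto simp: g_def\<close>)
    then show "(\<lambda>z\<in>K. g t z) \<in> R_1 K"
      by (rule rational_mem)
  next
    fix e :: real assume "0 < e"
    have "uniformly_continuous_on ({0..1} \<times> K) (\<lambda>(t, z). g t z)"
      by (intro compact_uniformly_continuous cont compact_Times K) auto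
    then obtain \<delta> where "0 < \<delta>" and \<delta>: "\<And>p q. p \<in> {0..1} \<times> K \<Longrightarrow> q \<in> {0..1} \<times> K \<Longrightarrow> dist q p < \<delta> \<Longrightarrow> 
        dist ((\<lambda>(t, z). g t z) q) ((\<lambda>(t, z). g t z) p) < e"
      using \<open>0 < e\<close> unfolding uniformly_continuous_on_def by metis
    then have "\<forall>s\<in>{0..1}. \<forall>t\<in>{0..1}. \<forall>x\<in>K. \<bar>s - t\<bar> < \<delta> \<longrightarrow> cmod (g s x - g t x) < e"
      using \<delta>[of "(_, x)" "(_, x)" for x] by (force simp: dist_Pair_Pair dist_norm)
    with \<open>0 < \<delta>\<close> show "\<exists>\<delta>>0. \<forall>s\<in>{0..1}. \<forall>t\<in>{0..1}. \<forall>x\<in>K. \<bar>s - t\<bar> < \<delta> \<longrightarrow> cmod (g s x - g t x) < e" by blast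
  qed
  then show ?thesis
    by (simp add: contour_integral_integral g_def)
qed

lemma sum_diff_cancel_common:
  fixes f :: "'b \<Rightarrow> complex"
  assumes "finite S" "finite S'"
  shows "(\<Sum>e\<in>S. f e) - (\<Sum>e\<in>S'. f e) = (\<Sum>e\<in>S - S'. f e) - (\<Sum>e\<in>S' - S. f e)"
  using sum.Int_Diff[OF assms(1), of f S'] sum.Int_Diff[OF assms(2), of f S] by (simp add: Int_commute)

text \<open>
  Take the closed squares of a fine grid that meet \<open>K\<close>, and add the integrals of the Cauchy kernel over
  their boundaries.  If \<open>z\<close> is not on a grid line, exactly one square contains it, so the sum is
  \<open>2 \<pi> \<i> F z\<close>.  Edges shared by two of these squares cancel; an edge that survives bounds a square that does not meet
  \<open>K\<close>, hence is disjoint from \<open>K\<close> and contributes an element of \<open>R(K)\<close>.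
\<close>

lemma Cauchy_grid_R_1:
  assumes K: "compact K" and U: "open U" "K \<subseteq> U" and F: "F holomorphic_on U"
  obtains d G where "0 < d" "G \<in> R_1 K"
    "\<And>z. z \<in> K \<Longrightarrow> (\<And>i::int. Re z \<noteq> d * i \<and> Im z \<noteq> d * i) \<Longrightarrow> G z = F z"
proof -
  interpret continuous_coordinates "{\<lambda>z. z}" K
    using K by unfold_locales auto
  obtain e where e: "e > 0" "(\<Union>x\<in>K. cball x e) \<subseteq> U"
    using compact_subset_open_imp_cball_epsilon_subset[OF K U] by blast
  define d where "d = e / 2"
  have d: "d > 0" using e by (simp add: d_def)
  define c where "c i j = Complex (d * of_int i) (d * of_int j)" for i j :: int
  define Q where "Q i j = cbox (c i j) (c (i + 1) (j + 1))" for i j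
  define S where "S = {(i, j). Q i j \<inter> K \<noteq> {}}"
  have Q_iff: "z \<in> Q i j \<longleftrightarrow> d * i \<le> Re z \<and> Re z \<le> d * i + d \<and> d * j \<le> Im z \<and> Im z \<le> d * j + d" for z i j
    by (auto simp: Q_def c_def in_cbox_complex_iff algebra_simps)
  have QU: "Q i j \<subseteq> U" if "(i, j) \<in> S" for i j
  proof
    fix z assume z: "z \<in> Q i j"
    obtain x where x: "x \<in> Q i j" "x \<in> K" using \<open>(i, j) \<in> S\<close> by (auto simp: S_def)
    have "\<bar>Re (x - z)\<bar> \<le> d" "\<bar>Im (x - z)\<bar> \<le> d"
      using x(1) z by (auto simp: Q_iff)
    then have "dist x z \<le> e"
      using cmod_le[of "x - z"] by (auto simp: dist_norm d_def)
    then show "z \<in> U" using e(2) x(2) by (auto simp: UN_subset_iff subset_iff)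
  qed
  have finS: "finite S"
  proof -
    obtain B where B: "\<And>x. x \<in> K \<Longrightarrow> cmod x \<le> B"
      using compact_imp_bounded[OF K] unfolding bounded_iff by blast
    have "S \<subseteq> {- \<lceil>B / d\<rceil> - 1..\<lceil>B / d\<rceil>} \<times> {- \<lceil>B / d\<rceil> - 1..\<lceil>B / d\<rceil>}"
    proof clarify
      fix i j assume "(i, j) \<in> S"
      then obtain x where x: "x \<in> Q i j" "x \<in> K" by (auto simp: S_def)
      have "\<bar>Re x\<bar> \<le> B" "\<bar>Im x\<bar> \<le> B"
        using B[OF x(2)] abs_Re_le_cmod[of x] abs_Im_le_cmod[of x] by linarith+
      then have "d * i \<le> B" "- B \<le> d * (i + 1)" "d * j \<le> B" "- B \<le> d * (j + 1)"
        using x(1) by (auto simp: Q_iff algebra_simps)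
      then have "real_of_int i \<le> B / d" "- (B / d) \<le> real_of_int (i + 1)" 
        "real_of_int j \<le> B / d" "- (B / d) \<le> real_of_int (j + 1)"
        using d by (auto simp: field_simps)
      then show "i \<in> {- \<lceil>B / d\<rceil> - 1..\<lceil>B / d\<rceil>} \<and> j \<in> {- \<lceil>B / d\<rceil> - 1..\<lceil>B / d\<rceil>}"
        by (simp only: atLeastAtMost_iff) linarith
    qed
    then show ?thesis by (rule finite_subset) auto
  qed
  define h where "h e z = contour_integral (linepath (c (fst e) (snd e)) (c (fst e + 1) (snd e))) (\<lambda>\<zeta>. F \<zeta> / (\<zeta> - z))" for e z
  define v where "v e z = contour_integral (linepath (c (fst e) (snd e)) (c (fst e) (snd e + 1))) (\<lambda>\<zeta>. F \<zeta> / (\<zeta> - z))" for e z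
  have bottom: "closed_segment (c i j) (c (i + 1) j) \<subseteq> Q i j"
    and top: "closed_segment (c i (j + 1)) (c (i + 1) (j + 1)) \<subseteq> Q i j"
    and left: "closed_segment (c i j) (c i (j + 1)) \<subseteq> Q i j"
    and right: "closed_segment (c (i + 1) j) (c (i + 1) (j + 1)) \<subseteq> Q i j" for i j
    unfolding Q_def using d by (intro closed_segment_subset; simp add: c_def in_cbox_complex_iff algebra_simps)+
  \<comment> \<open>The squares one step above, respectively to the right of, a square in \<open>S\<close>.  Labelling an edge by its
      lower left corner, \<open>up\<close> and \<open>ri\<close> label the top and right edges of the squares in \<open>S\<close>.\<close>
  define up where "up = (\<lambda>(i, j). (i, j + 1)) ` S"
  define ri where "ri = (\<lambda>(i, j). (i + 1, j)) ` S"
  have inj: "inj_on (\<lambda>(i::int, j::int). (i, j + 1)) S" "inj_on (\<lambda>(i::int, j::int). (i + 1, j)) S"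
    by (auto simp: inj_on_def)
  have Fc: "continuous_on (closed_segment a b) F" if "closed_segment a b \<subseteq> Q i j" "(i, j) \<in> S" for a b i j
    using holomorphic_on_imp_continuous_on[OF F] continuous_on_subset that QU by (meson subset_trans)
  have h_mem: "(\<lambda>z\<in>K. h e z) \<in> R_1 K" if e: "e \<in> (S - up) \<union> (up - S)" for e
  proof -
    obtain i j where ij: "e = (i, j)" by fastforce
    have below: "(i, j - 1) \<in> S \<longleftrightarrow> e \<in> up"
      unfolding up_def ij by (auto simp: image_iff intro: bexI[of _ "(i, j - 1)"])
    have "closed_segment (c i j) (c (i + 1) j) \<inter> K = {}"
      using e below bottom[of i j] top[of i "j - 1"] unfolding ij S_def by auto
    moreover have "continuous_on (closed_segment (c i j) (c (i + 1) j)) F"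
      using e below Fc[OF bottom, of i j] Fc[OF top, of i "j - 1"] unfolding ij by auto
    ultimately show ?thesis
      unfolding h_def ij using K by (simp add: Cauchy_kernel_segment_mem_R_1 del: restrict_apply)
  qed
  have v_mem: "(\<lambda>z\<in>K. v e z) \<in> R_1 K" if e: "e \<in> (S - ri) \<union> (ri - S)" for e
  proof -
    obtain i j where ij: "e = (i, j)" by fastforce
    have below: "(i - 1, j) \<in> S \<longleftrightarrow> e \<in> ri"
      unfolding ri_def ij by (auto simp: image_iff intro: bexI[of _ "(i - 1, j)"])
    have "closed_segment (c i j) (c i (j + 1)) \<inter> K = {}"
      using e below left[of i j] right[of "i - 1" j] unfolding ij S_def by auto
    moreover have "continuous_on (closed_segment (c i j) (c i (j + 1))) F"
      using e below Fc[OF left, of i j] Fc[OF right, of "i - 1" j] unfolding ij by auto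
    ultimately show ?thesis
      unfolding v_def ij using K by (simp add: Cauchy_kernel_segment_mem_R_1 del: restrict_apply)
  qed
  define H where "H z = ((\<Sum>e\<in>S - up. h e z) + (-1) * (\<Sum>e\<in>up - S. h e z)) + ((\<Sum>e\<in>ri - S. v e z) + (-1) * (\<Sum>e\<in>S - ri. v e z))" for z
  have fin: "finite (S - up)" "finite (up - S)" "finite (ri - S)" "finite (S - ri)" 
    using finS by (auto simp: up_def ri_def)
  have "(\<lambda>z\<in>K. H z) \<in> R_1 K"
  proof -
    note m = sum_mem[OF fin(1), of h] sum_mem[OF fin(2), of h] sum_mem[OF fin(3), of v] sum_mem[OF fin(4), of v]
    have "(\<lambda>z\<in>K. \<Sum>e\<in>S - up. h e z) \<in> R_1 K" "(\<lambda>z\<in>K. \<Sum>e\<in>up - S. h e z) \<in> R_1 K"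
      "(\<lambda>z\<in>K. \<Sum>e\<in>ri - S. v e z) \<in> R_1 K" "(\<lambda>z\<in>K. \<Sum>e\<in>S - ri. v e z) \<in> R_1 K"
      using m h_mem v_mem by blast+
    from add_mem[OF add_mem[OF this(1) scale_mem[OF this(2), of "-1"]] add_mem[OF this(3) scale_mem[OF this(4), of "-1"]]]
    show ?thesis
      unfolding H_def by (simp cong: restrict_cong add: restrict_apply' del: restrict_apply)
  qed
  from scale_mem[OF this, of "1 / (2 * pi * \<i>)"]
  have G: "(\<lambda>z\<in>K. H z / (2 * pi * \<i>)) \<in> R_1 K"
    by (simp cong: restrict_cong add: restrict_apply' del: restrict_apply)
  have Hz: "H z = 2 * pi * \<i> * F z" if z: "z \<in> K" and off: "\<And>i::int. Re z \<noteq> d * i \<and> Im z \<noteq> d * i" for z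
  proof -
    define i0 j0 where "i0 = \<lfloor>Re z / d\<rfloor>" and "j0 = \<lfloor>Im z / d\<rfloor>"
    have unique: "i = i0 \<and> j = j0" if "z \<in> Q i j" for i j
    proof -
      have "d * i < Re z" "Re z < d * (i + 1)" "d * j < Im z" "Im z < d * (j + 1)"
        using that off[of i] off[of j] off[of "i + 1"] off[of "j + 1"] by (auto simp: Q_iff algebra_simps less_le)
      then have "of_int i < Re z / d" "Re z / d < of_int i + 1" "of_int j < Im z / d" "Im z / d < of_int j + 1"
        using d by (auto simp: field_simps)
      then show ?thesis
        unfolding i0_def j0_def by (auto simp: floor_eq_iff intro!: floor_unique[symmetric])
    qed
    have z0: "z \<in> Q i0 j0"
    proof -
      have "of_int i0 \<le> Re z / d" "Re z / d < of_int i0 + 1" "of_int j0 \<le> Im z / d" "Im z / d < of_int j0 + 1"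
        unfolding i0_def j0_def by linarith+
      then show ?thesis using d by (auto simp: Q_iff field_simps)
    qed
    then have S0: "(i0, j0) \<in> S" using z by (auto simp: S_def)
    have box: "z \<in> box (c i0 j0) (c (i0 + 1) (j0 + 1))"
      using z0 off[of i0] off[of j0] off[of "i0 + 1"] off[of "j0 + 1"]
      by (auto simp: Q_iff in_box_complex_iff c_def algebra_simps less_le)
    have sq: "h (i, j) z + v (i + 1, j) z - h (i, j + 1) z - v (i, j) z = 
        (if (i, j) = (i0, j0) then 2 * pi * \<i> * F z else 0)" if ij: "(i, j) \<in> S" for i j
    proof -
      let ?f = "\<lambda>\<zeta>. F \<zeta> / (\<zeta> - z)"
      have le: "Re (c i j) \<le> Re (c (i + 1) (j + 1))" "Im (c i j) \<le> Im (c (i + 1) (j + 1))"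
        using d by (auto simp: c_def algebra_simps)
      have img: "path_image (rectpath (c i j) (c (i + 1) (j + 1))) \<subseteq> Q i j"
        using path_image_rectpath_subset_cbox[OF le] unfolding Q_def .
      have notin: "z \<notin> path_image (rectpath (c i j) (c (i + 1) (j + 1)))"
        using off[of i] off[of j] off[of "i + 1"] off[of "j + 1"]
        unfolding path_image_rectpath[OF le] by (auto simp: c_def)
      have cont: "continuous_on (path_image (rectpath (c i j) (c (i + 1) (j + 1)))) ?f"
        using notin by (intro continuous_intros continuous_on_subset[OF holomorphic_on_imp_continuous_on[OF F]])
          (use img QU[OF ij] in auto)
      have segs: "closed_segment (c i j) (c (i + 1) j) \<subseteq> path_image (rectpath (c i j) (c (i + 1) (j + 1)))"
         "closed_segment (c (i + 1) j) (c (i + 1) (j + 1)) \<subseteq> path_image (rectpath (c i j) (c (i + 1) (j + 1)))"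
         "closed_segment (c (i + 1) (j + 1)) (c i (j + 1)) \<subseteq> path_image (rectpath (c i j) (c (i + 1) (j + 1)))"
         "closed_segment (c i (j + 1)) (c i j) \<subseteq> path_image (rectpath (c i j) (c (i + 1) (j + 1)))"
        by (auto simp: rectpath_def Let_def path_image_join c_def)
      have int: "?f contour_integrable_on linepath (c i j) (c (i + 1) j)"
        "?f contour_integrable_on linepath (c (i + 1) j) (c (i + 1) (j + 1))"
        "?f contour_integrable_on linepath (c (i + 1) (j + 1)) (c i (j + 1))"
        "?f contour_integrable_on linepath (c i (j + 1)) (c i j)"
        by (rule contour_integrable_continuous_linepath, rule continuous_on_subset[OF cont], rule segs)+
      have "contour_integral (rectpath (c i j) (c (i + 1) (j + 1))) ?f = 
          contour_integral (linepath (c i j) (c (i + 1) j)) ?f + 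
          contour_integral (linepath (c (i + 1) j) (c (i + 1) (j + 1))) ?f +
          contour_integral (linepath (c (i + 1) (j + 1)) (c i (j + 1))) ?f +
          contour_integral (linepath (c i (j + 1)) (c i j)) ?f"
      proof -
        have "rectpath (c i j) (c (i + 1) (j + 1)) = linepath (c i j) (c (i + 1) j) +++ 
          linepath (c (i + 1) j) (c (i + 1) (j + 1)) +++ linepath (c (i + 1) (j + 1)) (c i (j + 1)) +++ linepath (c i (j + 1)) (c i j)"
          by (simp add: rectpath_def Let_def c_def)
        then show ?thesis
          using int by (simp add: contour_integrable_joinI valid_path_join)
      qed
      also have "\<dots> = h (i, j) z + v (i + 1, j) z - h (i, j + 1) z - v (i, j) z"
        using contour_integral_reverse_linepath[of "c (i + 1) (j + 1)" "c i (j + 1)" ?f]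
          contour_integral_reverse_linepath[of "c i (j + 1)" "c i j" ?f]
          continuous_on_subset[OF cont segs(3)] continuous_on_subset[OF cont segs(4)]
        by (simp add: h_def v_def)
      finally have rect: "contour_integral (rectpath (c i j) (c (i + 1) (j + 1))) ?f = h (i, j) z + v (i + 1, j) z - h (i, j + 1) z - v (i, j) z" .
      have holQ: "F holomorphic_on Q i j"
        by (rule holomorphic_on_subset[OF F QU[OF ij]])
      show ?thesis
      proof (cases "(i, j) = (i0, j0)")
        case True
        have "(?f has_contour_integral (2 * pi * \<i> * winding_number (rectpath (c i j) (c (i + 1) (j + 1))) z * F z)) (rectpath (c i j) (c (i + 1) (j + 1)))"
          by (rule Cauchy_integral_formula_convex_simple[OF _ holQ])
            (use img notin box True in \<open>auto simp: Q_def interior_cbox\<close>)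
        then show ?thesis
          using rect True box winding_number_rectpath[of z] by (auto dest!: contour_integral_unique)
      next
        case False
        then have "z \<notin> Q i j" using unique by blast
        then have "?f holomorphic_on Q i j"
          by (intro holomorphic_intros holQ) auto
        then have "(?f has_contour_integral 0) (rectpath (c i j) (c (i + 1) (j + 1)))"
          by (rule Cauchy_theorem_convex_simple) (use img in \<open>auto simp: Q_def\<close>)
        then show ?thesis
          using rect False by (auto dest!: contour_integral_unique)
      qed
    qed
    have "H z = (\<Sum>e\<in>S. h e z) - (\<Sum>e\<in>up. h e z) + ((\<Sum>e\<in>ri. v e z) - (\<Sum>e\<in>S. v e z))"
      using sum_diff_cancel_common[of S up "\<lambda>e. h e z"] sum_diff_cancel_common[of ri S "\<lambda>e. v e z"] finS
      by (simp add: H_def up_def ri_def)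
    also have "\<dots> = (\<Sum>(i, j)\<in>S. h (i, j) z + v (i + 1, j) z - h (i, j + 1) z - v (i, j) z)"
      unfolding up_def ri_def sum.reindex[OF inj(1)] sum.reindex[OF inj(2)]
      by (simp add: case_prod_unfold sum.distrib sum_subtractf)
    also have "\<dots> = (\<Sum>e\<in>S. if e = (i0, j0) then 2 * pi * \<i> * F z else 0)"
      by (rule sum.cong) (use sq in \<open>auto split: if_splits\<close>)
    also have "\<dots> = 2 * pi * \<i> * F z"
      using finS S0 by simp
    finally show ?thesis .
  qed
  show thesis
  proof (rule that[OF d G])
    fix z assume "z \<in> K" "\<And>i::int. Re z \<noteq> d * i \<and> Im z \<noteq> d * i"
    then show "(\<lambda>z\<in>K. H z / (2 * pi * \<i>)) z = F z"
      using Hz[of z] by (simp only: restrict_apply') simp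
  qed
qed

text \<open>
  The grid formula says nothing at points of \<open>K\<close> on grid lines, and such points need not be limits
  of other points of \<open>K\<close>.  It is therefore applied to a compact neighbourhood of \<open>K\<close>, in which every point of
  \<open>K\<close> can be approached diagonally while avoiding the grid.
\<close>

theorem Runge_R_1:
  assumes K: "compact K" and U: "open U" "K \<subseteq> U" and F: "F holomorphic_on U"
  shows "restrict F K \<in> R_1 K"
proof -
  obtain e where e: "e > 0" "(\<Union>x\<in>K. cball x e) \<subseteq> U"
    using compact_subset_open_imp_cball_epsilon_subset[OF K U] by blast
  define K1 where "K1 = {x + y | x y. x \<in> K \<and> y \<in> cball 0 e}"
  have K1: "compact K1"
    unfolding K1_def by (rule compact_sums[OF K compact_cball])
  have near: "x + y \<in> K1" if "x \<in> K" "cmod y \<le> e" for x y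
    using that by (auto simp: K1_def)
  have K1U: "K1 \<subseteq> U"
  proof
    fix u assume "u \<in> K1"
    then obtain x y where "x \<in> K" "cmod y \<le> e" "u = x + y" by (auto simp: K1_def)
    then have "u \<in> cball x e" by (simp add: dist_norm)
    then show "u \<in> U" using e(2) \<open>x \<in> K\<close> by blast
  qed
  interpret K1: continuous_coordinates "{\<lambda>z. z}" K1
    using K1 by unfold_locales auto
  obtain d G where d: "0 < d" and G: "G \<in> R_1 K1"
    and eq: "\<And>z. z \<in> K1 \<Longrightarrow> (\<And>i::int. Re z \<noteq> d * i \<and> Im z \<noteq> d * i) \<Longrightarrow> G z = F z"
    using Cauchy_grid_R_1[OF K1 U(1) K1U F] by blast
  have Fc: "continuous_on K1 F"
    using holomorphic_on_imp_continuous_on[OF F] K1U continuous_on_subset by blast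
  have "G z = F z" if z: "z \<in> K" for z
  proof -
    have "\<exists>t. 0 < t \<and> t < e / 2 * inverse (real (Suc n)) \<and> (\<forall>i::int. Re z + t \<noteq> d * i \<and> Im z + t \<noteq> d * i)" for n
    proof -
      \<comment> \<open>Only countably many diagonal shifts of \<open>z\<close> hit a grid line.\<close>
      let ?B = "range (\<lambda>i::int. d * i - Re z) \<union> range (\<lambda>i::int. d * i - Im z)"
      have "countable ?B" by simp
      moreover have "uncountable {0<..<e / 2 * inverse (real (Suc n))}"
        using e(1) by (simp add: uncountable_open_interval)
      ultimately have "\<not> {0<..<e / 2 * inverse (real (Suc n))} \<subseteq> ?B"
        using countable_subset by blast
      then obtain t where "t \<in> {0<..<e / 2 * inverse (real (Suc n))}" "t \<notin> ?B" by blast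
      then show ?thesis
        by (intro exI[of _ t]) (auto simp: image_iff algebra_simps)
    qed
    then obtain t where t: "\<And>n. 0 < t n" "\<And>n. t n < e / 2 * inverse (real (Suc n))"
      "\<And>n i::int. Re z + t n \<noteq> d * i \<and> Im z + t n \<noteq> d * i" by metis
    define w where "w n = z + Complex (t n) (t n)" for n
    have "(\<lambda>n. e / 2 * inverse (real (Suc n))) \<longlonglongrightarrow> e / 2 * 0"
      by (intro tendsto_intros LIMSEQ_inverse_real_of_nat)
    then have bnd: "(\<lambda>n. e / 2 * inverse (real (Suc n))) \<longlonglongrightarrow> 0" by (simp only: mult_zero_right)
    have "t \<longlonglongrightarrow> 0"
      by (rule tendsto_sandwich[OF always_eventually always_eventually tendsto_const bnd])
        (intro allI less_imp_le t)+
    then have "(\<lambda>n. Complex (t n) (t n)) \<longlonglongrightarrow> Complex 0 0"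
      by (intro tendsto_Complex)
    then have "(\<lambda>n. z + Complex (t n) (t n)) \<longlonglongrightarrow> z + Complex 0 0"
      by (intro tendsto_add tendsto_const)
    then have lim: "w \<longlonglongrightarrow> z"
      unfolding w_def by (metis add.right_neutral zero_complex.code)
    have wK1: "w n \<in> K1" for n
    proof -
      have "e / 2 * inverse (real (Suc n)) \<le> e / 2"
        using e(1) by (auto simp: divide_simps)
      then have "cmod (Complex (t n) (t n)) \<le> e"
        using t(1,2)[of n] cmod_le[of "Complex (t n) (t n)"] by auto
      then show ?thesis unfolding w_def by (rule near[OF z])
    qed
    have zK1: "z \<in> K1" using near[OF z, of 0] e(1) by simp
    have "(\<lambda>n. G (w n)) \<longlonglongrightarrow> G z" "(\<lambda>n. F (w n)) \<longlonglongrightarrow> F z"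
      using lim wK1 zK1 K1.mem_continuous[OF G] Fc unfolding continuous_on_sequentially by (auto simp: comp_def)
    moreover have "G (w n) = F (w n)" for n
      using t(3) by (intro eq wK1) (simp add: w_def)
    ultimately show ?thesis
      by (simp add: LIMSEQ_unique)
  qed
  then have "restrict F K = restrict G K" by auto
  moreover have "K \<subseteq> K1" using near[of _ 0] e(1) by auto
  ultimately show ?thesis
    using K1.restrict_mem_R_alg[OF G _ K] by simp
qed

section \<open>Schoenberg's space-filling curve\<close>

lemma binary_expansion_exists:
  assumes "x \<in> {0..1::real}"
  obtains a :: "nat \<Rightarrow> nat" where "\<And>n. a n \<in> {0, 1}" "(\<lambda>n. real (a n) / 2 ^ Suc n) sums x"
proof -
  define step where "step y = (if y \<ge> 1/2 then 2 * y - 1 else 2 * y :: real)" for y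
  define r where "r n = (step ^^ n) x" for n
  define a where "a n = (if r n \<ge> 1/2 then 1 else 0 :: nat)" for n
  have r: "r n \<in> {0..1}" for n
    unfolding r_def using assms by (induction n) (auto simp: step_def)
  have rSuc: "r (Suc n) = 2 * r n - a n" for n
    by (simp add: r_def a_def step_def)
  have partial: "(\<Sum>n<N. real (a n) / 2 ^ Suc n) = x - r N / 2 ^ N" for N
  proof (induction N)
    case 0
    then show ?case by (simp add: r_def)
  next
    case (Suc N)
    then show ?case by (simp add: rSuc diff_divide_distrib)
  qed
  have "(\<lambda>N. r N / 2 ^ N) \<longlonglongrightarrow> 0"
  proof (rule tendsto_sandwich[OF always_eventually always_eventually tendsto_const])
    show "(\<lambda>N. (1/2 :: real) ^ N) \<longlonglongrightarrow> 0" by (rule LIMSEQ_realpow_zero) auto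
  qed (use r in \<open>auto simp: power_one_over divide_simps\<close>)
  then have "(\<lambda>N. x - r N / 2 ^ N) \<longlonglongrightarrow> x - 0"
    by (intro tendsto_intros)
  then have "(\<lambda>n. real (a n) / 2 ^ Suc n) sums x"
    unfolding sums_def partial by simp
  then show thesis by (rule that[rotated]) (auto simp: a_def)
qed

text \<open>
  A continuous function of period \<open>2\<close> which is \<open>0\<close> on \<open>[0, 1/3]\<close> and \<open>1\<close> on \<open>[2/3, 1]\<close>.  If the ternary
  digits of \<open>t\<close> are all \<open>0\<close> or \<open>2\<close>, then, up to an even integer, \<open>3\<^sup>k t\<close> lies in the first interval if its
  \<open>k\<close>-th digit, counted from \<open>0\<close>, is \<open>0\<close> and in the second if it is \<open>2\<close>; so the bump reads off the digit.
\<close>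

definition schoenberg_bump :: "real \<Rightarrow> real" where
  "schoenberg_bump t = max 0 (min 1 (1/2 - cos (pi * t)))"

text \<open>
  The digits of \<open>t\<close> in the positions of parity \<open>i\<close> become the binary digits of the value.
\<close>

definition schoenberg_coord :: "nat \<Rightarrow> real \<Rightarrow> real" where
  "schoenberg_coord i t = (\<Sum>n. schoenberg_bump (3 ^ (2 * n + i) * t) / 2 ^ Suc n)"

lemma continuous_schoenberg_coord: "continuous_on UNIV (schoenberg_coord i)"
proof -
  have "uniform_limit UNIV (\<lambda>N t. \<Sum>n<N. schoenberg_bump (3 ^ (2 * n + i) * t) / 2 ^ Suc n) (schoenberg_coord i) sequentially"
    unfolding schoenberg_coord_def
  proof (rule Weierstrass_m_test)
    show "summable (\<lambda>n. 1 / 2 ^ Suc n :: real)"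
      using sums_summable[OF power_half_series] by (simp add: power_one_over)
    show "norm (schoenberg_bump (3 ^ (2 * n + i) * t) / 2 ^ Suc n) \<le> 1 / 2 ^ Suc n" for n t
      by (simp add: schoenberg_bump_def divide_simps)
  qed
  then show ?thesis
    by (rule uniform_limit_theorem[rotated])
      (auto intro!: always_eventually continuous_intros simp: schoenberg_bump_def)
qed

lemma schoenberg_bump_ternary:
  assumes b: "\<And>n. b n \<in> {0, 1::nat}"
  shows "schoenberg_bump (3 ^ k * (\<Sum>n. real (2 * b n) / 3 ^ Suc n)) = real (b k)"
proof -
  define d where "d n = real (2 * b n) / 3 ^ Suc n" for n
  have d_bounds: "0 \<le> d n" "d n \<le> 2 / 3 ^ Suc n" for n
    using b[of n] by (auto simp: d_def divide_simps)
  have geo: "(\<lambda>n. 2 / 3 ^ Suc (n + Suc k) :: real) sums (1 / 3 ^ Suc k)"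
  proof -
    have "(\<lambda>n. (2 / 3 ^ Suc (Suc k)) * (1/3) ^ n :: real) sums ((2 / 3 ^ Suc (Suc k)) * (1 / (1 - 1/3)))"
      by (intro sums_mult geometric_sums) auto
    then show ?thesis by (simp add: power_add power_one_over divide_simps mult_ac)
  qed
  have tail_sum: "summable (\<lambda>n. d (n + Suc k))"
    by (rule summable_comparison_test'[OF sums_summable[OF geo], of 0])
      (simp only: real_norm_def abs_of_nonneg[OF d_bounds(1)] d_bounds(2))
  then have dsum: "summable d" by (simp only: summable_iff_shift)
  define R where "R = (\<Sum>n. d (n + Suc k))"
  have R: "0 \<le> R" "R \<le> 1 / 3 ^ Suc k"
    unfolding R_def sums_unique[OF geo]
    by (rule suminf_nonneg[OF tail_sum d_bounds(1)],
        rule suminf_le[OF d_bounds(2) tail_sum sums_summable[OF geo]])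
  have "(\<Sum>n. d n) = R + (\<Sum>n<Suc k. d n)"
    unfolding R_def by (rule suminf_split_initial_segment[OF dsum])
  then have split: "3 ^ k * (\<Sum>n. d n) = (\<Sum>n<k. 3 ^ k * d n) + 3 ^ k * d k + 3 ^ k * R"
    by (simp add: algebra_simps sum_distrib_right)
  define m where "m = (\<Sum>n<k. 3 ^ (k - Suc n) * b n)"
  have "(\<Sum>n<k. 3 ^ k * d n) = 2 * real m"
    unfolding m_def of_nat_sum sum_distrib_left
  proof (rule sum.cong)
    fix n assume "n \<in> {..<k}"
    then have "(3::real) ^ k = 3 ^ (k - Suc n) * 3 ^ Suc n" by (simp flip: power_add del: power_Suc)
    then show "3 ^ k * d n = 2 * real (3 ^ (k - Suc n) * b n)" by (simp add: d_def)
  qed simp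
  moreover have "3 ^ k * d k = 2 * real (b k) / 3"
    by (simp add: d_def)
  moreover define \<theta> where "\<theta> = 2 * real (b k) / 3 + 3 ^ k * R"
  ultimately have eq: "3 ^ k * (\<Sum>n. d n) = 2 * real m + \<theta>"
    using split by simp
  have R3: "0 \<le> 3 ^ k * R" "3 ^ k * R \<le> 1 / 3"
    using R by (auto simp: field_simps)
  have "cos (pi * (2 * real m + \<theta>)) = cos (pi * \<theta>)"
  proof -
    have "pi * (2 * real m + \<theta>) = pi * \<theta> + 2 * real m * pi" by (simp add: algebra_simps)
    moreover have "cos (2 * real m * pi) = 1" "sin (2 * real m * pi) = 0"
      using cos_2npi[of m] sin_2npi[of m] by auto
    ultimately show ?thesis by (simp add: cos_add)
  qed
  moreover have "cos (pi * \<theta>) \<ge> 1/2" if "b k = 0"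
  proof -
    have "cos (pi / 3) \<le> cos (pi * \<theta>)"
      by (rule cos_monotone_0_pi_le) (use R3 that in \<open>auto simp: \<theta>_def\<close>)
    then show ?thesis by (simp add: cos_60)
  qed
  moreover have "cos (pi * \<theta>) \<le> - 1/2" if "b k = 1"
  proof -
    have "2/3 \<le> \<theta>" "\<theta> \<le> 1" using R3 that by (auto simp: \<theta>_def)
    then have "cos (pi * \<theta>) \<le> cos (pi * (2/3))"
      using mult_left_mono[of "2/3" \<theta> pi] mult_left_mono[of \<theta> 1 pi]
      by (intro cos_monotone_0_pi_le) auto
    moreover have "cos (pi * (2/3)) = - 1/2"
      using cos_120 by (simp add: mult.commute)
    ultimately show ?thesis by simp
  qed
  ultimately show ?thesis
    using b[of k] eq unfolding schoenberg_bump_def d_def by auto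
qed

lemma schoenberg_surj:
  assumes "x \<in> {0..1}" "y \<in> {0..1}"
  obtains t where "t \<in> {0..1}" "schoenberg_coord 0 t = x" "schoenberg_coord 1 t = y"
proof -
  obtain a where a: "\<And>n. a n \<in> {0, 1}" "(\<lambda>n. real (a n) / 2 ^ Suc n) sums x"
    using binary_expansion_exists[OF assms(1)] by blast
  obtain c where c: "\<And>n. c n \<in> {0, 1}" "(\<lambda>n. real (c n) / 2 ^ Suc n) sums y"
    using binary_expansion_exists[OF assms(2)] by blast
  define b where "b n = (if even n then a (n div 2) else c (n div 2))" for n
  have b: "b n \<in> {0, 1}" for n using a c by (auto simp: b_def)
  define t where "t = (\<Sum>n. real (2 * b n) / 3 ^ Suc n)"
  have "schoenberg_coord 0 t = x"
    unfolding schoenberg_coord_def t_def schoenberg_bump_ternary[OF b]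
    using sums_unique[OF a(2)] by (simp add: b_def)
  moreover have "schoenberg_coord 1 t = y"
    unfolding schoenberg_coord_def t_def schoenberg_bump_ternary[OF b]
    using sums_unique[OF c(2)] by (simp add: b_def)
  moreover have "t \<in> {0..1}"
  proof -
    have geo: "(\<lambda>n. 2 / 3 ^ Suc n :: real) sums 1"
    proof -
      have "(\<lambda>n. (2 / 3) * (1/3) ^ n :: real) sums ((2 / 3) * (1 / (1 - 1/3)))"
        by (intro sums_mult geometric_sums) auto
      then show ?thesis by (simp add: power_one_over divide_simps mult_ac)
    qed
    have bd: "0 \<le> real (2 * b n) / 3 ^ Suc n" "real (2 * b n) / 3 ^ Suc n \<le> 2 / 3 ^ Suc n" for n
      using b[of n] by (auto simp: divide_simps)
    have sum: "summable (\<lambda>n. real (2 * b n) / 3 ^ Suc n)"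
      by (rule summable_comparison_test'[OF sums_summable[OF geo], of 0])
        (simp only: real_norm_def abs_of_nonneg[OF bd(1)] bd(2))
    have "0 \<le> t"
      unfolding t_def by (rule suminf_nonneg[OF sum bd(1)])
    moreover have "t \<le> 1"
      unfolding t_def sums_unique[OF geo] by (rule suminf_le[OF bd(2) sum sums_summable[OF geo]])
    ultimately show ?thesis by simp
  qed
  ultimately show thesis using that by blast
qed

text \<open>
  This reduces weak compactness of measures on a plane compactum to the line, where Helly's selection theorem applies.
\<close>

lemma compact_subset_continuous_image_interval:
  fixes K :: "complex set"
  assumes "compact K"
  obtains g :: "real \<Rightarrow> complex" where "continuous_on UNIV g" "K \<subseteq> g ` {0..1}"
proof -
  obtain B where B: "0 < B" "\<And>z. z \<in> K \<Longrightarrow> cmod z \<le> B"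
    using compact_imp_bounded[OF assms] unfolding bounded_pos by blast
  define g where "g t = Complex (2 * B * schoenberg_coord 0 t - B) (2 * B * schoenberg_coord 1 t - B)" for t
  have "continuous_on UNIV g"
    unfolding g_def Complex_eq by (intro continuous_intros continuous_schoenberg_coord)
  moreover have "z \<in> g ` {0..1}" if "z \<in> K" for z
  proof -
    have "\<bar>Re z\<bar> \<le> B" "\<bar>Im z\<bar> \<le> B"
      using B(2)[OF that] abs_Re_le_cmod[of z] abs_Im_le_cmod[of z] by linarith+
    then have "(Re z + B) / (2 * B) \<in> {0..1}" "(Im z + B) / (2 * B) \<in> {0..1}"
      using B(1) by (auto simp: field_simps)
    then obtain t where "t \<in> {0..1}" "schoenberg_coord 0 t = (Re z + B) / (2 * B)" "schoenberg_coord 1 t = (Im z + B) / (2 * B)"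
      using schoenberg_surj by blast
    then show ?thesis
      using B(1) by (intro image_eqI[of _ _ t]) (auto simp: g_def complex_eq_iff)
  qed
  ultimately show thesis using that by blast
qed

section \<open>Positive functionals and the Riesz representation theorem in the plane\<close>

text \<open>
  A form of the Hahn-Banach theorem in terms of cones.  Let \<open>C\<close> be a maximal additively closed set of bounded
  functions with \<open>S \<subseteq> C\<close> that omits the constant \<open>-1\<close>.  Maximality forces \<open>w \<in> C\<close> or \<open>-w \<in> C\<close> for every
  bounded \<open>w\<close>, so the threshold \<open>L v\<close> of those \<open>s\<close> with \<open>s - v \<in> C\<close> is a Dedekind cut, and
  \<open>L\<close> is additive.  Real homogeneity is a consequence of additivity and positivity.
\<close>

lemma positive_functional_extension:
  fixes K :: "'a set" and S :: "('a \<Rightarrow> real) set"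
  assumes bdd: "\<And>h. h \<in> S \<Longrightarrow> bounded (h ` K)"
    and nonneg: "\<And>h. bounded (h ` K) \<Longrightarrow> (\<And>x. x \<in> K \<Longrightarrow> 0 \<le> h x) \<Longrightarrow> h \<in> S"
    and add: "\<And>h h'. h \<in> S \<Longrightarrow> h' \<in> S \<Longrightarrow> (\<lambda>x. h x + h' x) \<in> S"
    and neg: "(\<lambda>_. - 1) \<notin> S"
  obtains L :: "('a \<Rightarrow> real) \<Rightarrow> real" where
    "\<And>v w. bounded (v ` K) \<Longrightarrow> bounded (w ` K) \<Longrightarrow> L (\<lambda>x. v x + w x) = L v + L w"
    "\<And>h. h \<in> S \<Longrightarrow> 0 \<le> L h" "L (\<lambda>_. 1) = 1"
proof -
  define \<A> where "\<A> = {C. S \<subseteq> C \<and> (\<forall>h\<in>C. bounded (h ` K)) \<and> (\<forall>h\<in>C. \<forall>h'\<in>C. (\<lambda>x. h x + h' x) \<in> C) \<and> (\<lambda>_. - 1) \<notin> C}"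
  have "S \<in> \<A>" using bdd add neg by (auto simp: \<A>_def)
  have "\<exists>M\<in>\<A>. \<forall>X\<in>\<A>. M \<subseteq> X \<longrightarrow> X = M"
  proof (rule subset_Zorn_nonempty)
    fix \<C> assume "\<C> \<noteq> {}" and chain: "subset.chain \<A> \<C>"
    have sub: "C \<in> \<A>" if "C \<in> \<C>" for C using chain that by (auto simp: subset.chain_def)
    have "(\<lambda>x. h x + h' x) \<in> \<Union>\<C>" if "h \<in> \<Union>\<C>" "h' \<in> \<Union>\<C>" for h h'
    proof -
      obtain C D where CD: "C \<in> \<C>" "h \<in> C" "D \<in> \<C>" "h' \<in> D" using \<open>h \<in> \<Union>\<C>\<close> \<open>h' \<in> \<Union>\<C>\<close> by blast
      then have "C \<subseteq> D \<or> D \<subseteq> C" using chain by (auto simp: subset_chain_def)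
      then obtain E where "E \<in> \<C>" "h \<in> E" "h' \<in> E" using CD by blast
      then show ?thesis using sub[of E] unfolding \<A>_def by blast
    qed
    then show "\<Union>\<C> \<in> \<A>"
      using sub \<open>\<C> \<noteq> {}\<close> unfolding \<A>_def by blast
  qed (use \<open>S \<in> \<A>\<close> in auto)
  then obtain C where C: "C \<in> \<A>" and max: "\<And>X. X \<in> \<A> \<Longrightarrow> C \<subseteq> X \<Longrightarrow> X = C" by blast
  have CS: "S \<subseteq> C" and Cbdd: "\<And>h. h \<in> C \<Longrightarrow> bounded (h ` K)" and Cneg: "(\<lambda>_. - 1) \<notin> C"
    and Cadd: "\<And>h h'. h \<in> C \<Longrightarrow> h' \<in> C \<Longrightarrow> (\<lambda>x. h x + h' x) \<in> C"
    using C by (auto simp: \<A>_def)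
  have const: "(\<lambda>_. c) \<in> C" if "0 \<le> c" for c
    using nonneg[of "\<lambda>_. c"] that CS by (auto simp: image_constant_conv split: if_splits)
  have Cmult: "(\<lambda>x. real m * h x) \<in> C" if "h \<in> C" for h m
  proof (induction m)
    case 0
    then show ?case using const[of 0] by simp
  next
    case (Suc m)
    then show ?case using Cadd[OF Suc \<open>h \<in> C\<close>] by (simp add: algebra_simps)
  qed
  \<comment> \<open>A bounded function outside \<open>C\<close> generates, together with \<open>C\<close>, the constant \<open>-1\<close>.\<close>
  have gen: "\<exists>c\<in>C. \<exists>m>0. \<forall>x. - 1 = c x + real m * w x" if w: "bounded (w ` K)" "w \<notin> C" for w
  proof (rule ccontr)
    assume no: "\<not> ?thesis"
    define D where "D = {h. \<exists>c\<in>C. \<exists>m. h = (\<lambda>x. c x + real m * w x)}"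
    have CD: "C \<subseteq> D"
      unfolding D_def by (force intro: exI[of _ 0])
    have "D \<in> \<A>"
      unfolding \<A>_def
    proof (intro CollectI conjI ballI)
      show "S \<subseteq> D" using CS CD by simp
      fix h assume "h \<in> D"
      then obtain c m where h: "c \<in> C" "h = (\<lambda>x. c x + real m * w x)" by (auto simp: D_def)
      have "bounded ((\<lambda>x. real m * w x) ` K)"
        using bounded_scaling[OF w(1), of "real m"] by (simp add: image_image)
      then show "bounded (h ` K)"
        unfolding h using Cbdd[OF h(1)] by (rule bounded_plus_comp[rotated])
      fix h' assume "h' \<in> D"
      then obtain c' m' where h': "c' \<in> C" "h' = (\<lambda>x. c' x + real m' * w x)" by (auto simp: D_def)
      have "(\<lambda>x. h x + h' x) = (\<lambda>x. (c x + c' x) + real (m + m') * w x)"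
        unfolding h h' by (auto simp: algebra_simps)
      then show "(\<lambda>x. h x + h' x) \<in> D"
        unfolding D_def by (intro CollectI bexI[of _ "\<lambda>x. c x + c' x"] exI[of _ "m + m'"] Cadd[OF h(1) h'(1)])
    next
      show "(\<lambda>_. - 1) \<notin> D"
      proof
        assume "(\<lambda>_. - 1) \<in> D"
        then obtain c m where cm: "c \<in> C" "(\<lambda>_. - 1) = (\<lambda>x. c x + real m * w x)" by (auto simp: D_def)
        show False
        proof (cases "m = 0")
          case True
          then show False using cm Cneg by simp
        next
          case False
          then show False using cm(1) no fun_cong[OF cm(2)] by blast
        qed
      qed
    qed
    then have "D = C" using max CD by blast
    moreover have "w \<in> D"
      unfolding D_def using const[of 0] by (auto intro!: bexI[of _ "\<lambda>_. 0"] exI[of _ 1])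
    ultimately show False using w by simp
  qed
  have bdd_neg: "bounded ((\<lambda>x. - v x) ` K)" if "bounded (v ` K)" for v :: "'a \<Rightarrow> real"
    using that bounded_uminus[of "v ` K"] by (simp add: image_image)
  have total: "w \<in> C \<or> (\<lambda>x. - w x) \<in> C" if w: "bounded (w ` K)" for w
  proof (rule ccontr)
    assume "\<not> ?thesis"
    moreover have "bounded ((\<lambda>x. - w x) ` K)"
      by (rule bdd_neg[OF w])
    ultimately obtain c m c' m' where *: "c \<in> C" "0 < m" "\<And>x. - 1 = c x + real m * w x"
      "c' \<in> C" "0 < m'" "\<And>x. - 1 = c' x + real m' * (- w x)"
      using gen[OF w] gen[of "\<lambda>x. - w x"] by metis
    \<comment> \<open>The combination of the two representations of \<open>-1\<close> in which \<open>w\<close> cancels is the constant \<open>-(m + m')\<close>.\<close>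
    have "(\<lambda>x. (real m' * c x + real m * c' x) + (real (m + m') - 1)) \<in> C"
      using * by (intro Cadd Cmult const) auto
    moreover have "(real m' * c x + real m * c' x) + (real (m + m') - 1) = - 1" for x
    proof -
      have "real m' * (c x + real m * w x) + real m * (c' x + real m' * (- w x)) = - real m' - real m"
        unfolding *(3)[symmetric] *(6)[symmetric] by simp
      then show ?thesis by (simp add: algebra_simps)
    qed
    ultimately have "(\<lambda>_. - 1) \<in> C" by (simp only:)
    then show False using Cneg by simp
  qed
  define L where "L v = Inf {s. (\<lambda>x. s - v x) \<in> C}" for v
  have mono: "h' \<in> C" if "h \<in> C" "bounded (h' ` K)" "\<And>x. x \<in> K \<Longrightarrow> h x \<le> h' x" for h h'
  proof -
    have "bounded ((\<lambda>x. h' x - h x) ` K)"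
      using that(2) Cbdd[OF that(1)] by (rule bounded_minus_comp)
    then have "(\<lambda>x. h' x - h x) \<in> C" using nonneg[of "\<lambda>x. h' x - h x"] that(3) CS by auto
    from Cadd[OF that(1) this] show ?thesis by simp
  qed
  have bdd_sub: "bounded ((\<lambda>x. s - v x) ` K)" if "bounded (v ` K)" for s :: real and v
    using that by (intro bounded_minus_comp) (auto simp: image_constant_conv)
  have ne: "{s. (\<lambda>x. s - v x) \<in> C} \<noteq> {}" and bel: "bdd_below {s. (\<lambda>x. s - v x) \<in> C}" if v: "bounded (v ` K)" for v
  proof -
    obtain B where B: "\<And>x. x \<in> K \<Longrightarrow> \<bar>v x\<bar> \<le> B" using v by (auto simp: bounded_iff)
    have "(\<lambda>x. B - v x) \<in> C"
      using nonneg[OF bdd_sub[OF v]] B CS by (metis abs_le_D1 diff_ge_0_iff_ge subsetD)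
    then show "{s. (\<lambda>x. s - v x) \<in> C} \<noteq> {}" by blast
    have "- B - 1 \<le> s" if s: "(\<lambda>x. s - v x) \<in> C" for s
    proof (rule ccontr)
      assume "\<not> - B - 1 \<le> s"
      then have "s - v x \<le> - 1" if "x \<in> K" for x using B[OF that] by auto
      then have "(\<lambda>_. - 1) \<in> C" by (intro mono[OF s]) (auto simp: image_constant_conv)
      then show False using Cneg by simp
    qed
    then show "bdd_below {s. (\<lambda>x. s - v x) \<in> C}" by (meson bdd_belowI mem_Collect_eq)
  qed
  have L_le: "L v \<le> s" if "(\<lambda>x. s - v x) \<in> C" "bounded (v ` K)" for v s
    unfolding L_def using that bel by (auto intro: cInf_lower)
  have L_ge: "b \<le> L v" if "\<And>s. (\<lambda>x. s - v x) \<in> C \<Longrightarrow> b \<le> s" "bounded (v ` K)" for v b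
    unfolding L_def by (intro cInf_greatest ne that(2)) (auto intro: that(1))
  have below_L: "(\<lambda>x. v x - s) \<in> C" if "s < L v" "bounded (v ` K)" for v s
    using total[OF bdd_sub[OF that(2), of s]] L_le[of s v] that by auto
  have sub: "L (\<lambda>x. v x + w x) \<le> L v + L w" if vw: "bounded (v ` K)" "bounded (w ` K)" for v w
  proof -
    have vw': "bounded ((\<lambda>x. v x + w x) ` K)" using vw by (rule bounded_plus_comp)
    have "L (\<lambda>x. v x + w x) \<le> s + s'" if s: "(\<lambda>x. s - v x) \<in> C" "(\<lambda>x. s' - w x) \<in> C" for s s'
    proof (rule L_le[OF _ vw'])
      show "(\<lambda>x. s + s' - (v x + w x)) \<in> C" using Cadd[OF s] by (simp add: algebra_simps)
    qed
    then have "L (\<lambda>x. v x + w x) - s' \<le> L v" if s: "(\<lambda>x. s' - w x) \<in> C" for s'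
      using that by (intro L_ge vw(1)) (simp add: algebra_simps)
    then have "L (\<lambda>x. v x + w x) - L v \<le> L w"
      by (intro L_ge vw(2)) (simp add: algebra_simps)
    then show ?thesis by simp
  qed
  have neg_L: "L (\<lambda>x. - v x) \<le> - L v" if v: "bounded (v ` K)" for v
  proof (rule field_le_epsilon)
    fix e :: real assume "0 < e"
    then have "(\<lambda>x. v x - (L v - e)) \<in> C" by (intro below_L v) auto
    then have "(\<lambda>x. (- L v + e) - (- v x)) \<in> C" by (simp add: algebra_simps)
    then show "L (\<lambda>x. - v x) \<le> - L v + e" by (rule L_le) (rule bdd_neg[OF v])
  qed
  show thesis
  proof (rule that)
    fix v w :: "'a \<Rightarrow> real" assume vw: "bounded (v ` K)" "bounded (w ` K)"
    have "L (\<lambda>x. (v x + w x) + (- w x)) \<le> L (\<lambda>x. v x + w x) + L (\<lambda>x. - w x)"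
      by (intro sub bounded_plus_comp vw bdd_neg)
    then have "L v \<le> L (\<lambda>x. v x + w x) - L w"
      using neg_L[OF vw(2)] by simp
    then show "L (\<lambda>x. v x + w x) = L v + L w" using sub[OF vw] by simp
  next
    fix h assume "h \<in> S"
    then have h: "h \<in> C" "bounded (h ` K)" using CS bdd by auto
    have "L (\<lambda>x. - h x) \<le> 0" by (rule L_le) (use h bdd_neg in auto)
    moreover have "L (\<lambda>x. h x + - h x) \<le> L h + L (\<lambda>x. - h x)" by (intro sub h bdd_neg)
    moreover have "0 \<le> L (\<lambda>x. h x + - h x)"
    proof (rule L_ge)
      fix s assume s: "(\<lambda>x. s - (h x + - h x)) \<in> C"
      show "0 \<le> s"
      proof (rule ccontr)
        assume "\<not> 0 \<le> s"
        then obtain m where "1 < real m * (- s)" using reals_Archimedean3[of "- s"] by (metis neg_0_less_iff_less not_le)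
        moreover have "(\<lambda>x. real m * s) \<in> C" using Cmult[OF s, of m] by simp
        ultimately have "(\<lambda>_. - 1) \<in> C" by (elim mono) (auto simp: image_constant_conv)
        then show False using Cneg by simp
      qed
    qed (auto simp: image_constant_conv)
    ultimately show "0 \<le> L h" by simp
  next
    have b: "bounded ((\<lambda>_. c :: real) ` K)" for c by (auto simp: image_constant_conv)
    have le: "L (\<lambda>_. c) \<le> c" for c by (rule L_le[OF _ b]) (use const[of 0] in simp)
    have "L (\<lambda>_. 1 + 0) \<le> 1" using le by simp
    moreover have "1 \<le> L (\<lambda>_. 1)"
    proof (rule L_ge[OF _ b])
      fix s :: real assume s: "(\<lambda>x. s - 1) \<in> C"
      show "1 \<le> s"
      proof (rule ccontr)
        assume "\<not> 1 \<le> s"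
        then obtain m where "1 < real m * (1 - s)" using reals_Archimedean3[of "1 - s"] by (metis diff_gt_0_iff_gt not_le)
        moreover have "(\<lambda>x. real m * (s - 1)) \<in> C" using Cmult[OF s, of m] by simp
        ultimately have "(\<lambda>_. - 1) \<in> C" by (elim mono) (auto simp: image_constant_conv algebra_simps)
        then show False using Cneg by simp
      qed
    qed
    ultimately show "L (\<lambda>_. 1) = 1" by simp
  qed
qed

lemma additive_nonneg_imp_scale:
  fixes f :: "real \<Rightarrow> real"
  assumes add: "\<And>s t. f (s + t) = f s + f t" and nonneg: "\<And>t. 0 \<le> t \<Longrightarrow> 0 \<le> f t"
  shows "f t = t * f 1"
proof -
  have mono: "f s \<le> f t" if "s \<le> t" for s t
    using add[of s "t - s"] nonneg[of "t - s"] that by simp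
  have zero: "f 0 = 0" using add[of 0 0] by simp
  have neg: "f (- s) = - f s" for s using add[of s "- s"] zero by simp
  have nat: "f (real n * s) = real n * f s" for n s
    by (induction n) (auto simp: zero add algebra_simps)
  have int: "f (of_int k) = of_int k * f 1" for k
    using nat[of "nat k" 1] nat[of "nat (- k)" 1] neg[of "of_int k"] by (cases "k \<ge> 0") auto
  have "real n * \<bar>f t - t * f 1\<bar> \<le> f 1" for n
  proof -
    let ?k = "\<lfloor>real n * t\<rfloor>"
    have "of_int ?k \<le> real n * t" "real n * t \<le> of_int (?k + 1)" by linarith+
    then have "f (of_int ?k) \<le> f (real n * t)" "f (real n * t) \<le> f (of_int (?k + 1))"
      "of_int ?k * f 1 \<le> real n * t * f 1" "real n * t * f 1 \<le> of_int (?k + 1) * f 1"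
      using mono nonneg[of 1] by (auto intro: mult_right_mono)
    then have "\<bar>real n * f t - real n * t * f 1\<bar> \<le> f 1"
      unfolding int nat by (simp add: algebra_simps abs_le_iff)
    moreover have "real n * f t - real n * t * f 1 = real n * (f t - t * f 1)" by (simp add: algebra_simps)
    ultimately show ?thesis by (simp add: abs_mult)
  qed
  then have "\<bar>f t - t * f 1\<bar> = 0"
    by (metis abs_ge_zero abs_of_nonneg le_less not_less reals_Archimedean3)
  then show ?thesis by simp
qed

text \<open>
  Since \<open>L\<close> is defined on all bounded functions, it can be applied to indicators of arbitrary sets.
  Let \<open>s n\<close> be maps of \<open>K\<close> into itself with finite range that move points by less than \<open>1/(n + 1)\<close>; then
  \<open>v \<mapsto> L (v \<circ> s n)\<close> is integration against a finitely supported probability measure, and it converges to \<open>L v\<close>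
  for continuous \<open>v\<close>.  The measures are lifted to the line along a continuous map \<open>g\<close> that covers \<open>K\<close>; a weak limit of a
  subsequence of the lifts, mapped back by \<open>g\<close>, represents \<open>L\<close>.
\<close>

theorem Riesz_representation_compact_plane:
  fixes K :: "complex set" and L :: "(complex \<Rightarrow> real) \<Rightarrow> real"
  assumes K: "compact K"
    and add: "\<And>v w. bounded (v ` K) \<Longrightarrow> bounded (w ` K) \<Longrightarrow> L (\<lambda>x. v x + w x) = L v + L w"
    and nonneg: "\<And>v. bounded (v ` K) \<Longrightarrow> (\<And>x. x \<in> K \<Longrightarrow> 0 \<le> v x) \<Longrightarrow> 0 \<le> L v"
    and one: "L (\<lambda>_. 1) = 1"
  obtains \<mu> where "sets \<mu> = sets (restrict_space borel K)" "prob_space \<mu>"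
    "\<And>v. continuous_on K v \<Longrightarrow> integral\<^sup>L \<mu> v = L v"
proof -
  have bplus: "bounded ((\<lambda>x. v x + w x) ` K)" if "bounded (v ` K)" "bounded (w ` K)" for v w :: "complex \<Rightarrow> real"
    using that by (rule bounded_plus_comp)
  have bscale: "bounded ((\<lambda>x. c * v x) ` K)" if "bounded (v ` K)" for v :: "complex \<Rightarrow> real" and c
    using bounded_scaling[OF that, of c] by (simp add: image_image)
  have bconst: "bounded ((\<lambda>_. c) ` K)" for c :: real by (auto simp: image_constant_conv)
  have scale: "L (\<lambda>x. c * v x) = c * L v" if v: "bounded (v ` K)" "\<And>x. x \<in> K \<Longrightarrow> 0 \<le> v x" for c v
  proof -
    have "L (\<lambda>x. c * v x) = c * L (\<lambda>x. 1 * v x)"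
    proof (rule additive_nonneg_imp_scale[of "\<lambda>c. L (\<lambda>x. c * v x)"])
      show "L (\<lambda>x. (s + t) * v x) = L (\<lambda>x. s * v x) + L (\<lambda>x. t * v x)" for s t
        using add[OF bscale bscale, OF v(1) v(1), of s t] by (simp add: algebra_simps)
      show "0 \<le> L (\<lambda>x. t * v x)" if "0 \<le> t" for t
        by (rule nonneg) (use bscale v that in auto)
    qed
    then show ?thesis by simp
  qed
  have const: "L (\<lambda>_. c) = c" for c
    using scale[of "\<lambda>_. 1" c] bconst one by simp
  have mono: "L v \<le> L w" if "bounded (v ` K)" "bounded (w ` K)" "\<And>x. x \<in> K \<Longrightarrow> v x \<le> w x" for v w
  proof -
    have b: "bounded ((\<lambda>x. w x - v x) ` K)" using that(2,1) by (rule bounded_minus_comp)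
    have "L (\<lambda>x. v x + (w x - v x)) = L v + L (\<lambda>x. w x - v x)"
      by (rule add[OF that(1) b])
    moreover have "0 \<le> L (\<lambda>x. w x - v x)"
      using that by (intro nonneg b) auto
    ultimately show ?thesis by simp
  qed
  have cong: "L v = L w" if "bounded (v ` K)" "\<And>x. x \<in> K \<Longrightarrow> v x = w x" for v w
  proof -
    have "bounded (w ` K)" using that by (metis image_cong)
    then show ?thesis using mono[of v w] mono[of w v] that by force
  qed
  have sum: "finite I \<Longrightarrow> (\<And>i. i \<in> I \<Longrightarrow> bounded (v i ` K)) \<Longrightarrow> 
      bounded ((\<lambda>x. \<Sum>i\<in>I. v i x) ` K) \<and> L (\<lambda>x. \<Sum>i\<in>I. v i x) = (\<Sum>i\<in>I. L (v i))" for I and v :: "complex \<Rightarrow> complex \<Rightarrow> real"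
  proof (induction rule: finite_induct)
    case empty
    then show ?case using const[of 0] bconst[of 0] by simp
  next
    case (insert i I)
    then show ?case using add[of "v i" "\<lambda>x. \<Sum>i\<in>I. v i x"] bplus[of "v i" "\<lambda>x. \<Sum>i\<in>I. v i x"] by simp
  qed
  obtain g :: "real \<Rightarrow> complex" where g: "continuous_on UNIV g" "K \<subseteq> g ` {0..1}"
    using compact_subset_continuous_image_interval[OF K] by blast
  \<comment> \<open>An arbitrary section of \<open>g\<close> over \<open>K\<close>, possibly non-measurable; it only transports discrete measures.\<close>
  define h where "h y = (SOME t. t \<in> {0..1} \<and> g t = y)" for y
  have h: "h y \<in> {0..1}" "g (h y) = y" if "y \<in> K" for y
    using someI_ex[of "\<lambda>t. t \<in> {0..1} \<and> g t = y"] g(2) that unfolding h_def by blast+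
  have "\<exists>s. finite (s ` K) \<and> s ` K \<subseteq> K \<and> (\<forall>x\<in>K. dist (s x) x < inverse (real (Suc n)))" for n
  proof -
    have "K \<subseteq> (\<Union>x\<in>K. ball x (inverse (real (Suc n))))" by force
    then obtain T where T: "finite T" "T \<subseteq> K" "K \<subseteq> (\<Union>x\<in>T. ball x (inverse (real (Suc n))))"
      using compactE_image[OF K, of K "\<lambda>x. ball x (inverse (real (Suc n)))"] by (metis open_ball)
    define s where "s x = (SOME y. y \<in> T \<and> dist y x < inverse (real (Suc n)))" for x
    have "s x \<in> T \<and> dist (s x) x < inverse (real (Suc n))" if "x \<in> K" for x
    proof -
      have "x \<in> (\<Union>y\<in>T. ball y (inverse (real (Suc n))))" using T(3) that by (rule subsetD)
      then have "\<exists>y. y \<in> T \<and> dist y x < inverse (real (Suc n))" by (simp only: UN_iff mem_ball) blast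
      then show ?thesis unfolding s_def by (rule someI_ex)
    qed
    then show ?thesis
      using T by (intro exI[of _ s]) (auto intro: finite_subset)
  qed
  then obtain s where s: "\<And>n. finite (s n ` K)" "\<And>n. s n ` K \<subseteq> K" "\<And>n x. x \<in> K \<Longrightarrow> dist (s n x) x < inverse (real (Suc n))"
    by metis
  define W where "W n y = L (indicator {x \<in> K. s n x = y})" for n y
  have bind: "bounded (indicator E ` K :: real set)" for E
    by (rule bounded_subset[of "{0, 1}"]) (auto simp: indicator_def)
  have W0: "0 \<le> W n y" for n y
    unfolding W_def by (rule nonneg[OF bind]) simp
  have Wsum: "(\<Sum>y\<in>s n ` K. v y * W n y) = L (\<lambda>x. v (s n x))" for n and v :: "complex \<Rightarrow> real"
  proof -
    have bi: "bounded ((\<lambda>x. v y * indicator {x \<in> K. s n x = y} x) ` K)" for y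
      by (rule bscale[OF bind])
    have "(\<Sum>y\<in>s n ` K. v y * W n y) = (\<Sum>y\<in>s n ` K. L (\<lambda>x. v y * indicator {x \<in> K. s n x = y} x))"
      unfolding W_def by (intro sum.cong refl scale[symmetric] bind) simp
    also have "\<dots> = L (\<lambda>x. \<Sum>y\<in>s n ` K. v y * indicator {x \<in> K. s n x = y} x)"
      using sum[OF s(1)[of n], of "\<lambda>y x. v y * indicator {x \<in> K. s n x = y} x"] bi by simp
    also have "\<dots> = L (\<lambda>x. v (s n x))"
    proof (rule cong)
      show "bounded ((\<lambda>x. \<Sum>y\<in>s n ` K. v y * indicator {x \<in> K. s n x = y} x) ` K)"
        using sum[OF s(1)[of n], of "\<lambda>y x. v y * indicator {x \<in> K. s n x = y} x"] bi by simp
      fix x assume "x \<in> K"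
      then have "(\<Sum>y\<in>s n ` K. v y * indicator {x \<in> K. s n x = y} x) = (\<Sum>y\<in>s n ` K. if y = s n x then v y else 0)"
        by (intro sum.cong) (auto simp: indicator_def)
      then show "(\<Sum>y\<in>s n ` K. v y * indicator {x \<in> K. s n x = y} x) = v (s n x)"
        using s(1) \<open>x \<in> K\<close> by simp
    qed
    finally show ?thesis .
  qed
  have Wsupp: "y \<in> s n ` K" if "W n y \<noteq> 0" for n y
  proof (rule ccontr)
    assume "y \<notin> s n ` K"
    then have "W n y = L (\<lambda>_. 0)"
      unfolding W_def by (intro cong bind) (auto simp: indicator_def)
    then show False using that const[of 0] by simp
  qed
  define p where "p n = embed_pmf (W n)" for n
  have p: "pmf (p n) y = W n y" for n y
    unfolding p_def
  proof (rule pmf_embed_pmf[OF W0])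
    have "(\<integral>\<^sup>+ y. ennreal (W n y) \<partial>count_space UNIV) = (\<Sum>y\<in>s n ` K. ennreal (W n y))"
      by (rule nn_integral_count_space'[OF s(1)]) (metis Wsupp ennreal_0, simp)
    also have "\<dots> = ennreal (\<Sum>y\<in>s n ` K. 1 * W n y)"
      by (simp add: W0)
    also have "\<dots> = 1"
      unfolding Wsum by (simp add: one)
    finally show "(\<integral>\<^sup>+ y. ennreal (W n y) \<partial>count_space UNIV) = 1" .
  qed
  define \<nu> where "\<nu> n = distr (measure_pmf (p n)) borel h" for n
  have real_dist: "real_distribution (\<nu> n)" for n
    unfolding \<nu>_def
    by (intro real_distribution.intro prob_space.prob_space_distr measure_pmf.prob_space_axioms) (auto simp: real_distribution_axioms_def)
  have int\<nu>: "(\<integral>t. f (g t) \<partial>\<nu> n) = L (\<lambda>x. f (s n x))" if "continuous_on UNIV f" for f :: "complex \<Rightarrow> real" and n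
  proof -
    have [measurable]: "f \<in> borel_measurable borel" "g \<in> borel_measurable borel"
      using that g(1) by (auto intro: borel_measurable_continuous_onI)
    have "(\<integral>t. f (g t) \<partial>\<nu> n) = (\<integral>y. f (g (h y)) \<partial>measure_pmf (p n))"
      unfolding \<nu>_def by (subst integral_distr) auto
    also have "\<dots> = (\<Sum>y\<in>s n ` K. f (g (h y)) * pmf (p n) y)"
      by (rule integral_measure_pmf_real[OF s(1)]) (use Wsupp in \<open>auto simp: set_pmf_iff p\<close>)
    also have "\<dots> = (\<Sum>y\<in>s n ` K. f y * W n y)"
      using h(2) s(2)[of n] by (intro sum.cong) (auto simp: p)
    finally show ?thesis unfolding Wsum .
  qed
  have "tight \<nu>"
    unfolding tight_def
  proof (intro conjI allI impI real_dist)
    fix \<epsilon> :: real assume "0 < \<epsilon>"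
    have "measure (\<nu> n) {-1<..1} = 1" for n
    proof -
      have "measure (\<nu> n) {-1<..1} = measure (measure_pmf (p n)) (h -` {-1<..1})"
        unfolding \<nu>_def by (subst measure_distr) auto
      also have "\<dots> = 1"
      proof (rule measure_pmf.prob_eq_1[THEN iffD2])
        show "AE y in measure_pmf (p n). y \<in> h -` {-1<..1}"
        proof (rule AE_pmfI)
          fix y assume "y \<in> set_pmf (p n)"
          then have "y \<in> K" using Wsupp[of n y] s(2)[of n] by (auto simp: set_pmf_iff p)
          then show "y \<in> h -` {-1<..1}" using h(1)[of y] by auto
        qed
      qed auto
      finally show ?thesis .
    qed
    then show "\<exists>a b. a < b \<and> (\<forall>n. 1 - \<epsilon> < measure (\<nu> n) {a<..b})"
      using \<open>0 < \<epsilon>\<close> by (intro exI[of _ "-1"] exI[of _ 1]) auto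
  qed
  from tight_imp_convergent_subsubsequence[OF this strict_mono_id]
  obtain r M where r: "strict_mono r" and M: "real_distribution M" and conv: "weak_conv_m (\<nu> \<circ> r) M"
    by (auto simp: comp_def id_def)
  have key: "(\<integral>t. f (g t) \<partial>M) = L f" if f: "continuous_on UNIV f" and bd: "\<And>x. \<bar>f x\<bar> \<le> B" for f :: "complex \<Rightarrow> real" and B
  proof -
    have fg: "continuous_on UNIV (\<lambda>t. f (g t))"
      using continuous_on_compose2[OF f g(1)] by simp
    have fb: "bounded (f ` K)" "bounded ((\<lambda>x. f (s n x)) ` K)" for n
      using bd by (auto simp: bounded_iff)
    have "(\<lambda>n. \<integral>t. f (g t) \<partial>(\<nu> \<circ> r) n) \<longlonglongrightarrow> (\<integral>t. f (g t) \<partial>M)"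
    proof (rule weak_conv_imp_integral_bdd_continuous_conv[OF _ M conv])
      show "real_distribution ((\<nu> \<circ> r) n)" for n using real_dist by simp
      show "isCont (\<lambda>t. f (g t)) t" for t using fg by (simp add: continuous_on_eq_continuous_at)
      show "norm (f (g t)) \<le> B" for t using bd by simp
    qed
    moreover have "(\<lambda>n. L (\<lambda>x. f (s n x))) \<longlonglongrightarrow> L f"
    proof (rule LIMSEQ_I)
      fix e :: real assume e: "0 < e"
      have "uniformly_continuous_on K f"
        by (rule compact_uniformly_continuous[OF continuous_on_subset[OF f] K]) auto
      then obtain d where d: "0 < d" "\<And>x y. x \<in> K \<Longrightarrow> y \<in> K \<Longrightarrow> dist y x < d \<Longrightarrow> dist (f y) (f x) < e / 2"
        using e unfolding uniformly_continuous_on_def by (meson half_gt_zero)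
      obtain N where N: "inverse (real (Suc N)) < d" using reals_Archimedean[OF d(1)] by blast
      have "norm (L (\<lambda>x. f (s n x)) - L f) < e" if "N \<le> n" for n
      proof -
        have "inverse (real (Suc n)) \<le> inverse (real (Suc N))"
          using that by (intro le_imp_inverse_le) auto
        then have "inverse (real (Suc n)) < d" using N by linarith
        then have close: "\<bar>f (s n x) - f x\<bar> \<le> e / 2" if "x \<in> K" for x
          using d(2)[OF that, of "s n x"] s(2)[of n] less_trans[OF s(3)[OF that, of n]] that
          by (force simp: dist_real_def simp del: of_nat_Suc)
        have "f (s n x) \<le> f x + e / 2" "f x \<le> f (s n x) + e / 2" if "x \<in> K" for x
          using close[OF that] by linarith+
        then have "L (\<lambda>x. f (s n x)) \<le> L (\<lambda>x. f x + e / 2)" "L f \<le> L (\<lambda>x. f (s n x) + e / 2)"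
          using mono[OF fb(2) bplus[OF fb(1) bconst], of n "e / 2"] mono[OF fb(1) bplus[OF fb(2) bconst], of n "e / 2"]
          by blast+
        then have "\<bar>L (\<lambda>x. f (s n x)) - L f\<bar> \<le> e / 2"
          using add[OF fb(1) bconst, of "e / 2"] add[OF fb(2) bconst, of n "e / 2"] const[of "e / 2"] by linarith
        then show ?thesis using e by auto
      qed
      then show "\<exists>N. \<forall>n\<ge>N. norm (L (\<lambda>x. f (s n x)) - L f) < e" by blast
    qed
    then have "(\<lambda>n. L (\<lambda>x. f (s (r n) x))) \<longlonglongrightarrow> L f"
      using LIMSEQ_subseq_LIMSEQ[OF _ r] by (fastforce simp: comp_def)
    ultimately show ?thesis
      using LIMSEQ_unique by (fastforce simp: int\<nu>[OF f])
  qed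
  interpret M: real_distribution M by (rule M)
  have [measurable]: "g \<in> borel_measurable borel"
    using g(1) by (rule borel_measurable_continuous_onI)
  define \<mu>0 where "\<mu>0 = distr M borel g"
  interpret \<mu>0: prob_space \<mu>0
    unfolding \<mu>0_def by (rule M.prob_space_distr) simp
  have key': "(\<integral>x. f x \<partial>\<mu>0) = L f" if "continuous_on UNIV f" "\<And>x. \<bar>f x\<bar> \<le> B" for f :: "complex \<Rightarrow> real" and B
    unfolding \<mu>0_def using key[OF that] that(1)
    by (subst integral_distr) (auto intro: borel_measurable_continuous_onI)
  have "K \<noteq> {}"
  proof
    assume "K = {}"
    then have "L (\<lambda>_. 1) = L (\<lambda>_. 0)" by (intro cong) auto
    then show False using const[of 1] const[of 0] by simp
  qed
  \<comment> \<open>A bounded continuous function whose zero set is \<open>K\<close>; its integral vanishes, so the limit measure lives on \<open>K\<close>.\<close>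
  define \<phi> where "\<phi> x = min 1 (infdist x K)" for x
  have \<phi>: "continuous_on UNIV \<phi>" "0 \<le> \<phi> x" "\<phi> x \<le> 1" for x
    unfolding \<phi>_def by (auto intro!: continuous_intros simp: infdist_nonneg)
  have [measurable]: "\<phi> \<in> borel_measurable borel"
    using \<phi>(1) by (rule borel_measurable_continuous_onI)
  have "(\<integral>x. \<phi> x \<partial>\<mu>0) = L \<phi>"
    by (rule key'[of _ 1]) (use \<phi> in \<open>auto simp: abs_of_nonneg\<close>)
  also have "\<dots> = L (\<lambda>_. 0)"
    by (rule cong) (auto simp: \<phi>_def bounded_iff infdist_nonneg intro!: exI[of _ 1])
  finally have "(\<integral>x. \<phi> x \<partial>\<mu>0) = 0" using const[of 0] by simp
  moreover have "integrable \<mu>0 \<phi>"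
    by (rule \<mu>0.integrable_const_bound[of _ 1]) (use \<phi> in \<open>auto simp: \<mu>0_def abs_of_nonneg\<close>)
  ultimately have "AE x in \<mu>0. \<phi> x = 0"
    using integral_nonneg_eq_0_iff_AE[of \<mu>0 \<phi>] \<phi> by auto
  then have AEK: "AE x in \<mu>0. x \<in> K"
  proof eventually_elim
    case (elim x)
    then have "infdist x K = 0" by (auto simp: \<phi>_def min_def split: if_splits)
    then show ?case
      using in_closed_iff_infdist_zero[OF compact_imp_closed[OF K] \<open>K \<noteq> {}\<close>] by simp
  qed
  have Kb: "K \<in> sets borel" using compact_imp_closed[OF K] by (rule borel_closed)
  have s0: "sets \<mu>0 = sets borel" "space \<mu>0 = UNIV" by (auto simp: \<mu>0_def)
  have e1: "emeasure \<mu>0 K = 1"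
    using \<mu>0.emeasure_eq_1_AE[OF _ AEK] Kb s0 by simp
  define \<mu> where "\<mu> = restrict_space \<mu>0 K"
  show thesis
  proof (rule that)
    show "sets \<mu> = sets (restrict_space borel K)"
      unfolding \<mu>_def by (rule sets_restrict_space_cong[OF s0(1)])
    show "prob_space \<mu>"
      unfolding \<mu>_def by (rule prob_space_restrict_space) (use Kb s0 e1 in auto)
    fix v :: "complex \<Rightarrow> real" assume v: "continuous_on K v"
    obtain B where B: "0 \<le> B" "\<And>x. x \<in> K \<Longrightarrow> \<bar>v x\<bar> \<le> B"
      using compact_imp_bounded[OF compact_continuous_image[OF v K]] unfolding bounded_iff
      by (metis abs_ge_zero \<open>K \<noteq> {}\<close> all_not_in_conv image_eqI order_trans real_norm_def)
    obtain w where w: "continuous_on UNIV w" "\<And>x. x \<in> K \<Longrightarrow> w x = v x" "\<And>x. \<bar>w x\<bar> \<le> B"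
      using Tietze[OF v _ B(1), of UNIV] compact_imp_closed[OF K] B(2) by (auto simp: closed_closedin[symmetric])
    have [measurable]: "w \<in> borel_measurable borel"
      using w(1) by (rule borel_measurable_continuous_onI)
    have "integral\<^sup>L \<mu> v = integral\<^sup>L \<mu> w"
      by (rule Bochner_Integration.integral_cong) (auto simp: \<mu>_def space_restrict_space w(2))
    also have "\<dots> = (\<integral>x. indicator K x *\<^sub>R w x \<partial>\<mu>0)"
      unfolding \<mu>_def by (rule integral_restrict_space) (use Kb s0 in auto)
    also have "\<dots> = (\<integral>x. w x \<partial>\<mu>0)"
      using AEK Kb by (intro integral_cong_AE) (auto simp: \<mu>0_def elim!: eventually_mono)
    also have "\<dots> = L w"
      by (rule key'[OF w(1,3)])
    also have "\<dots> = L v"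
      by (rule cong) (use w(2) B(2) in \<open>auto simp: bounded_iff\<close>)
    finally show "integral\<^sup>L \<mu> v = L v" .
  qed
qed

section \<open>Existence of Jensen measures\<close>

lemma regular_borel_probI:
  fixes X :: "'a::polish_space set"
  assumes X: "compact X" and sets: "sets \<mu> = sets (restrict_space borel X)" and prob: "prob_space \<mu>"
  shows "regular_borel_prob X \<mu>"
  unfolding regular_borel_prob_def
proof (intro conjI sets prob ballI)
  interpret prob_space \<mu> by (rule prob)
  have Xb: "X \<in> sets borel" using compact_imp_closed[OF X] by (rule borel_closed)
  have sp: "space \<mu> = X" using sets_eq_imp_space_eq[OF sets] by (simp add: space_restrict_space)
  have id: "(\<lambda>x. x) \<in> measurable \<mu> borel"
    unfolding measurable_cong_sets[OF sets refl] by (intro measurable_restrict_space1) simp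
  define M where "M = distr \<mu> borel (\<lambda>x. x)"
  have M: "sets M = sets borel" "emeasure M (space M) \<noteq> \<infinity>"
    unfolding M_def using id by (auto simp: emeasure_distr sp[symmetric] emeasure_space_1)
  have eM: "emeasure M B = emeasure \<mu> (B \<inter> X)" if "B \<in> sets borel" for B
    unfolding M_def using that id by (simp add: emeasure_distr sp vimage_def Int_def)
  fix E assume "E \<in> sets \<mu>"
  then have E: "E \<in> sets borel" "E \<subseteq> X"
    unfolding sets using Xb by (auto simp: sets_restrict_space)
  have EX: "emeasure M E = emeasure \<mu> E" using eM[OF E(1)] E(2) by (simp add: Int_absorb2)
  have "emeasure \<mu> E = (SUP C\<in>{C. C \<subseteq> E \<and> compact C}. emeasure M C)"
    using inner_regular[OF M E(1)] EX by simp
  also have "\<dots> = (SUP C\<in>{C. compact C \<and> C \<subseteq> E}. emeasure \<mu> C)"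
  proof (rule SUP_cong)
    fix C assume "C \<in> {C. compact C \<and> C \<subseteq> E}"
    then have "compact C" "C \<inter> X = C" using E(2) by auto
    then show "emeasure M C = emeasure \<mu> C"
      using eM[of C] by (simp add: borel_compact)
  qed auto
  finally show "emeasure \<mu> E = (SUP C\<in>{C. compact C \<and> C \<subseteq> E}. emeasure \<mu> C)" .
  have "emeasure \<mu> E = (INF U\<in>{U. E \<subseteq> U \<and> open U}. emeasure M U)"
    using outer_regular[OF M E(1)] EX by simp
  also have "\<dots> = (INF U\<in>{U. openin (top_of_set X) U \<and> E \<subseteq> U}. emeasure \<mu> U)"
  proof (rule INF_eq)
    fix U assume "U \<in> {U. E \<subseteq> U \<and> open U}"
    then show "\<exists>V\<in>{U. openin (top_of_set X) U \<and> E \<subseteq> U}. emeasure \<mu> V \<le> emeasure M U"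
      using eM[of U] E(2) by (intro bexI[of _ "U \<inter> X"]) (auto simp: openin_open)
  next
    fix V assume V: "V \<in> {U. openin (top_of_set X) U \<and> E \<subseteq> U}"
    then obtain U where "open U" "V = X \<inter> U" by (auto simp: openin_open)
    then show "\<exists>U\<in>{U. E \<subseteq> U \<and> open U}. emeasure M U \<le> emeasure \<mu> V"
      using eM[of U] V by (intro bexI[of _ U]) (auto simp: Int_commute)
  qed
  finally show "emeasure \<mu> E = (INF U\<in>{U. openin (top_of_set X) U \<and> E \<subseteq> U}. emeasure \<mu> U)" .
qed

lemma uniform_algebra_power:
  assumes "uniform_algebra X A" "f \<in> A" shows "(\<lambda>x\<in>X. f x ^ n) \<in> A"
proof (induction n)
  case 0
  then show ?case using assms unfolding uniform_algebra_def by (simp del: restrict_apply)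
next
  case (Suc n)
  have "\<forall>f\<in>A. \<forall>g\<in>A. (\<lambda>x\<in>X. f x * g x) \<in> A"
    using assms(1) unfolding uniform_algebra_def by (elim conjE)
  from this[rule_format, OF assms(2) Suc] have "(\<lambda>x\<in>X. f x * (\<lambda>x\<in>X. f x ^ n) x) \<in> A" .
  then show ?case by (simp cong: restrict_cong add: restrict_apply' del: restrict_apply)
qed

text \<open>
  The integral of \<open>ln f\<close> is split into the positive part \<open>P\<close> and the negative part, which is the increasing limit of
  its truncations \<open>Q N\<close>.  The truncated inequalities bound all \<open>\<integral> Q N\<close> by the same finite number, and monotone convergence
  removes the truncation.
\<close>

lemma elog_le_eintegral_elog:
  assumes prob: "prob_space \<mu>" and f[measurable]: "f \<in> borel_measurable \<mu>"
    and f0: "\<And>x. x \<in> space \<mu> \<Longrightarrow> 0 \<le> f x" and bd: "\<And>x. x \<in> space \<mu> \<Longrightarrow> f x \<le> B" and r: "0 < r"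
    and trunc: "\<And>N::nat. ln r \<le> (\<integral>x. ln (max (f x) (exp (- real N))) \<partial>\<mu>)"
  shows "elog r \<le> eintegral \<mu> (\<lambda>x. elog (f x))"
proof -
  interpret prob_space \<mu> by (rule prob)
  define P where "P x = ln (max (f x) 1)" for x
  define Q where "Q N x = - ln (max (min (f x) 1) (exp (- real N)))" for N x
  have [measurable]: "P \<in> borel_measurable \<mu>" "Q N \<in> borel_measurable \<mu>" for N
    unfolding P_def[abs_def] Q_def[abs_def] by measurable
  have P: "0 \<le> P x" "P x \<le> ln (max B 1)" if "x \<in> space \<mu>" for x
    using bd[OF that] by (auto simp: P_def)
  have Q: "0 \<le> Q N x" "Q N x \<le> real N" for N x
  proof -
    have "ln (exp (- real N)) \<le> ln (max (min (f x) 1) (exp (- real N)))"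
      by (subst ln_le_cancel_iff) (auto simp: less_max_iff_disj)
    then show "Q N x \<le> real N" by (simp add: Q_def)
    show "0 \<le> Q N x" by (auto simp: Q_def less_max_iff_disj intro!: ln_le_zero_iff[THEN iffD2])
  qed
  have iP: "integrable \<mu> P"
    by (rule integrable_const_bound[of _ "ln (max B 1)"]) (use P in auto)
  have iQ: "integrable \<mu> (Q N)" for N
    by (rule integrable_const_bound[of _ "real N"]) (use Q in auto)
  have split: "ln (max (f x) (exp (- real N))) = P x - Q N x" for N x
  proof -
    have e: "exp (- real N) \<le> 1" by simp
    have "max (f x) (exp (- real N)) = f x" if "1 < f x"
      using e that by (intro max_absorb1) linarith
    then show ?thesis by (cases "f x \<le> 1") (auto simp: P_def Q_def)
  qed
  have bound: "(\<integral>x. Q N x \<partial>\<mu>) \<le> (\<integral>x. P x \<partial>\<mu>) - ln r" for N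
    using trunc[of N] iP iQ[of N] unfolding split by simp
  have pos: "(\<integral>\<^sup>+x. e2ennreal (elog (f x)) \<partial>\<mu>) = ennreal (\<integral>x. P x \<partial>\<mu>)"
  proof -
    have "(\<integral>\<^sup>+x. e2ennreal (elog (f x)) \<partial>\<mu>) = (\<integral>\<^sup>+x. ennreal (P x) \<partial>\<mu>)"
    proof (rule nn_integral_cong)
      fix x assume "x \<in> space \<mu>"
      from f0[OF this] show "e2ennreal (elog (f x)) = ennreal (P x)"
        by (auto simp: elog_def P_def max_def e2ennreal_neg ennreal_neg simp flip: ennreal.abs_eq)
    qed
    also have "\<dots> = ennreal (\<integral>x. P x \<partial>\<mu>)"
      by (rule nn_integral_eq_integral[OF iP]) (use P in auto)
    finally show ?thesis .
  qed
  have "(\<integral>\<^sup>+x. e2ennreal (- elog (f x)) \<partial>\<mu>) \<le> (\<integral>\<^sup>+x. (SUP N. ennreal (Q N x)) \<partial>\<mu>)"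
  proof (rule nn_integral_mono)
    fix x assume "x \<in> space \<mu>"
    show "e2ennreal (- elog (f x)) \<le> (SUP N. ennreal (Q N x))"
    proof (cases "f x = 0")
      case True
      have "ennreal (Q N x) = of_nat N" for N
        by (simp add: Q_def True ennreal_of_nat_eq_real_of_nat)
      then show ?thesis by (simp add: ennreal_SUP_of_nat_eq_top)
    next
      case False
      then have fx: "0 < f x" using f0[OF \<open>x \<in> space \<mu>\<close>] by simp
      obtain N :: nat where N: "- ln (f x) \<le> real N" using real_arch_simple by blast
      have "exp (- real N) \<le> f x"
        using N fx by (metis exp_le_cancel_iff exp_ln minus_le_iff)
      then have "- ln (f x) \<le> Q N x"
        using fx by (auto simp: Q_def max_def min_def)
      then have "e2ennreal (- elog (f x)) \<le> ennreal (Q N x)"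
        using fx by (simp add: elog_def ennreal.abs_eq[symmetric] ennreal_leI)
      also have "\<dots> \<le> (SUP N. ennreal (Q N x))" by (rule SUP_upper) simp
      finally show ?thesis .
    qed
  qed
  also have "\<dots> = (SUP N. \<integral>\<^sup>+x. ennreal (Q N x) \<partial>\<mu>)"
  proof (rule nn_integral_monotone_convergence_SUP)
    show "incseq (\<lambda>N x. ennreal (Q N x))"
      unfolding incseq_def le_fun_def
    proof (intro allI impI ennreal_leI)
      fix m n :: nat and x assume "m \<le> n"
      then have "max (min (f x) 1) (exp (- real n)) \<le> max (min (f x) 1) (exp (- real m))"
        by (intro max.mono) auto
      then show "Q m x \<le> Q n x"
        unfolding Q_def by (simp add: less_max_iff_disj)
    qed
  qed simp
  also have "\<dots> \<le> ennreal ((\<integral>x. P x \<partial>\<mu>) - ln r)"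
  proof (rule SUP_least)
    fix N
    have "(\<integral>\<^sup>+x. ennreal (Q N x) \<partial>\<mu>) = ennreal (\<integral>x. Q N x \<partial>\<mu>)"
      by (rule nn_integral_eq_integral[OF iQ]) (use Q in auto)
    also have "\<dots> \<le> ennreal ((\<integral>x. P x \<partial>\<mu>) - ln r)"
      using bound by (rule ennreal_leI)
    finally show "(\<integral>\<^sup>+x. ennreal (Q N x) \<partial>\<mu>) \<le> ennreal ((\<integral>x. P x \<partial>\<mu>) - ln r)" .
  qed
  finally have neg: "(\<integral>\<^sup>+x. e2ennreal (- elog (f x)) \<partial>\<mu>) \<le> ennreal ((\<integral>x. P x \<partial>\<mu>) - ln r)" .
  have "0 \<le> (\<integral>x. Q 0 x \<partial>\<mu>)" by (intro Bochner_Integration.integral_nonneg Q)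
  then have D: "0 \<le> (\<integral>x. P x \<partial>\<mu>) - ln r" using bound[of 0] by linarith
  have "enn2ereal (\<integral>\<^sup>+x. e2ennreal (- elog (f x)) \<partial>\<mu>) \<le> enn2ereal (ennreal ((\<integral>x. P x \<partial>\<mu>) - ln r))"
    using neg by (simp add: less_eq_ennreal.rep_eq)
  also have "\<dots> = ereal ((\<integral>x. P x \<partial>\<mu>) - ln r)"
    using D by (simp add: enn2ereal_ennreal)
  finally have "ereal (\<integral>x. P x \<partial>\<mu>) - ereal ((\<integral>x. P x \<partial>\<mu>) - ln r) \<le> eintegral \<mu> (\<lambda>x. elog (f x))"
    unfolding eintegral_def pos using P by (intro ereal_minus_mono) (auto simp: enn2ereal_ennreal integral_nonneg_AE)
  then show ?thesis using r by (simp add: elog_def)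
qed

text \<open>
  Let \<open>S\<close> be the set of bounded functions \<open>h\<close> that dominate some
  \<open>(k (u - c) + ln (cmod f) - ln (cmod (f a))) / n\<close> with \<open>f \<in> A\<close> and \<open>f a \<noteq> 0\<close>, written in exponential form to
  allow zeros of \<open>f\<close>.  Products and powers in \<open>A\<close> make \<open>S\<close> closed under addition, and \<open>dom\<close> says that \<open>-1\<close>
  is not in \<open>S\<close>.  A positive functional that is nonnegative on \<open>S\<close> is represented by a measure \<open>\<mu>\<close>.  Its
  nonnegativity at \<open>u - c\<close> gives the bound for \<open>\<integral> u d\<mu>\<close>, and its nonnegativity at the truncations of
  \<open>ln (cmod f) - ln (cmod (f a))\<close> from below gives Jensen's inequality.
\<close>

theorem Jensen_measure_exists:
  fixes K :: "complex set"
  assumes A: "uniform_algebra K A" and a: "a \<in> K" and u: "continuous_on K u"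
    and dom: "\<And>k f. f \<in> A \<Longrightarrow> \<exists>x\<in>K. cmod (f a) * exp (real k * c) \<le> cmod (f x) * exp (real k * u x)"
  obtains \<mu> where "jensen_measure K A (\<lambda>f. f a) \<mu>" "c \<le> (\<integral>x. u x \<partial>\<mu>)"
proof -
  have K: "compact K"
    using A unfolding uniform_algebra_def by (elim conjE)
  have Acfun: "A \<subseteq> cfun K"
    using A unfolding uniform_algebra_def by (elim conjE)
  have "\<forall>c. (\<lambda>x\<in>K. c) \<in> A"
    using A unfolding uniform_algebra_def by (elim conjE)
  note Aconst = this[rule_format]
  have "\<forall>f\<in>A. \<forall>g\<in>A. (\<lambda>x\<in>K. f x * g x) \<in> A"
    using A unfolding uniform_algebra_def by (elim conjE)
  note Amult = this[rule_format]
  define e where "e = (\<lambda>x\<in>K. 1 :: complex)"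
  have e: "e \<in> A" "\<And>x. x \<in> K \<Longrightarrow> e x = 1" using Aconst[of 1] by (auto simp: e_def)
  have Acont: "continuous_on K f" if "f \<in> A" for f
    using Acfun cfun_eq[OF K] that by blast
  have bcont: "bounded (v ` K)" if "continuous_on K v" for v :: "complex \<Rightarrow> real"
    using compact_imp_bounded[OF compact_continuous_image[OF that K]] .
  define S where "S = {h :: complex \<Rightarrow> real. bounded (h ` K) \<and> (\<exists>n>0. \<exists>k::nat. \<exists>f\<in>A. f a \<noteq> 0 \<and>
     (\<forall>x\<in>K. cmod (f x) * exp (real k * (u x - c)) \<le> cmod (f a) * exp (real n * h x)))}"
  have SI: "h \<in> S" if "bounded (h ` K)" "n > 0" "f \<in> A" "f a \<noteq> 0"
    "\<And>x. x \<in> K \<Longrightarrow> cmod (f x) * exp (real k * (u x - c)) \<le> cmod (f a) * exp (real n * h x)" for h n k f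
    using that unfolding S_def by blast
  obtain L :: "(complex \<Rightarrow> real) \<Rightarrow> real" where Ladd: "\<And>v w. bounded (v ` K) \<Longrightarrow> bounded (w ` K) \<Longrightarrow> L (\<lambda>x. v x + w x) = L v + L w"
    and Lnonneg: "\<And>h. h \<in> S \<Longrightarrow> 0 \<le> L h" and Lone: "L (\<lambda>_. 1) = 1"
  proof (rule positive_functional_extension[of S K])
    show "bounded (h ` K)" if "h \<in> S" for h using that by (simp add: S_def)
    show "h \<in> S" if "bounded (h ` K)" "\<And>x. x \<in> K \<Longrightarrow> 0 \<le> h x" for h
      by (rule SI[of h 1 e 0]) (use that a e in auto)
    show "(\<lambda>x. h x + h' x) \<in> S" if hS: "h \<in> S" and hS': "h' \<in> S" for h h'
    proof -
      obtain n k f where f: "n > 0" "f \<in> A" "f a \<noteq> 0"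
        "\<And>x. x \<in> K \<Longrightarrow> cmod (f x) * exp (real k * (u x - c)) \<le> cmod (f a) * exp (real n * h x)"
        using hS unfolding S_def by blast
      obtain n' k' f' where f': "n' > 0" "f' \<in> A" "f' a \<noteq> 0"
        "\<And>x. x \<in> K \<Longrightarrow> cmod (f' x) * exp (real k' * (u x - c)) \<le> cmod (f' a) * exp (real n' * h' x)"
        using hS' unfolding S_def by blast
      define F where "F = (\<lambda>x\<in>K. (\<lambda>x\<in>K. f x ^ n') x * (\<lambda>x\<in>K. f' x ^ n) x)"
      have F: "F x = f x ^ n' * f' x ^ n" if "x \<in> K" for x using that by (simp add: F_def)
      show ?thesis
      proof (rule SI[of _ "n * n'" F "k * n' + k' * n"])
        show "bounded ((\<lambda>x. h x + h' x) ` K)"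
          using hS hS' unfolding S_def by (intro bounded_plus_comp) auto
        show "F \<in> A" unfolding F_def by (intro Amult uniform_algebra_power[OF A] f f')
        fix x assume x: "x \<in> K"
        have "cmod (F x) * exp (real (k * n' + k' * n) * (u x - c)) =
           (cmod (f x) * exp (real k * (u x - c))) ^ n' * (cmod (f' x) * exp (real k' * (u x - c))) ^ n"
          unfolding exp_of_nat_mult F[OF x]
          by (simp add: norm_mult norm_power power_mult_distrib power_add power_mult[symmetric])
        also have "\<dots> \<le> (cmod (f a) * exp (real n * h x)) ^ n' * (cmod (f' a) * exp (real n' * h' x)) ^ n"
          by (intro mult_mono power_mono f(4) f'(4) x) auto
        also have "\<dots> = cmod (F a) * exp (real (n * n') * (h x + h' x))"
          unfolding exp_of_nat_mult F[OF a] exp_add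
          by (simp add: norm_mult norm_power power_mult_distrib power_mult[symmetric] mult.commute[of n'])
        finally show "cmod (F x) * exp (real (k * n' + k' * n) * (u x - c)) \<le> cmod (F a) * exp (real (n * n') * (h x + h' x))" .
      qed (use f f' F[OF a] in auto)
    qed
    show "(\<lambda>_. - 1) \<notin> S"
    proof
      assume "(\<lambda>_. - 1) \<in> S"
      then obtain n k f where f: "n > 0" "f \<in> A" "f a \<noteq> 0"
        "\<And>x. x \<in> K \<Longrightarrow> cmod (f x) * exp (real k * (u x - c)) \<le> cmod (f a) * exp (real n * (- 1))"
        unfolding S_def by blast
      obtain x where x: "x \<in> K" "cmod (f a) * exp (real k * c) \<le> cmod (f x) * exp (real k * u x)"
        using dom[OF f(2)] by blast
      have "cmod (f a) \<le> cmod (f x) * exp (real k * (u x - c))"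
        using x(2) by (simp add: right_diff_distrib exp_diff field_simps)
      also have "\<dots> \<le> cmod (f a) * exp (real n * (- 1))" by (rule f(4)[OF x(1)])
      also have "\<dots> < cmod (f a) * 1" using f by (intro mult_strict_left_mono) auto
      finally show False by simp
    qed
  next
    fix L :: "(complex \<Rightarrow> real) \<Rightarrow> real" assume L: "\<And>v w. bounded (v ` K) \<Longrightarrow> bounded (w ` K) \<Longrightarrow> L (\<lambda>x. v x + w x) = L v + L w"
      "\<And>h. h \<in> S \<Longrightarrow> 0 \<le> L h" "L (\<lambda>_. 1) = 1"
    show thesis by (rule that[OF L])
  qed
  have nonneg_S: "v \<in> S" if "bounded (v ` K)" "\<And>x. x \<in> K \<Longrightarrow> 0 \<le> v x" for v
    by (rule SI[of v 1 e 0]) (use that a e in auto)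
  obtain \<mu> where \<mu>: "sets \<mu> = sets (restrict_space borel K)" "prob_space \<mu>"
    and int: "\<And>v. continuous_on K v \<Longrightarrow> integral\<^sup>L \<mu> v = L v"
    by (rule Riesz_representation_compact_plane[where L = L, OF K Ladd Lnonneg[OF nonneg_S] Lone]) (assumption | rule that)+
  interpret prob_space \<mu> by (rule \<mu>(2))
  have sp: "space \<mu> = K" using sets_eq_imp_space_eq[OF \<mu>(1)] by (simp add: space_restrict_space)
  have meas: "v \<in> borel_measurable \<mu>" if "continuous_on K v" for v :: "complex \<Rightarrow> real"
    unfolding measurable_cong_sets[OF \<mu>(1) refl] using that by (rule borel_measurable_continuous_on_restrict)
  have integrable: "integrable \<mu> v" if cv: "continuous_on K v" for v :: "complex \<Rightarrow> real"
  proof -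
    obtain B where "\<And>x. x \<in> K \<Longrightarrow> \<bar>v x\<bar> \<le> B" using bcont[OF cv] by (auto simp: bounded_iff)
    then show ?thesis by (intro integrable_const_bound[of _ B] meas cv) (auto simp: sp)
  qed
  have minus: "d \<le> integral\<^sup>L \<mu> v" if "continuous_on K v" "(\<lambda>x. v x - d) \<in> S" for v d
  proof -
    have "0 \<le> (\<integral>x. v x - d \<partial>\<mu>)"
      using Lnonneg[OF that(2)] int[OF continuous_on_diff[OF that(1) continuous_on_const]] by simp
    then show ?thesis using integrable[OF that(1)] by (simp add: prob_space)
  qed
  show thesis
  proof (rule that)
    show "c \<le> (\<integral>x. u x \<partial>\<mu>)"
    proof (rule minus[OF u])
      show "(\<lambda>x. u x - c) \<in> S"
      proof (rule SI[of _ 1 e 1])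
        show "bounded ((\<lambda>x. u x - c) ` K)"
          by (intro bcont continuous_on_diff u continuous_on_const)
      qed (use a e in auto)
    qed
    show "jensen_measure K A (\<lambda>f. f a) \<mu>"
      unfolding jensen_measure_def
    proof (intro conjI ballI regular_borel_probI K \<mu>)
      fix f assume f: "f \<in> A"
      show "elog (cmod (f a)) \<le> eintegral \<mu> (\<lambda>x. elog (cmod (f x)))"
      proof (cases "f a = 0")
        case True
        then show ?thesis by (simp add: elog_def)
      next
        case False
        have fc: "continuous_on K (\<lambda>x. cmod (f x))" by (intro continuous_intros Acont f)
        obtain B where B: "\<And>x. x \<in> K \<Longrightarrow> \<bar>cmod (f x)\<bar> \<le> B" using bcont[OF fc] by (auto simp: bounded_iff)
        show ?thesis
        proof (rule elog_le_eintegral_elog[OF \<mu>(2) meas[OF fc]])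
          fix N :: nat
          have pos: "0 < max (cmod (f x)) (exp (- real N))" for x by (simp add: less_max_iff_disj)
          have cont: "continuous_on K (\<lambda>x. ln (max (cmod (f x)) (exp (- real N))))"
            by (intro continuous_intros fc) (use pos in \<open>auto simp: less_le\<close>)
          show "ln (cmod (f a)) \<le> (\<integral>x. ln (max (cmod (f x)) (exp (- real N))) \<partial>\<mu>)"
          proof (rule minus[OF cont], rule SI[of _ 1 f 0])
            show "bounded ((\<lambda>x. ln (max (cmod (f x)) (exp (- real N))) - ln (cmod (f a))) ` K)"
              by (intro bcont continuous_on_diff cont continuous_on_const)
            show "cmod (f x) * exp (real 0 * (u x - c)) \<le> cmod (f a) * exp (real 1 * (ln (max (cmod (f x)) (exp (- real N))) - ln (cmod (f a))))" for x
              using pos[of x] False by (simp add: exp_diff)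
          qed (use f False in auto)
        qed (use B False in \<open>auto simp: sp\<close>)
      qed
    qed
  qed
qed

text \<open>
  Jensen's inequality for \<open>z - x\<close>, whose integral against the point mass is \<open>-\<infinity>\<close>, forces \<open>a - x = 0\<close>.
\<close>

lemma Jensen_point_mass:
  fixes K :: "complex set"
  assumes K: "compact K" and z: "(\<lambda>z\<in>K. z - x) \<in> A" and x: "x \<in> K"
    and J: "jensen_measure K A (\<lambda>f. f a) (return (restrict_space borel K) x)" and a: "a \<in> K"
  shows "x = a"
proof -
  let ?\<mu> = "return (restrict_space borel K) x"
  let ?f = "\<lambda>z\<in>K. z - x"
  have sp: "x \<in> space (restrict_space borel K)" using x by (simp add: space_restrict_space)
  have cont: "continuous_on K (\<lambda>y. cmod (?f y))"
    by (rule continuous_on_eq[of _ "\<lambda>y. cmod (y - x)"]) (auto intro!: continuous_intros)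
  have [measurable]: "(\<lambda>y. cmod (?f y)) \<in> borel_measurable (restrict_space borel K)"
    by (rule borel_measurable_continuous_on_restrict[OF cont])
  have el[measurable]: "elog \<in> borel_measurable borel"
    unfolding elog_def[abs_def] by measurable
  have "(\<lambda>y. e2ennreal (elog (cmod (?f y)))) \<in> borel_measurable (restrict_space borel K)"
    "(\<lambda>y. e2ennreal (- elog (cmod (?f y)))) \<in> borel_measurable (restrict_space borel K)"
    by measurable
  then have "eintegral ?\<mu> (\<lambda>y. elog (cmod (?f y))) = - \<infinity>"
    unfolding eintegral_def using sp x by (simp add: nn_integral_return elog_def e2ennreal_neg zero_ennreal.rep_eq)
  then have "elog (cmod (?f a)) = - \<infinity>"
    using J z unfolding jensen_measure_def by fastforce
  then show ?thesis using a by (auto simp: elog_def split: if_splits)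
qed

text \<open>
  The Jensen measure with \<open>c \<le> \<integral> u d\<mu>\<close> has to be the point mass at \<open>a\<close>.
\<close>

theorem no_Jensen_measures_imp_bound:
  fixes K :: "complex set"
  assumes A: "uniform_algebra K A" and triv: "no_nontrivial_jensen_measures K A" 
    and z: "\<And>x. (\<lambda>z\<in>K. z - x) \<in> A"
    and a: "a \<in> K" and u: "continuous_on K u"
    and dom: "\<And>k f. f \<in> A \<Longrightarrow> \<exists>x\<in>K. cmod (f a) * exp (real k * c) \<le> cmod (f x) * exp (real k * u x)"
  shows "c \<le> u a"
proof -
  obtain \<mu> where \<mu>: "jensen_measure K A (\<lambda>f. f a) \<mu>" "c \<le> (\<integral>x. u x \<partial>\<mu>)"
    using Jensen_measure_exists[OF A a u dom] by blast
  have K: "compact K" using A unfolding uniform_algebra_def by blast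
  have "(\<lambda>x\<in>K. 1) \<in> A" using A unfolding uniform_algebra_def by blast
  then have "algebra_character K A (\<lambda>f. f a)"
    unfolding algebra_character_def linear_on_algebra_def using a by (auto intro!: bexI[of _ "\<lambda>x\<in>K. 1"])
  then obtain x where x: "x \<in> K" "\<mu> = return (restrict_space borel K) x"
    using triv \<mu>(1) unfolding no_nontrivial_jensen_measures_def by blast
  then have "x = a" using Jensen_point_mass[OF K z x(1) _ a] \<mu>(1) by simp
  have "(\<integral>x. u x \<partial>\<mu>) = u x"
    unfolding x(2) by (rule integral_return)
      (use x(1) u in \<open>auto simp: space_restrict_space intro: borel_measurable_continuous_on_restrict\<close>)
  then show ?thesis using \<mu>(2) \<open>x = a\<close> by simp
qed

section \<open>Naturality of the algebra on the circle bundle\<close>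

lemma polynomial_funs_comp_fst:
  assumes "p \<in> polynomial_funs {\<lambda>z. z}"
  shows "(\<lambda>x. p (fst x)) \<in> polynomial_funs {fst, snd :: complex \<times> complex \<Rightarrow> complex}"
  using assms
proof induction
  case (coord z)
  then show ?case using polynomial_funs.coord[of fst "{fst, snd}"] by simp
qed (rule polynomial_funs.const polynomial_funs.add polynomial_funs.mult; assumption)+

lemma compact_X_over:
  assumes "compact K" shows "compact (X_over K)"
proof -
  have "X_over K = (K \<times> cball 0 1) \<inter> {x. (cmod (fst x))\<^sup>2 + (cmod (snd x))\<^sup>2 = 1}"
  proof -
    have "cmod w \<le> 1" if "(cmod z)\<^sup>2 + (cmod w)\<^sup>2 = 1" for z w
    proof (rule power2_le_imp_le)
      show "(cmod w)\<^sup>2 \<le> 1\<^sup>2" using that zero_le_power2[of "cmod z"] unfolding one_power2 by linarith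
    qed simp
    then show ?thesis by (auto simp: X_over_def)
  qed
  moreover have "closed {x :: complex \<times> complex. (cmod (fst x))\<^sup>2 + (cmod (snd x))\<^sup>2 = 1}"
    by (intro closed_Collect_eq continuous_intros)
  ultimately show ?thesis
    using assms by (auto intro!: compact_Int_closed compact_Times)
qed

locale compact_in_disc =
  fixes K :: "complex set"
  assumes compact_K: "compact K" and K_disc: "K \<subseteq> ball 0 1"
begin

abbreviation "X \<equiv> X_over K"

sublocale K: continuous_coordinates "{\<lambda>z. z}" K
  using compact_K by unfold_locales auto

sublocale X: continuous_coordinates "{fst, snd :: complex \<times> complex \<Rightarrow> complex}" "X_over K"
  using compact_X_over[OF compact_K] by unfold_locales (auto intro: continuous_intros)

definition radius :: "complex \<Rightarrow> real" where "radius z = sqrt (1 - (cmod z)\<^sup>2)"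

lemma radius_pos: "z \<in> K \<Longrightarrow> 0 < radius z"
proof -
  assume "z \<in> K"
  then have "cmod z < 1" using K_disc by auto
  then have "(cmod z)\<^sup>2 < 1" by (simp add: power_less_one_iff)
  then show ?thesis by (simp add: radius_def)
qed

lemma continuous_radius: "continuous_on S radius"
  unfolding radius_def by (intro continuous_intros)

lemma mem_X_iff: "(z, w) \<in> X \<longleftrightarrow> z \<in> K \<and> cmod w = radius z"
proof (cases "z \<in> K")
  case True
  then have "0 < radius z" by (rule radius_pos)
  then have "0 < 1 - (cmod z)\<^sup>2" by (simp add: radius_def)
  then have "cmod w = radius z \<longleftrightarrow> (cmod w)\<^sup>2 = 1 - (cmod z)\<^sup>2"
    unfolding radius_def by (metis less_imp_le norm_ge_zero real_sqrt_abs abs_of_nonneg real_sqrt_pow2)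
  then have "(cmod z)\<^sup>2 + (cmod w)\<^sup>2 = 1 \<longleftrightarrow> cmod w = radius z"
    by auto
  then show ?thesis by (simp add: X_over_def True)
qed (simp add: X_over_def)

lemma fst_X: "fst ` X = K"
proof
  show "K \<subseteq> fst ` X"
  proof
    fix z assume "z \<in> K"
    then have "(z, of_real (radius z)) \<in> X" using radius_pos[of z] by (simp add: mem_X_iff)
    then show "z \<in> fst ` X" by force
  qed
qed (auto simp: mem_X_iff)

lemma pullback_mem:
  assumes "f \<in> R_1 K" shows "(\<lambda>x\<in>X. f (fst x)) \<in> R_2 X"
proof -
  obtain r where r: "\<And>n::nat. r n \<in> rational_funs {\<lambda>z. z} K" "uniform_limit K r f sequentially"
    using assms unfolding K.mem_iff_uniform_limit by blast
  have rat: "(\<lambda>x\<in>X. r n (fst x)) \<in> rational_funs {fst, snd} X" for n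
  proof -
    obtain p q where *: "p \<in> polynomial_funs {\<lambda>z. z}" "q \<in> polynomial_funs {\<lambda>z. z}" "\<forall>x\<in>K. q x \<noteq> 0" 
      "\<And>x. x \<in> K \<Longrightarrow> r n x = p x / q x"
      using K.rational_funsE[OF r(1)[of n]] by metis
    show ?thesis
      by (rule X.rational_funsI[OF polynomial_funs_comp_fst[OF *(1)] polynomial_funs_comp_fst[OF *(2)]])
        (use *(3,4) fst_X in auto)
  qed
  have "uniform_limit X (\<lambda>n x. r n (fst x)) (\<lambda>x. f (fst x)) sequentially"
    using r(2) unfolding uniform_limit_iff by (rule all_forward) (use fst_X in \<open>auto elim!: eventually_mono\<close>)
  then have "uniform_limit X (\<lambda>n. \<lambda>x\<in>X. r n (fst x)) (\<lambda>x. f (fst x)) sequentially"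
    by (rule uniform_limit_cong'[THEN iffD1, rotated -1]) auto
  moreover have "continuous_on X (\<lambda>x. f (fst x))"
    by (rule continuous_on_compose2[OF K.mem_continuous[OF assms]]) (use fst_X in \<open>auto intro: continuous_intros\<close>)
  ultimately show ?thesis
    using rat by (intro X.uniform_limit_mem)
qed

lemma R_1_shift_mem: "(\<lambda>z\<in>K. z - x) \<in> R_1 K"
  using K.polynomial_mem[OF polynomial_funs.add[OF polynomial_funs.coord[of "\<lambda>z. z"] polynomial_funs.const[of "- x"]]]
  by simp

lemma uniform_algebra_R_1: "K \<noteq> {} \<Longrightarrow> uniform_algebra K (R_1 K)"
  by (rule K.uniform_algebra_A) auto

lemma uniform_algebra_R_2: "K \<noteq> {} \<Longrightarrow> uniform_algebra X (R_2 X)"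
  by (rule X.uniform_algebra_A) (use fst_X in \<open>auto simp: prod_eq_iff\<close>)

lemma pullback_character:
  assumes \<phi>: "algebra_character X (R_2 X) \<phi>"
  shows "algebra_character K (R_1 K) (\<lambda>f. \<phi> (\<lambda>x\<in>X. f (fst x)))"
proof -
  have K: "x \<in> X \<Longrightarrow> fst x \<in> K" for x using fst_X by blast
  have add: "\<phi> (\<lambda>x\<in>X. (\<lambda>z\<in>K. f z + g z) (fst x)) = \<phi> (\<lambda>x\<in>X. f (fst x)) + \<phi> (\<lambda>x\<in>X. g (fst x))"
    if "f \<in> R_1 K" "g \<in> R_1 K" for f g
  proof -
    have "(\<lambda>x\<in>X. (\<lambda>z\<in>K. f z + g z) (fst x)) = (\<lambda>x\<in>X. (\<lambda>x\<in>X. f (fst x)) x + (\<lambda>x\<in>X. g (fst x)) x)"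
      by (rule restrict_ext) (simp add: K)
    then show ?thesis using X.character_add[OF \<phi> pullback_mem pullback_mem] that by simp
  qed
  have mult: "\<phi> (\<lambda>x\<in>X. (\<lambda>z\<in>K. f z * g z) (fst x)) = \<phi> (\<lambda>x\<in>X. f (fst x)) * \<phi> (\<lambda>x\<in>X. g (fst x))"
    if "f \<in> R_1 K" "g \<in> R_1 K" for f g
  proof -
    have "(\<lambda>x\<in>X. (\<lambda>z\<in>K. f z * g z) (fst x)) = (\<lambda>x\<in>X. (\<lambda>x\<in>X. f (fst x)) x * (\<lambda>x\<in>X. g (fst x)) x)"
      by (rule restrict_ext) (simp add: K)
    then show ?thesis using X.character_mult[OF \<phi> pullback_mem pullback_mem] that by simp
  qed
  have const: "\<phi> (\<lambda>x\<in>X. (\<lambda>z\<in>K. c) (fst x)) = c" for c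
  proof -
    have "(\<lambda>x\<in>X. (\<lambda>z\<in>K. c) (fst x)) = (\<lambda>x\<in>X. c)"
      by (rule restrict_ext) (simp add: K)
    then show ?thesis using X.character_const[OF \<phi>] by simp
  qed
  have scale: "\<phi> (\<lambda>x\<in>X. (\<lambda>z\<in>K. c * f z) (fst x)) = c * \<phi> (\<lambda>x\<in>X. f (fst x))" if "f \<in> R_1 K" for c f
  proof -
    have "(\<lambda>z\<in>K. c * f z) = (\<lambda>z\<in>K. (\<lambda>z\<in>K. c) z * f z)"
      by (rule restrict_ext) simp
    then show ?thesis using mult[OF K.const_mem[of c] that] const[of c] by simp
  qed
  show ?thesis
    unfolding algebra_character_def linear_on_algebra_def
  proof (intro conjI ballI allI)
    show "\<exists>f\<in>R_1 K. \<phi> (\<lambda>x\<in>X. f (fst x)) \<noteq> 0"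
      using const[of 1] by (intro bexI[OF _ K.const_mem[of 1]]) simp
  qed (rule add mult scale; assumption)+
qed

text \<open>
  The products of pullbacks \<open>f\<close> with powers of \<open>g\<close> have modulus \<open>cmod (f z) * exp (k * u z)\<close>, and a character takes
  on them one of their values; this is the domination needed for a Jensen measure.
\<close>

lemma character_log_bound:
  assumes triv: "no_nontrivial_jensen_measures K (R_1 K)" and \<phi>: "algebra_character X (R_2 X) \<phi>"
    and a: "a = \<phi> (restrict fst X)" "a \<in> K"
    and g: "g \<in> R_2 X" "\<And>x. x \<in> X \<Longrightarrow> cmod (g x) = exp (u (fst x))" and u: "continuous_on K u"
  shows "ln (cmod (\<phi> g)) \<le> u a"
proof (rule no_Jensen_measures_imp_bound[OF uniform_algebra_R_1 triv R_1_shift_mem a(2) u])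
  show "K \<noteq> {}" using a(2) by auto
  have eval: "\<phi> (\<lambda>x\<in>X. f (fst x)) = f a" if "f \<in> R_1 K" for f
  proof (rule K.character_eq_evaluation[OF pullback_character[OF \<phi>] _ a(2) that])
    show "\<phi> (\<lambda>x\<in>X. (restrict z K) (fst x)) = z a" if "z \<in> {\<lambda>z. z}" for z
    proof -
      have "(\<lambda>x\<in>X. (restrict z K) (fst x)) = restrict fst X"
        using that fst_X by (intro restrict_ext) auto
      then show ?thesis using a(1) that by (simp only: singleton_iff)
    qed
  qed
  fix k :: nat and f assume f: "f \<in> R_1 K"
  have gk: "(\<lambda>x\<in>X. g x ^ k) \<in> R_2 X" by (rule X.power_mem[OF g(1)])
  obtain x where x: "x \<in> X" "\<phi> (\<lambda>x\<in>X. (\<lambda>x\<in>X. f (fst x)) x * (\<lambda>x\<in>X. g x ^ k) x) = (\<lambda>x\<in>X. (\<lambda>x\<in>X. f (fst x)) x * (\<lambda>x\<in>X. g x ^ k) x) x"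
    using X.character_mem_range[OF \<phi> X.mult_mem[OF pullback_mem[OF f] gk]] by blast
  have "\<phi> g \<noteq> 0"
    using X.character_mem_range[OF \<phi> g(1)] g(2) by (metis exp_not_eq_zero norm_eq_zero)
  have "f a * \<phi> g ^ k = f (fst x) * g x ^ k"
    using x(1,2) X.character_mult[OF \<phi> pullback_mem[OF f] gk] X.character_power[OF \<phi> g(1)] eval[OF f] by simp
  then have "cmod (f a) * cmod (\<phi> g) ^ k = cmod (f (fst x)) * cmod (g x) ^ k"
    by (metis norm_mult norm_power)
  then have "cmod (f a) * exp (real k * ln (cmod (\<phi> g))) = cmod (f (fst x)) * exp (real k * u (fst x))"
    using \<open>\<phi> g \<noteq> 0\<close> by (simp add: exp_of_nat_mult g(2)[OF x(1)])
  then show "\<exists>x\<in>K. cmod (f a) * exp (real k * ln (cmod (\<phi> g))) \<le> cmod (f x) * exp (real k * u x)"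
    using x(1) fst_X by (intro bexI[of _ "fst x"]) auto
qed

text \<open>
  The bound is used twice, for \<open>w\<close> and for \<open>1/w\<close>, to place the point \<open>(a, b)\<close> on the circle over \<open>a\<close>.
\<close>

theorem natural_R_2:
  assumes triv: "no_nontrivial_jensen_measures K (R_1 K)"
  shows "natural_on X (R_2 X)"
  unfolding natural_on_def
proof (intro allI impI)
  fix \<phi> assume \<phi>: "algebra_character X (R_2 X) \<phi>"
  define a where "a = \<phi> (restrict fst X)"
  define b where "b = \<phi> (restrict snd X)"
  have fstB: "restrict fst X \<in> R_2 X" and sndB: "restrict snd X \<in> R_2 X"
    by (rule X.coord_mem; simp)+
  obtain x where "x \<in> X" "a = restrict fst X x"
    using X.character_mem_range[OF \<phi> fstB] unfolding a_def by blast
  then have a: "a \<in> K" using fst_X by auto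
  have nz: "restrict snd X x \<noteq> 0" and mod: "cmod (restrict snd X x) = radius (fst x)" if "x \<in> X" for x
    using that radius_pos[of "fst x"] mem_X_iff[of "fst x" "snd x"] by auto
  have b: "b \<noteq> 0"
    using X.character_mem_range[OF \<phi> sndB] nz unfolding b_def by metis
  have up: "ln (cmod b) \<le> ln (radius a)"
    unfolding b_def
  proof (rule character_log_bound[OF triv \<phi> a_def a sndB, of "\<lambda>z. ln (radius z)"])
    show "continuous_on K (\<lambda>z. ln (radius z))"
      by (intro continuous_intros continuous_radius) (use radius_pos in force)
    show "cmod (restrict snd X x) = exp (ln (radius (fst x)))" if "x \<in> X" for x
    proof -
      have "fst x \<in> K" using that fst_X by blast
      then show ?thesis using mod[OF that] radius_pos[of "fst x"] by simp
    qed
  qed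
  define g where "g = (\<lambda>x\<in>X. inverse (restrict snd X x))"
  have gB: "g \<in> R_2 X"
    unfolding g_def by (rule X.inverse_mem[OF sndB]) (use nz in blast)
  have gb: "\<phi> g = inverse b"
  proof -
    have "(\<lambda>x\<in>X. g x * restrict snd X x) = (\<lambda>x\<in>X. 1)"
      using nz by (intro restrict_ext) (auto simp: g_def)
    then have "\<phi> g * b = 1"
      using X.character_mult[OF \<phi> gB sndB] X.character_one[OF \<phi>] b_def by simp
    then show ?thesis using b by (simp add: field_simps)
  qed
  have down: "ln (cmod (\<phi> g)) \<le> - ln (radius a)"
  proof (rule character_log_bound[OF triv \<phi> a_def a gB, of "\<lambda>z. - ln (radius z)"])
    show "continuous_on K (\<lambda>z. - ln (radius z))"
      by (intro continuous_intros continuous_radius) (use radius_pos in force)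
    show "cmod (g x) = exp (- ln (radius (fst x)))" if "x \<in> X" for x
    proof -
      have "fst x \<in> K" using that fst_X by blast
      then show ?thesis
        using mod[OF that] radius_pos[of "fst x"] that by (simp add: g_def exp_minus norm_inverse)
    qed
  qed
  then have "ln (radius a) \<le> ln (cmod b)"
    unfolding gb using b by (simp add: norm_inverse ln_inverse)
  with up have "cmod b = radius a"
    using b radius_pos[OF a] by (simp add: ln_inj_iff)
  then have "(a, b) \<in> X" using a by (simp add: mem_X_iff)
  moreover have "\<phi> f = f (a, b)" if "f \<in> R_2 X" for f
    by (rule X.character_eq_evaluation[OF \<phi> _ \<open>(a, b) \<in> X\<close> that]) (auto simp: a_def b_def)
  ultimately show "\<exists>x\<in>X. \<forall>f\<in>R_2 X. \<phi> f = f x" by blast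
qed

end

section \<open>The circle group and its Haar measure\<close>

text \<open>
  Half-open periods split exactly into half-open pieces, so no null sets have to be discarded.
\<close>

lemma nn_integral_periodic_shift:
  fixes F :: "real \<Rightarrow> ennreal"
  assumes F[measurable]: "F \<in> borel_measurable borel" and per: "\<And>t. F (t + 1) = F t" and c: "0 \<le> c" "c \<le> 1"
  shows "(\<integral>\<^sup>+t. F (t - c) * indicator {0..<1} t \<partial>lborel) = (\<integral>\<^sup>+t. F t * indicator {0..<1} t \<partial>lborel)"
proof -
  have per': "F (t - 1) = F t" for t using per[of "t - 1"] by simp
  have "(\<integral>\<^sup>+t. F (t - c) * indicator {0..<1} t \<partial>lborel) = (\<integral>\<^sup>+u. F (c + u - c) * indicator {0..<1} (c + u) \<partial>lborel)"
    using nn_integral_real_affine[of "\<lambda>t. F (t - c) * indicator {0..<1} t" 1 c] by simp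
  also have "\<dots> = (\<integral>\<^sup>+u. F u * indicator {-c..<0} u + F u * indicator {0..<1 - c} u \<partial>lborel)"
    using c by (intro nn_integral_cong) (auto split: split_indicator)
  also have "\<dots> = (\<integral>\<^sup>+u. F u * indicator {-c..<0} u \<partial>lborel) + (\<integral>\<^sup>+u. F u * indicator {0..<1 - c} u \<partial>lborel)"
    by (rule nn_integral_add) auto
  also have "(\<integral>\<^sup>+u. F u * indicator {-c..<0} u \<partial>lborel) = (\<integral>\<^sup>+u. F (-1 + u) * indicator {-c..<0} (-1 + u) \<partial>lborel)"
    using nn_integral_real_affine[of "\<lambda>u. F u * indicator {-c..<0} u" 1 "-1"] by simp
  also have "\<dots> = (\<integral>\<^sup>+u. F u * indicator {1 - c..<1} u \<partial>lborel)"
    using per' by (intro nn_integral_cong) (auto split: split_indicator)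
  also have "\<dots> + (\<integral>\<^sup>+u. F u * indicator {0..<1 - c} u \<partial>lborel) = (\<integral>\<^sup>+u. F u * indicator {1 - c..<1} u + F u * indicator {0..<1 - c} u \<partial>lborel)"
    by (rule nn_integral_add[symmetric]) auto
  also have "\<dots> = (\<integral>\<^sup>+t. F t * indicator {0..<1} t \<partial>lborel)"
    using c by (intro nn_integral_cong) (auto split: split_indicator)
  finally show ?thesis .
qed

abbreviation turn :: "real \<Rightarrow> complex" where "turn t \<equiv> cis (2 * pi * t)"

lemma turn_surj:
  assumes "s \<in> sphere 0 1" obtains t where "0 \<le> t" "t < 1" "s = turn t"
proof -
  have "s = turn (Arg2pi s / (2 * pi))"
    using Arg2pi_eq[of s] assms by (simp add: cis_conv_exp mult.commute)
  then show thesis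
    using that[of "Arg2pi s / (2 * pi)"] Arg2pi[of s] by (auto simp: divide_simps)
qed

definition circle_measure :: "complex measure" where
  "circle_measure = distr (restrict_space lborel {0..<1}) (restrict_space borel (sphere 0 1)) turn"

lemma measurable_turn: "turn \<in> measurable (restrict_space lborel A) (restrict_space borel (sphere 0 1))"
proof (rule measurable_restrict_space1, rule measurable_restrict_space2)
  have "continuous_on UNIV turn"
    unfolding cis_conv_exp by (intro continuous_intros)
  then show "turn \<in> lborel \<rightarrow>\<^sub>M borel"
    using borel_measurable_continuous_onI by simp
qed auto

lemma sets_circle_measure: "sets circle_measure = sets (restrict_space borel (sphere 0 1))"
  by (simp add: circle_measure_def)

lemma space_circle_measure: "space circle_measure = sphere 0 1"
  by (simp add: circle_measure_def space_restrict_space)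

lemma prob_space_circle_measure: "prob_space circle_measure"
  unfolding circle_measure_def
proof (rule prob_space.prob_space_distr[OF _ measurable_turn])
  show "prob_space (restrict_space lborel {0..<1::real})"
    by (rule prob_space_restrict_space) auto
qed

lemma emeasure_circle_measure:
  assumes "E \<in> sets circle_measure"
  shows "emeasure circle_measure E = (\<integral>\<^sup>+t. indicator E (turn t) * indicator {0..<1} t \<partial>lborel)"
proof -
  have E: "E \<in> sets (restrict_space borel (sphere 0 1))" using assms sets_circle_measure by simp
  have "emeasure circle_measure E = (\<integral>\<^sup>+s. indicator E s \<partial>circle_measure)"
    using assms by simp
  also have "\<dots> = (\<integral>\<^sup>+t. indicator E (turn t) \<partial>restrict_space lborel {0..<1})"
    unfolding circle_measure_def by (rule nn_integral_distr[OF measurable_turn]) (use E in auto)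
  also have "\<dots> = (\<integral>\<^sup>+t. indicator E (turn t) * indicator {0..<1} t \<partial>lborel)"
    by (rule nn_integral_restrict_space) auto
  finally show ?thesis .
qed

lemma emeasure_circle_measure_rotate:
  assumes s: "s \<in> sphere 0 1" and E: "E \<in> sets circle_measure"
  shows "(\<lambda>x. s * x) ` E \<in> sets circle_measure" "emeasure circle_measure ((\<lambda>x. s * x) ` E) = emeasure circle_measure E"
proof -
  obtain c where c: "0 \<le> c" "c < 1" "s = turn c" using turn_surj[OF s] .
  have s0: "s \<noteq> 0" using s by auto
  have Esub: "E \<subseteq> sphere 0 1" using sets.sets_into_space[OF E] space_circle_measure by simp
  have img: "(\<lambda>x. s * x) ` E = (\<lambda>x. inverse s * x) -` E \<inter> space circle_measure"
  proof -
    have "x \<in> (\<lambda>x. s * x) ` E \<longleftrightarrow> inverse s * x \<in> E" for x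
      using s0 by (auto simp: image_iff mult.assoc[symmetric] intro: bexI[of _ "inverse s * x"])
    moreover have "(\<lambda>x. s * x) ` E \<subseteq> sphere 0 1" using Esub s by (auto simp: norm_mult)
    ultimately show ?thesis unfolding space_circle_measure by blast
  qed
  have "(\<lambda>x. inverse s * x) \<in> measurable circle_measure circle_measure"
    unfolding measurable_cong_sets[OF sets_circle_measure sets_circle_measure]
    by (intro measurable_restrict_space3) (use s in \<open>auto simp: norm_mult norm_inverse\<close>)
  then show m: "(\<lambda>x. s * x) ` E \<in> sets circle_measure"
    unfolding img using E by (rule measurable_sets)
  define F where "F t = (indicator E (turn t) :: ennreal)" for t
  have [measurable]: "F \<in> borel_measurable borel"
  proof -
    have "turn \<in> measurable lborel (restrict_space borel (sphere 0 1))"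
      using measurable_turn[of UNIV] by simp
    moreover have "E \<in> sets (restrict_space borel (sphere 0 1))" using E sets_circle_measure by simp
    ultimately have "F \<in> borel_measurable lborel"
      unfolding F_def by (intro measurable_compose[OF _ borel_measurable_indicator])
    then show ?thesis by simp
  qed
  have "indicator ((\<lambda>x. s * x) ` E) (turn t) = F (t - c)" for t
  proof -
    have "turn t = s * turn (t - c)"
      unfolding c(3) cis_mult by (simp add: algebra_simps)
    then have "turn t \<in> (\<lambda>x. s * x) ` E \<longleftrightarrow> turn (t - c) \<in> E"
      using s0 by auto
    then show ?thesis by (simp add: F_def indicator_def)
  qed
  then have "emeasure circle_measure ((\<lambda>x. s * x) ` E) = (\<integral>\<^sup>+t. F (t - c) * indicator {0..<1} t \<partial>lborel)"
    unfolding emeasure_circle_measure[OF m] by simp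
  also have "\<dots> = (\<integral>\<^sup>+t. F t * indicator {0..<1} t \<partial>lborel)"
  proof (rule nn_integral_periodic_shift)
    show "F (t + 1) = F t" for t
    proof -
      have "turn (t + 1) = turn t * cis (2 * pi)"
        unfolding cis_mult by (simp add: algebra_simps)
      then show ?thesis by (simp add: F_def)
    qed
  qed (use c in auto)
  also have "\<dots> = emeasure circle_measure E"
    unfolding emeasure_circle_measure[OF E] F_def ..
  finally show "emeasure circle_measure ((\<lambda>x. s * x) ` E) = emeasure circle_measure E" .
qed

lemma integral_circle_measure_rotate:
  fixes f :: "complex \<Rightarrow> complex"
  assumes s: "s \<in> sphere 0 1" and f: "continuous_on (sphere 0 1) f"
  shows "(\<integral>x. f (x * s) \<partial>circle_measure) = (\<integral>x. f x \<partial>circle_measure)"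
proof -
  have s0: "s \<noteq> 0" using s by auto
  have meas: "(\<lambda>x. x * s) \<in> measurable circle_measure circle_measure"
    unfolding measurable_cong_sets[OF sets_circle_measure sets_circle_measure]
    by (intro measurable_restrict_space3) (use s in \<open>auto simp: norm_mult\<close>)
  have "distr circle_measure circle_measure (\<lambda>x. x * s) = circle_measure"
  proof (rule measure_eqI)
    fix E assume "E \<in> sets (distr circle_measure circle_measure (\<lambda>x. x * s))"
    then have E: "E \<in> sets circle_measure" by simp
    have inv: "inverse s \<in> sphere 0 1" using s by (simp add: norm_inverse)
    have Esub: "E \<subseteq> sphere 0 1" using sets.sets_into_space[OF E] space_circle_measure by simp
    have "(\<lambda>x. x * s) -` E \<inter> space circle_measure = (\<lambda>x. inverse s * x) ` E"
    proof -
      have "x \<in> (\<lambda>x. inverse s * x) ` E \<longleftrightarrow> x * s \<in> E" for x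
        using s0 by (auto simp: image_iff field_simps intro: bexI[of _ "x * s"])
      moreover have "(\<lambda>x. inverse s * x) ` E \<subseteq> sphere 0 1" using Esub s by (auto simp: norm_mult norm_inverse)
      ultimately show ?thesis unfolding space_circle_measure by blast
    qed
    then show "emeasure (distr circle_measure circle_measure (\<lambda>x. x * s)) E = emeasure circle_measure E"
      using emeasure_circle_measure_rotate(2)[OF inv E] by (simp add: emeasure_distr[OF meas E])
  qed simp
  moreover have "f \<in> borel_measurable circle_measure"
    unfolding measurable_cong_sets[OF sets_circle_measure refl] using f by (rule borel_measurable_continuous_on_restrict)
  ultimately show ?thesis
    using integral_distr[OF meas, of f] by simp
qed

lemma integral_circle_measure:
  fixes f :: "complex \<Rightarrow> complex"
  assumes f: "continuous_on (sphere 0 1) f"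
  shows "(\<integral>x. f x \<partial>circle_measure) = integral {0..1} (\<lambda>t. f (turn t))"
proof -
  have "f \<in> borel_measurable (restrict_space borel (sphere 0 1))"
    using f by (rule borel_measurable_continuous_on_restrict)
  then have "(\<integral>x. f x \<partial>circle_measure) = (\<integral>t. f (turn t) \<partial>restrict_space lborel {0..<1})"
    unfolding circle_measure_def by (rule integral_distr[OF measurable_turn])
  also have "\<dots> = (\<integral>t. indicator {0..<1} t *\<^sub>R f (turn t) \<partial>lborel)"
    by (rule integral_restrict_space) auto
  also have "\<dots> = (LINT t:{0..1}|lborel. f (turn t))"
  proof -
    have cont: "continuous_on {0..1} (\<lambda>t. f (turn t))"
      by (rule continuous_on_compose2[OF f]) (auto simp: cis_conv_exp intro!: continuous_intros)
    have m: "(\<lambda>t. indicator {0..1} t *\<^sub>R f (turn t)) \<in> borel_measurable lborel"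
      using borel_measurable_continuous_on_indicator[OF _ cont] by simp
    have eq: "indicator {0..<1} t *\<^sub>R f (turn t) = indicator {0..<1} t *\<^sub>R (indicator {0..1} t *\<^sub>R f (turn t))" for t :: real
      by (auto split: split_indicator)
    have "(\<lambda>t. indicator {0..<1} t *\<^sub>R (indicator {0..1} t *\<^sub>R f (turn t))) \<in> borel_measurable lborel"
      by (rule borel_measurable_scaleR[OF _ m]) simp
    then have m': "(\<lambda>t. indicator {0..<1} t *\<^sub>R f (turn t)) \<in> borel_measurable lborel"
      by (simp only: eq[symmetric])
    have "AE t in lborel. t \<noteq> (1::real)" by (rule AE_lborel_singleton)
    then show ?thesis
      unfolding set_lebesgue_integral_def using m m'
      by (intro integral_cong_AE) (auto elim!: eventually_mono split: split_indicator)
  qed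
  also have "\<dots> = integral {0..1} (\<lambda>t. f (turn t))"
  proof (rule set_borel_integral_eq_integral)
    have cont: "continuous_on {0..1} (\<lambda>t. f (turn t))"
      by (rule continuous_on_compose2[OF f]) (auto simp: cis_conv_exp intro!: continuous_intros)
    then show "set_integrable lborel {0..1} (\<lambda>t. f (turn t))"
      by (rule borel_integrable_atLeastAtMost'[unfolded set_integrable_def[symmetric]])
  qed
  finally show ?thesis .
qed

lemma circle_group_simps [simp]:
  "carrier circle_group = sphere 0 1" "x \<otimes>\<^bsub>circle_group\<^esub> y = x * y" "\<one>\<^bsub>circle_group\<^esub> = 1"
  by (simp_all add: circle_group_def)

lemma group_circle_group: "group circle_group"
proof (rule groupI)
  fix x assume "x \<in> carrier circle_group"
  then show "\<exists>y\<in>carrier circle_group. y \<otimes>\<^bsub>circle_group\<^esub> x = \<one>\<^bsub>circle_group\<^esub>"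
    by (intro bexI[of _ "inverse x"]) (auto simp: norm_inverse intro!: left_inverse)
qed (auto simp: norm_mult)

lemma inv_circle_group: "x \<in> sphere 0 1 \<Longrightarrow> inv\<^bsub>circle_group\<^esub> x = inverse x"
  by (rule group.inv_equality[OF group_circle_group]) (auto simp: norm_inverse intro!: left_inverse)

lemma compact_group_circle_group: "compact_group circle_group"
  unfolding compact_group_def
proof (intro conjI group_circle_group)
  show "continuous_on (carrier circle_group) (\<lambda>s. inv\<^bsub>circle_group\<^esub> s)"
  proof (rule continuous_on_eq)
    show "continuous_on (carrier circle_group) inverse"
      by (intro continuous_intros) auto
  qed (simp add: inv_circle_group)
qed (auto simp: split_beta intro!: continuous_intros)

lemma Haar_circle_measure: "normalised_haar_measure circle_group circle_measure"
  unfolding normalised_haar_measure_def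
proof (intro conjI ballI)
  show "regular_borel_prob (carrier circle_group) circle_measure"
    by (rule regular_borel_probI) (auto simp: sets_circle_measure prob_space_circle_measure)
  fix s E assume "s \<in> carrier circle_group" "E \<in> sets circle_measure"
  moreover have "s <#\<^bsub>circle_group\<^esub> E = (\<lambda>x. s * x) ` E"
    by (auto simp: l_coset_def)
  ultimately show "emeasure circle_measure (s <#\<^bsub>circle_group\<^esub> E) = emeasure circle_measure E"
    using emeasure_circle_measure_rotate(2) by simp
qed

section \<open>Averaging over the fibres\<close>

lemma polynomial_funs_holomorphic_snd:
  assumes "p \<in> polynomial_funs {fst, snd}" shows "(\<lambda>w. p (z, w)) holomorphic_on S"
  using assms
proof induction
  case (coord c)
  then show ?case by (auto intro!: holomorphic_intros)
qed (intro holomorphic_intros; assumption)+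

lemma polynomial_funs_has_derivative_fst:
  assumes "p \<in> polynomial_funs {fst, snd}"
  shows "\<exists>p'\<in>polynomial_funs {fst, snd}. \<forall>z w. ((\<lambda>z. p (z, w)) has_field_derivative p' (z, w)) (at z)"
  using assms
proof induction
  case (const c)
  then show ?case by (intro bexI[OF _ polynomial_funs.const[of 0]]) (auto intro!: derivative_eq_intros)
next
  case (coord c)
  then consider "c = fst" | "c = snd" by auto
  then show ?case
  proof cases
    case 1
    then show ?thesis by (intro bexI[OF _ polynomial_funs.const[of 1]]) (auto intro!: derivative_eq_intros)
  next
    case 2
    then show ?thesis by (intro bexI[OF _ polynomial_funs.const[of 0]]) (auto intro!: derivative_eq_intros)
  qed
next
  case (add p q)
  then obtain p' q' where "p' \<in> polynomial_funs {fst, snd}" "q' \<in> polynomial_funs {fst, snd}"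
    "\<And>z w. ((\<lambda>z. p (z, w)) has_field_derivative p' (z, w)) (at z)" 
    "\<And>z w. ((\<lambda>z. q (z, w)) has_field_derivative q' (z, w)) (at z)" by blast
  then show ?case
    by (intro bexI[of _ "\<lambda>x. p' x + q' x"] polynomial_funs.add) (auto intro!: derivative_eq_intros)
next
  case (mult p q)
  then obtain p' q' where *: "p' \<in> polynomial_funs {fst, snd}" "q' \<in> polynomial_funs {fst, snd}"
    "\<And>z w. ((\<lambda>z. p (z, w)) has_field_derivative p' (z, w)) (at z)" 
    "\<And>z w. ((\<lambda>z. q (z, w)) has_field_derivative q' (z, w)) (at z)" by blast
  show ?case
  proof (intro bexI[of _ "\<lambda>x. p' x * q x + q' x * p x"] allI)
    show "((\<lambda>z. p (z, w) * q (z, w)) has_field_derivative (p' (z, w) * q (z, w) + q' (z, w) * p (z, w))) (at z)" for z w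
      by (rule DERIV_mult[OF *(3,4)])
  qed (intro polynomial_funs.add polynomial_funs.mult * mult.hyps)
qed

text \<open>
  The mean is \<open>1/(2 \<pi> \<i>)\<close> times the contour integral of \<open>h w / w\<close>, and concentric circles in an annulus are
  homotopic in it.
\<close>

lemma circle_mean_radius_independent:
  assumes h: "h holomorphic_on {w. r1 < cmod w \<and> cmod w < r2}" and r: "0 \<le> r1" "r1 < \<rho>" "\<rho> < r2" "r1 < \<rho>'" "\<rho>' < r2"
  shows "integral {0..1} (\<lambda>t. h (turn t * of_real \<rho>)) = integral {0..1} (\<lambda>t. h (turn t * of_real \<rho>'))"
proof -
  let ?A = "{w. r1 < cmod w \<and> cmod w < r2}"
  have circ: "circlepath 0 r t = turn t * of_real r" for r t
    by (simp add: circlepath cis_conv_exp mult_ac)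
  have mean: "contour_integral (circlepath 0 r) (\<lambda>w. h w / w) = 2 * pi * \<i> * integral {0..1} (\<lambda>t. h (turn t * of_real r))"
    if "0 < r" for r
  proof -
    have "contour_integral (circlepath 0 r) (\<lambda>w. h w / w) = integral {0..1} (\<lambda>t. (2 * pi * \<i>) * h (turn t * of_real r))"
      unfolding contour_integral_integral
    proof (rule Henstock_Kurzweil_Integration.integral_cong)
      fix t :: real
      have "vector_derivative (circlepath 0 r) (at t) = 2 * pi * \<i> * (turn t * of_real r)"
        by (simp add: vector_derivative_circlepath cis_conv_exp mult_ac)
      moreover have "turn t * of_real r \<noteq> 0" using that by simp
      ultimately show "h (circlepath 0 r t) / circlepath 0 r t * vector_derivative (circlepath 0 r) (at t) = 2 * pi * \<i> * h (turn t * of_real r)"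
        unfolding circ by simp
    qed
    then show ?thesis by simp
  qed
  have "contour_integral (circlepath 0 \<rho>) (\<lambda>w. h w / w) = contour_integral (circlepath 0 \<rho>') (\<lambda>w. h w / w)"
  proof (rule Cauchy_theorem_homotopic_loops)
    show "open ?A" by (intro open_Collect_conj open_Collect_less continuous_intros)
    show "(\<lambda>w. h w / w) holomorphic_on ?A"
      by (intro holomorphic_intros h) (use r(1) in auto)
    show "homotopic_loops ?A (circlepath 0 \<rho>) (circlepath 0 \<rho>')"
    proof (rule homotopic_loops_linear)
      fix t x assume "t \<in> {0..1::real}"
      show "closed_segment (circlepath 0 \<rho> t) (circlepath 0 \<rho>' t) \<subseteq> ?A"
      proof
        fix x assume "x \<in> closed_segment (circlepath 0 \<rho> t) (circlepath 0 \<rho>' t)"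
        then obtain u where u: "0 \<le> u" "u \<le> 1" "x = (1 - u) *\<^sub>R (turn t * of_real \<rho>) + u *\<^sub>R (turn t * of_real \<rho>')"
          unfolding closed_segment_def circ by blast
        define s where "s = (1 - u) * \<rho> + u * \<rho>'"
        have "x = turn t * of_real s"
          unfolding u(3) s_def by (simp add: scaleR_conv_of_real algebra_simps)
        moreover have "r1 < s" "s < r2"
          unfolding s_def using convex_bound_lt[of "\<rho>" r2 "\<rho>'" "1 - u" u] convex_bound_lt[of "- \<rho>" "- r1" "- \<rho>'" "1 - u" u] r u(1,2)
          by (auto simp: algebra_simps)
        ultimately show "x \<in> ?A" using r(1) by (simp add: norm_mult)
      qed
    qed auto
  qed auto
  then show ?thesis
    using mean[of \<rho>] mean[of \<rho>'] r by simp
qed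

context compact_in_disc
begin

definition fibre_average :: "(complex \<times> complex \<Rightarrow> complex) \<Rightarrow> complex \<Rightarrow> complex" where
  "fibre_average f = (\<lambda>z\<in>K. integral {0..1} (\<lambda>t. f (z, turn t * of_real (radius z))))"

lemma fibre_point_mem: "z \<in> K \<Longrightarrow> (z, turn t * of_real (radius z)) \<in> X"
  using radius_pos[of z] by (simp add: mem_X_iff norm_mult)

lemma continuous_on_fibre:
  assumes "continuous_on X f"
  shows "continuous_on (K \<times> S) (\<lambda>(z, t). f (z, turn t * of_real (radius z)))"
proof -
  have "continuous_on (K \<times> S) (\<lambda>x. turn (snd x))"
    unfolding cis_conv_exp by (intro continuous_intros)
  moreover have "continuous_on (K \<times> S) (\<lambda>x. radius (fst x))"
    by (rule continuous_on_compose2[OF continuous_radius[of UNIV]]) (auto intro: continuous_intros)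
  ultimately have "continuous_on (K \<times> S) (\<lambda>x. (fst x, turn (snd x) * of_real (radius (fst x))))"
    by (intro continuous_intros)
  then show ?thesis
    unfolding split_beta by (rule continuous_on_compose2[OF assms]) (auto simp: fibre_point_mem)
qed

lemma fibre_integrable:
  fixes f :: "complex \<times> complex \<Rightarrow> complex"
  assumes "continuous_on X f" "z \<in> K"
  shows "(\<lambda>t. f (z, turn t * of_real (radius z))) integrable_on {0..1}"
proof (rule integrable_continuous_real)
  have "continuous_on {0..1} (\<lambda>t. (\<lambda>(z, t). f (z, turn t * of_real (radius z))) (z, t))"
    by (rule continuous_on_compose2[OF continuous_on_fibre[OF assms(1), of UNIV]]) (use assms(2) in \<open>auto intro!: continuous_intros\<close>)
  then show "continuous_on {0..1} (\<lambda>t. f (z, turn t * of_real (radius z)))" by simp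
qed

lemma fibre_average_cfun:
  assumes "f \<in> cfun X" shows "fibre_average f \<in> cfun K"
proof -
  have "continuous_on K (\<lambda>z. integral (cbox 0 1) (\<lambda>t. f (z, turn t * of_real (radius z))))"
    by (rule integral_continuous_on_param, rule continuous_on_fibre) (use assms X.cfun_iff in blast)
  then show ?thesis
    unfolding K.cfun_iff fibre_average_def by (simp cong: continuous_on_cong)
qed

lemma fibre_average_add:
  assumes "f \<in> cfun X" "g \<in> cfun X"
  shows "fibre_average (\<lambda>x\<in>X. f x + g x) = (\<lambda>z\<in>K. fibre_average f z + fibre_average g z)"
proof (rule extensionalityI[of _ K])
  fix z assume z: "z \<in> K"
  have "continuous_on X f" "continuous_on X g" using assms X.cfun_iff by blast+
  then show "fibre_average (\<lambda>x\<in>X. f x + g x) z = (\<lambda>z\<in>K. fibre_average f z + fibre_average g z) z"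
    using z by (simp add: fibre_average_def fibre_point_mem integral_add fibre_integrable)
qed (auto simp: fibre_average_def)

lemma fibre_average_scale:
  "fibre_average (\<lambda>x\<in>X. c * f x) = (\<lambda>z\<in>K. c * fibre_average f z)"
  by (rule extensionalityI[of _ K]) (auto simp: fibre_average_def fibre_point_mem)

lemma fibre_average_pullback:
  assumes "f \<in> extensional K" shows "fibre_average (\<lambda>x\<in>X. f (fst x)) = f"
  by (rule extensionalityI[of _ K]) (use assms in \<open>auto simp: fibre_average_def fibre_point_mem\<close>)

lemma fibre_average_bound:
  assumes "f \<in> cfun X" "\<And>x. x \<in> X \<Longrightarrow> cmod (f x) \<le> b" "z \<in> K"
  shows "cmod (fibre_average f z) \<le> b"
proof -
  have "continuous_on X f" using assms X.cfun_iff by blast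
  have "cmod (integral {0..1} (\<lambda>t. f (z, turn t * of_real (radius z)))) \<le> b * (1 - 0)"
  proof (rule integral_bound)
    have "continuous_on {0..1} (\<lambda>t. (\<lambda>(z, t). f (z, turn t * of_real (radius z))) (z, t))"
      by (rule continuous_on_compose2[OF continuous_on_fibre[OF \<open>continuous_on X f\<close>, of UNIV]]) (use assms(3) in \<open>auto intro!: continuous_intros\<close>)
    then show "continuous_on {0..1} (\<lambda>t. f (z, turn t * of_real (radius z)))" by simp
  qed (use assms fibre_point_mem in auto)
  then show ?thesis using assms(3) by (simp add: fibre_average_def)
qed

text \<open>
  The radius \<open>r z\<close> is not holomorphic in \<open>z\<close>.  But the zeros of the denominator avoid the circle over
  \<open>z0\<close>, hence, for \<open>z\<close> near \<open>z0\<close>, a whole annulus around it; so the circle over \<open>z\<close> can be replaced by the one over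
  \<open>z0\<close>, and the integral over a fixed circle depends holomorphically on \<open>z\<close>.
\<close>

lemma fibre_average_rational:
  assumes "f \<in> rational_funs {fst, snd} X" shows "fibre_average f \<in> R_1 K"
proof -
  obtain p q where p: "p \<in> polynomial_funs {fst, snd}" and q: "q \<in> polynomial_funs {fst, snd}" 
    and nz: "\<forall>x\<in>X. q x \<noteq> 0" and f: "\<And>x. x \<in> X \<Longrightarrow> f x = p x / q x"
    using X.rational_funsE[OF assms] by metis
  have cont: "continuous_on S g" if "g \<in> polynomial_funs {fst, snd :: complex \<times> complex \<Rightarrow> complex}" for g S
    using that by (rule polynomial_funs_continuous_on[rotated]) (auto intro: continuous_intros)
  define F where "F z = integral {0..1} (\<lambda>t. p (z, turn t * of_real (radius z)) / q (z, turn t * of_real (radius z)))" for z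
  have "\<exists>\<delta>>0. F holomorphic_on ball z0 \<delta>" if z0: "z0 \<in> K" for z0
  proof -
    define r0 where "r0 = radius z0"
    have r0: "0 < r0" using radius_pos[OF z0] by (simp add: r0_def)
    have "compact ({z0} \<times> sphere (0::complex) r0)" by (intro compact_Times) auto
    moreover have "open {x. q x \<noteq> 0}"
      using cont[OF q] by (intro open_Collect_neq) auto
    moreover have "{z0} \<times> sphere 0 r0 \<subseteq> {x. q x \<noteq> 0}"
      using nz z0 by (auto simp: mem_X_iff r0_def)
    ultimately obtain e where e: "0 < e" "(\<Union>x\<in>{z0} \<times> sphere 0 r0. cball x e) \<subseteq> {x. q x \<noteq> 0}"
      by (rule compact_subset_open_imp_cball_epsilon_subset)
    define \<eta> where "\<eta> = min (e / 2) r0"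
    have \<eta>: "0 < \<eta>" "\<eta> \<le> e / 2" "\<eta> \<le> r0" using e r0 by (auto simp: \<eta>_def)
    obtain \<delta>0 where \<delta>0: "0 < \<delta>0" "\<And>z. dist z z0 < \<delta>0 \<Longrightarrow> dist (radius z) (radius z0) < \<eta>"
      using continuous_radius[of UNIV] \<eta>(1) unfolding continuous_on_iff by (metis UNIV_I)
    define \<delta> where "\<delta> = min \<delta>0 (e / 2)"
    have \<delta>: "0 < \<delta>" using \<delta>0 e by (simp add: \<delta>_def)
    let ?A = "{w. r0 - \<eta> < cmod w \<and> cmod w < r0 + \<eta>}"
    have q0: "q (z, w) \<noteq> 0" if z: "z \<in> ball z0 \<delta>" and w: "w \<in> ?A" for z w
    proof -
      have w0: "0 < cmod w" using w \<eta> by auto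
      \<comment> \<open>The radial projection of \<open>w\<close> to the circle of radius \<open>r0\<close>.\<close>
      define w' where "w' = of_real (r0 / cmod w) * w"
      have w': "cmod w' = r0" using w0 r0 by (simp add: w'_def norm_mult norm_divide)
      have "w' - w = of_real (r0 / cmod w - 1) * w" by (simp add: w'_def algebra_simps)
      then have "cmod (w' - w) = \<bar>r0 / cmod w - 1\<bar> * \<bar>cmod w\<bar>"
        by (simp only: norm_mult norm_of_real abs_norm_cancel)
      also have "\<dots> = \<bar>r0 - cmod w\<bar>"
        unfolding abs_mult[symmetric] using w0 by (simp add: left_diff_distrib)
      also have "\<dots> < e / 2" using w \<eta>(2) unfolding mem_Collect_eq by linarith
      finally have "dist w' w < e / 2" by (simp add: dist_norm)
      moreover have "dist z0 z < e / 2" using z by (simp add: \<delta>_def)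
      moreover have "dist (z0, w') (z, w) \<le> dist z0 z + dist w' w"
        unfolding dist_Pair_Pair by (rule sqrt_sum_squares_le_sum) auto
      ultimately have "(z, w) \<in> cball (z0, w') e" by simp
      then show ?thesis using e(2) w' by force
    qed
    have eq: "F z = integral (cbox 0 1) (\<lambda>t. p (z, turn t * of_real r0) / q (z, turn t * of_real r0))" if z: "z \<in> ball z0 \<delta>" for z
    proof -
      have "\<bar>radius z - r0\<bar> < \<eta>"
        using \<delta>0(2)[of z] z by (simp add: \<delta>_def dist_commute dist_real_def r0_def)
      then show ?thesis
        unfolding F_def cbox_interval using \<eta> z q0
        by (intro circle_mean_radius_independent[of "\<lambda>w. p (z, w) / q (z, w)" "r0 - \<eta>" "r0 + \<eta>"]
            holomorphic_on_divide polynomial_funs_holomorphic_snd p q) auto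
    qed
    have hol: "(\<lambda>z. integral (cbox 0 1) (\<lambda>t. p (z, turn t * of_real r0) / q (z, turn t * of_real r0))) holomorphic_on ball z0 \<delta>"
    proof -
      obtain p' q' where p': "p' \<in> polynomial_funs {fst, snd}" "\<And>z w. ((\<lambda>z. p (z, w)) has_field_derivative p' (z, w)) (at z)"
        and q': "q' \<in> polynomial_funs {fst, snd}" "\<And>z w. ((\<lambda>z. q (z, w)) has_field_derivative q' (z, w)) (at z)"
        using polynomial_funs_has_derivative_fst[OF p] polynomial_funs_has_derivative_fst[OF q] by metis
      have q1: "q (z, turn t * of_real r0) \<noteq> 0" if "z \<in> ball z0 \<delta>" for z t
        using that by (rule q0) (use r0 \<eta> in \<open>simp add: norm_mult\<close>)
      have turn: "continuous_on S turn" for S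
        unfolding cis_conv_exp by (intro continuous_intros)
      have comp: "continuous_on S (\<lambda>x. g (fst x, turn (snd x) * of_real r0))" if "g \<in> polynomial_funs {fst, snd :: complex \<times> complex \<Rightarrow> complex}" for g and S :: "(complex \<times> real) set"
        by (rule continuous_on_compose2[OF cont[OF that, of UNIV]])
          (auto intro!: continuous_intros continuous_on_compose2[OF turn[of UNIV]])
      show ?thesis
      proof (rule leibniz_rule_holomorphic)
        fix z t assume z: "z \<in> ball z0 \<delta>"
        show "((\<lambda>z. p (z, turn t * of_real r0) / q (z, turn t * of_real r0)) has_field_derivative
           (p' (z, turn t * of_real r0) * q (z, turn t * of_real r0) - p (z, turn t * of_real r0) * q' (z, turn t * of_real r0)) 
             / (q (z, turn t * of_real r0) * q (z, turn t * of_real r0))) (at z within ball z0 \<delta>)"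
          by (intro DERIV_divide DERIV_subset[OF p'(2)] DERIV_subset[OF q'(2)] q1 z) auto
      next
        fix z assume z: "z \<in> ball z0 \<delta>"
        have cg: "continuous_on (cbox 0 1) (\<lambda>t. g (z, turn t * of_real r0))" if "g \<in> polynomial_funs {fst, snd :: complex \<times> complex \<Rightarrow> complex}" for g
          by (rule continuous_on_compose2[OF cont[OF that, of UNIV]])
            (auto intro!: continuous_intros continuous_on_compose2[OF turn[of UNIV]])
        show "(\<lambda>t. p (z, turn t * of_real r0) / q (z, turn t * of_real r0)) integrable_on cbox 0 1"
          by (intro integrable_continuous continuous_on_divide cg p q) (use q1[OF z] in auto)
      next
        show "continuous_on (ball z0 \<delta> \<times> cbox 0 1) (\<lambda>(z, t). (p' (z, turn t * of_real r0) * q (z, turn t * of_real r0) - p (z, turn t * of_real r0) * q' (z, turn t * of_real r0)) 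
             / (q (z, turn t * of_real r0) * q (z, turn t * of_real r0)))"
          unfolding split_beta
          by (intro continuous_on_divide continuous_on_diff continuous_on_mult comp p q p' q') (use q1 in auto)
      qed auto
    qed
    have "F holomorphic_on ball z0 \<delta>"
      by (rule holomorphic_cong[THEN iffD2, OF refl eq hol])
    then show ?thesis using \<delta> by blast
  qed
  then obtain \<delta> where \<delta>: "\<And>z. z \<in> K \<Longrightarrow> 0 < \<delta> z" "\<And>z. z \<in> K \<Longrightarrow> F holomorphic_on ball z (\<delta> z)"
    by metis
  have "F holomorphic_on (\<Union>z\<in>K. ball z (\<delta> z))"
    by (rule holomorphic_on_UN_open) (use \<delta> in auto)
  moreover have "K \<subseteq> (\<Union>z\<in>K. ball z (\<delta> z))" using \<delta>(1) by force
  ultimately have "restrict F K \<in> R_1 K"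
    by (intro Runge_R_1[OF compact_K, of "\<Union>z\<in>K. ball z (\<delta> z)"]) auto
  moreover have "fibre_average f = restrict F K"
    unfolding fibre_average_def F_def by (rule restrict_ext) (simp add: f fibre_point_mem)
  ultimately show ?thesis by simp
qed

lemma fibre_average_mem:
  assumes f: "f \<in> R_2 X" shows "fibre_average f \<in> R_1 K"
proof (rule K.closed_mem)
  have fc: "f \<in> cfun X" by (rule X.mem_cfun[OF f])
  show "fibre_average f \<in> cfun K" by (rule fibre_average_cfun[OF fc])
  fix e :: real assume "0 < e"
  then obtain r where r: "r \<in> rational_funs {fst, snd} X" "\<forall>x\<in>X. cmod (f x - r x) \<le> e"
    using f unfolding X.mem_iff_approx by blast
  have rc: "r \<in> cfun X" using r X.rational_funs_subset_cfun by blast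
  define d where "d = (\<lambda>x\<in>X. f x - r x)"
  have dc: "d \<in> cfun X"
    using fc rc unfolding X.cfun_iff d_def by (auto intro!: continuous_intros cong: continuous_on_cong)
  have "f = (\<lambda>x\<in>X. d x + r x)"
    using fc unfolding X.cfun_iff d_def by (intro extensionalityI[of _ X]) auto
  then have "fibre_average f = (\<lambda>z\<in>K. fibre_average d z + fibre_average r z)"
    using fibre_average_add[OF dc rc] by simp
  moreover have "cmod (fibre_average d z) \<le> e" if "z \<in> K" for z
    by (rule fibre_average_bound[OF dc _ that]) (use r(2) in \<open>simp add: d_def\<close>)
  ultimately show "\<exists>g\<in>R_1 K. \<forall>z\<in>K. cmod (fibre_average f z - g z) \<le> e"
    by (intro bexI[OF _ fibre_average_rational[OF r(1)]]) simp
qed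

end

section \<open>The circle action and the Cole extension\<close>

context compact_in_disc
begin

lemma circle_act_eq: "(z, w) \<in> X \<Longrightarrow> circle_act K s (z, w) = (z, s * w)"
  by (simp add: circle_act_def)

lemma circle_act_mem: "s \<in> sphere 0 1 \<Longrightarrow> x \<in> X \<Longrightarrow> circle_act K s x \<in> X"
  by (cases x) (simp add: circle_act_eq mem_X_iff norm_mult)

lemma circle_act_mult:
  assumes "s \<in> sphere 0 1" "t \<in> sphere 0 1" "x \<in> X"
  shows "circle_act K (s * t) x = circle_act K s (circle_act K t x)"
  using assms circle_act_mem[OF assms(2,3)] by (cases x) (simp add: circle_act_eq mult.assoc)

lemma circle_act_Bij:
  assumes "s \<in> sphere 0 1" shows "circle_act K s \<in> Bij X"
proof -
  have inv: "inverse s \<in> sphere 0 1" "s * inverse s = 1" "inverse s * s = 1"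
    using assms by (auto simp: norm_inverse intro!: left_inverse right_inverse)
  have one: "circle_act K 1 x = x" if "x \<in> X" for x
    using that by (cases x) (simp add: circle_act_eq)
  have "bij_betw (circle_act K s) X X"
    by (rule bij_betwI[where g = "circle_act K (inverse s)"])
      (use assms inv one in \<open>auto simp: circle_act_mem circle_act_mult[symmetric]\<close>)
  then show ?thesis
    by (simp add: Bij_def circle_act_def)
qed

theorem continuous_action_circle: "continuous_action circle_group X (circle_act K)"
  unfolding continuous_action_def
proof
  show "group_action circle_group X (circle_act K)"
  proof (intro group_action.intro group_hom.intro group_hom_axioms.intro group_circle_group group_BijGroup homI)
    fix s assume "s \<in> carrier circle_group"
    then show "circle_act K s \<in> carrier (BijGroup X)"
      using circle_act_Bij by (simp add: BijGroup_def)
  next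
    fix s t assume st: "s \<in> carrier circle_group" "t \<in> carrier circle_group"
    have "circle_act K (s * t) = compose X (circle_act K s) (circle_act K t)"
    proof (rule extensionalityI[of _ X])
      show "circle_act K (s * t) x = compose X (circle_act K s) (circle_act K t) x" if "x \<in> X" for x
        using circle_act_mult[of s t x] st that by (simp add: compose_def)
    qed (simp_all add: circle_act_def)
    then show "circle_act K (s \<otimes>\<^bsub>circle_group\<^esub> t) = circle_act K s \<otimes>\<^bsub>BijGroup X\<^esub> circle_act K t"
      using st circle_act_Bij by (simp add: BijGroup_def)
  qed
  have "continuous_on (sphere 0 1 \<times> X) (\<lambda>p. (fst (snd p), fst p * snd (snd p)))"
    by (intro continuous_intros)
  then show "continuous_on (carrier circle_group \<times> X) (\<lambda>(s, x). circle_act K s x)"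
    unfolding circle_group_simps by (rule continuous_on_eq) (auto simp: circle_act_eq)
qed

lemma orbit_circle_act:
  assumes x: "x \<in> X" shows "orbit circle_group (circle_act K) x = {y \<in> X. fst y = fst x}"
proof
  show "orbit circle_group (circle_act K) x \<subseteq> {y \<in> X. fst y = fst x}"
    using x circle_act_mem by (cases x) (auto simp: orbit_def circle_act_eq)
  show "{y \<in> X. fst y = fst x} \<subseteq> orbit circle_group (circle_act K) x"
  proof
    fix y assume y: "y \<in> {y \<in> X. fst y = fst x}"
    obtain z w where zw: "x = (z, w)" by (cases x)
    obtain v where v: "y = (z, v)" using y zw by (cases y) auto
    have "z \<in> K" "cmod w = radius z" "cmod v = radius z"
      using x y by (auto simp: zw v mem_X_iff)
    then have "w \<noteq> 0" "v / w \<in> sphere 0 1"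
      using radius_pos[of z] by (auto simp: norm_divide)
    moreover have "circle_act K (v / w) x = y"
      using x \<open>w \<noteq> 0\<close> by (simp add: zw v circle_act_eq)
    ultimately show "y \<in> orbit circle_group (circle_act K) x"
      unfolding orbit_def by (auto intro!: exI[of _ "v / w"])
  qed
qed

text \<open>
  The average was taken from the base point \<open>(z, r z)\<close> of the fibre; invariance of Haar measure moves the
  base point to any other point of the orbit.
\<close>

lemma fibre_average_eq_orbit_integral:
  assumes f: "f \<in> cfun X" and x: "x \<in> X"
  shows "fibre_average f (fst x) = (\<integral>s. f (circle_act K s x) \<partial>circle_measure)"
proof -
  obtain z w where zw: "x = (z, w)" by (cases x)
  have z: "z \<in> K" "cmod w = radius z" using x by (auto simp: zw mem_X_iff)
  have rz: "0 < radius z" by (rule radius_pos[OF z(1)])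
  define s0 where "s0 = w / of_real (radius z)"
  have s0: "s0 \<in> sphere 0 1" using z rz by (simp add: s0_def norm_divide)
  have w: "w = s0 * of_real (radius z)" using rz by (simp add: s0_def)
  have fc: "continuous_on X f" using f X.cfun_iff by blast
  have cont: "continuous_on (sphere 0 1) (\<lambda>s. f (z, s * of_real (radius z)))"
    by (rule continuous_on_compose2[OF fc])
      (use z rz in \<open>auto simp: mem_X_iff norm_mult intro!: continuous_intros\<close>)
  have "(\<integral>s. f (circle_act K s x) \<partial>circle_measure) = (\<integral>s. f (z, (s * s0) * of_real (radius z)) \<partial>circle_measure)"
    using x by (simp add: zw circle_act_eq w mult.assoc)
  also have "\<dots> = (\<integral>s. f (z, s * of_real (radius z)) \<partial>circle_measure)"
    by (rule integral_circle_measure_rotate[OF s0 cont])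
  also have "\<dots> = integral {0..1} (\<lambda>t. f (z, turn t * of_real (radius z)))"
    by (rule integral_circle_measure[OF cont])
  finally show ?thesis using z(1) by (simp add: zw fibre_average_def)
qed

lemma has_op_norm_fibre_average:
  assumes ne: "K \<noteq> {}" shows "has_op_norm X K fibre_average 1"
proof -
  let ?S = "{sup_norm K (fibre_average f) | f. f \<in> cfun X \<and> sup_norm X f \<le> 1}"
  have le: "s \<le> 1" if "s \<in> ?S" for s
  proof -
    obtain f where f: "f \<in> cfun X" "sup_norm X f \<le> 1" and s: "s = sup_norm K (fibre_average f)"
      using \<open>s \<in> ?S\<close> by blast
    have "continuous_on X f" using f X.cfun_iff by blast
    then have "continuous_on X (\<lambda>x. cmod (f x))" by (intro continuous_intros)
    then have bdd: "bdd_above ((\<lambda>x. cmod (f x)) ` X)"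
      by (intro bounded_imp_bdd_above compact_imp_bounded compact_continuous_image X.compact_space)
    have "cmod (f x) \<le> 1" if "x \<in> X" for x
      using cSUP_upper[OF that bdd] f(2) unfolding sup_norm_def by linarith
    then show ?thesis
      unfolding s sup_norm_def by (intro cSUP_least ne fibre_average_bound[OF f(1)])
  qed
  have one: "1 \<in> ?S"
  proof -
    have "X \<noteq> {}" using ne fst_X by auto
    then have "sup_norm X (\<lambda>x\<in>X. 1) = 1" by (simp add: sup_norm_def)
    moreover have "fibre_average (\<lambda>x\<in>X. 1) = (\<lambda>z\<in>K. 1)"
      unfolding fibre_average_def by (rule restrict_ext) (simp add: fibre_point_mem)
    then have "sup_norm K (fibre_average (\<lambda>x\<in>X. 1)) = 1" using ne by (simp add: sup_norm_def)
    ultimately show ?thesis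
      using X.mem_cfun[OF X.const_mem[of 1]] by (intro CollectI exI[of _ "\<lambda>x\<in>X. 1"]) (simp del: mspace_cfunspace)
  qed
  show ?thesis
    unfolding has_op_norm_def Let_def
    by (intro conjI cSup_eq_maximum[OF one le] bdd_aboveI[of _ 1] le)
qed

lemma cole_extension_via_fibre_average:
  assumes ne: "K \<noteq> {}"
  shows "cole_extension_via X (R_2 X) K (R_1 K) fst fibre_average"
  unfolding cole_extension_via_def
proof (intro conjI)
  show "uniform_algebra X (R_2 X)" by (rule uniform_algebra_R_2[OF ne])
  show "uniform_algebra K (R_1 K)" by (rule uniform_algebra_R_1[OF ne])
  show "continuous_on X fst" by (intro continuous_intros)
  show "fst ` X = K" by (rule fst_X)
  show "has_op_norm X K fibre_average 1" by (rule has_op_norm_fibre_average[OF ne])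
  have one: "fibre_average (\<lambda>x\<in>X. 1) = (\<lambda>z\<in>K. 1)"
    unfolding fibre_average_def by (rule restrict_ext) (simp add: fibre_point_mem)
  show "unital_linear_map X K fibre_average"
    unfolding unital_linear_map_def
    by (intro conjI ballI allI Pi_I one fibre_average_cfun fibre_average_add fibre_average_scale)
  show "\<forall>f\<in>cfun K. fibre_average (\<lambda>x\<in>X. f (fst x)) = f"
    using fibre_average_pullback K.cfun_iff by blast
  show "fibre_average ` R_2 X = R_1 K"
  proof
    show "fibre_average ` R_2 X \<subseteq> R_1 K" using fibre_average_mem by blast
    show "R_1 K \<subseteq> fibre_average ` R_2 X"
    proof
      fix f assume f: "f \<in> R_1 K"
      then have "f = fibre_average (\<lambda>x\<in>X. f (fst x))"
        using fibre_average_pullback K.mem_cfun K.cfun_iff by metis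
      then show "f \<in> fibre_average ` R_2 X" using pullback_mem[OF f] by blast
    qed
  qed
qed

end

theorem proposition4p17:
  fixes K :: "complex set"
  assumes "compact K"
    and "K \<subseteq> ball 0 1"
    and "R_1 K \<noteq> cfun K"
    and "no_nontrivial_jensen_measures K (R_1 K)"
  shows "natural_on (X_over K) (R_2 (X_over K)) \<and>
    continuous_action circle_group (X_over K) (circle_act K) \<and>
    generalised_cole_extension (X_over K) (R_2 (X_over K)) K (R_1 K) \<and>
    cole_extension_implemented_by (X_over K) (R_2 (X_over K)) K (R_1 K) circle_group (circle_act K)"
proof -
  interpret compact_in_disc K
    using assms(1,2) by unfold_locales
  \<comment> \<open>On the empty set all functions agree, so \<open>R(K)\<close> would be all of \<open>C(K)\<close>.\<close>
  have ne: "K \<noteq> {}"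
  proof
    assume "K = {}"
    then have only: "f = (\<lambda>z\<in>K. 0)" if "f \<in> cfun K" for f
      using that unfolding K.cfun_iff by (auto simp: extensional_def)
    have "f \<in> R_1 K" if "f \<in> cfun K" for f
      unfolding only[OF that] by (rule K.const_mem)
    then show False using assms(3) K.mem_cfun by blast
  qed
  have via: "cole_extension_via X (R_2 X) K (R_1 K) fst fibre_average"
    by (rule cole_extension_via_fibre_average[OF ne])
  have "cole_extension_implemented_by X (R_2 X) K (R_1 K) circle_group (circle_act K)"
    unfolding cole_extension_implemented_by_def
  proof (intro conjI compact_group_circle_group continuous_action_circle exI[of _ fst]
      exI[of _ fibre_average] exI[of _ circle_measure] via Haar_circle_measure ballI)
    show "orbit circle_group (circle_act K) y = {y' \<in> X. fst y' = fst y}" if "y \<in> X" for y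
      by (rule orbit_circle_act[OF that])
    show "fibre_average f (fst y) = (\<integral>s. f (circle_act K s y) \<partial>circle_measure)" if "f \<in> R_2 X" "y \<in> X" for f y
      by (rule fibre_average_eq_orbit_integral[OF X.mem_cfun[OF that(1)] that(2)])
  qed
  then show ?thesis
    using natural_R_2[OF assms(4)] continuous_action_circle via unfolding generalised_cole_extension_def by blast
qed

end
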